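(* Let $g\geqslant1$ and let $f\in\mathbb{C}[x]$ be a polynomial of degree $2g+1$, without multiple roots, such that $f(0)=1$. Denote by $\Gamma_f$ the non-singular affine curve of genus $g$ defined by $y^2=f(x)$, and by $\bar\Gamma_f$ its completion. Then $\mu^{-1}(f)$ is isomorphic to an affine part of the Jacobian variety of $\bar\Gamma_f$, namely the Jacobian minus three translates of the theta divisor: $$\mu^{-1}(f)\cong\mathrm{Jac}(\bar\Gamma_f)\setminus(\Theta\cup\Theta_+\cup\Theta_-).$$ The $(-1)$-involution on $\mathrm{Jac}(\bar\Gamma_f)$ leaves $\Theta$ invariant and permutes $\Theta_+$ and $\Theta_-$.
   Context: $M_g$ is the affine space of triplets $(\mathcal{P},\mathcal{Q},\mathcal{R})$ of complex polynomials with $\deg\mathcal{P}\leqslant g$, $\mathcal{P}(0)=1$; $\deg\mathcal{Q}\leqslant g$, $\mathcal{Q}(0)=2$; $\deg\mathcal{R}\leqslant g+1$, $\mathcal{R}(0)=0$. The map $\mu:M_g\to\mathbb{C}[x]$ is $\mu(\mathcal{P},\mathcal{Q},\mathcal{R})=\mathcal{P}^2+\mathcal{Q}\mathcal{R}$. Since $\deg f$ is odd, $\bar\Gamma_f=\Gamma_f\cup\{\infty\}$. $\mathrm{Jac}(\bar\Gamma_f)$ is the group of degree zero divisors on $\bar\Gamma_f$ modulo linear equivalence, $[D]$ denoting the class of $D$. The theta divisor is $\Theta=\{[\sum_{i=1}^{g-1}P_i-(g-1)\infty]\mid P_i\in\bar\Gamma_f\}$, and $\Theta_\pm=\Theta+[(0,\pm1)-\infty]$,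 where $(0,\pm1)\in\Gamma_f$. *)

theory Defs
  imports
    "HOL-Analysis.Abstract_Topology"
    "HOL-Algebra.Free_Abelian_Groups"
    "HOL-Computational_Algebra.Polynomial"
begin

section \<open>Spaces with functions and algebraic atlases\<close>

text \<open>
  Complex algebraic varieties are treated in the classical language: a set of points with its
  Zariski topology and the sheaf of regular complex-valued functions on it.
  HOL functions being total, a function is regular on \<open>U\<close> or not according to its values on \<open>U\<close> only.
\<close>

record 'a fspace =
  zariski :: "'a topology"
  regular :: "'a set \<Rightarrow> ('a \<Rightarrow> complex) set"

definition fspace_morphism :: "'a fspace \<Rightarrow> 'b fspace \<Rightarrow> ('a \<Rightarrow> 'b) \<Rightarrow> bool" where
  "fspace_morphism X Y \<phi> \<longleftrightarrow>
     continuous_map (zariski X) (zariski Y) \<phi> \<and>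
     (\<forall>V h. openin (zariski Y) V \<and> h \<in> regular Y V \<longrightarrow>
        h \<circ> \<phi> \<in> regular X {x \<in> topspace (zariski X). \<phi> x \<in> V})"

definition fspace_isomorphic :: "'a fspace \<Rightarrow> 'b fspace \<Rightarrow> bool" where
  "fspace_isomorphic X Y \<longleftrightarrow>
     (\<exists>\<phi> \<psi>. fspace_morphism X Y \<phi> \<and> fspace_morphism Y X \<psi> \<and>
        (\<forall>x \<in> topspace (zariski X). \<psi> (\<phi> x) = x) \<and>
        (\<forall>y \<in> topspace (zariski Y). \<phi> (\<psi> y) = y))"

text \<open>Only meant for \<open>U\<close> open in \<open>X\<close>.\<close>

definition open_subspace :: "'a fspace \<Rightarrow> 'a set \<Rightarrow> 'a fspace" where
  "open_subspace X U = \<lparr>zariski = subtopology (zariski X) U, regular = regular X\<rparr>"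

text \<open>The algebra of polynomial expressions, with complex coefficients, in the functions of \<open>S\<close>.\<close>

inductive_set polyfuns :: "('a \<Rightarrow> complex) set \<Rightarrow> ('a \<Rightarrow> complex) set"
  for S :: "('a \<Rightarrow> complex) set" where
  gen: "s \<in> S \<Longrightarrow> s \<in> polyfuns S"
| const: "(\<lambda>_. c) \<in> polyfuns S"
| add: "p \<in> polyfuns S \<Longrightarrow> q \<in> polyfuns S \<Longrightarrow> (\<lambda>x. p x + q x) \<in> polyfuns S"
| mult: "p \<in> polyfuns S \<Longrightarrow> q \<in> polyfuns S \<Longrightarrow> (\<lambda>x. p x * q x) \<in> polyfuns S"

text \<open>
  A chart \<open>(U, S)\<close> consists of a set \<open>U\<close> and of functions that embed \<open>U\<close> as a closed algebraic
  subset of an affine space. The charts of an atlas are glued along their overlaps, which have to be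
  open in, and to carry the same structure from, both charts.
\<close>

type_synonym 'a chart = "'a set \<times> ('a \<Rightarrow> complex) set"

definition atlas_topology :: "'a chart set \<Rightarrow> 'a topology" where
  "atlas_topology A = topology_generated_by {{x \<in> U. p x \<noteq> 0} | U S p. (U, S) \<in> A \<and> p \<in> polyfuns S}"

definition atlas_space :: "'a chart set \<Rightarrow> 'a fspace" where
  "atlas_space A = \<lparr>
     zariski = atlas_topology A,
     regular = (\<lambda>W. {h. \<forall>x \<in> W. \<exists>(U, S) \<in> A. \<exists>p \<in> polyfuns S. \<exists>q \<in> polyfuns S. \<exists>V.
        openin (atlas_topology A) V \<and> x \<in> V \<and> V \<subseteq> W \<inter> U \<and>
        (\<forall>z \<in> V. q z \<noteq> 0 \<and> h z = p z / q z)})\<rparr>"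

definition power_atlas :: "nat \<Rightarrow> 'a chart set \<Rightarrow> (nat \<Rightarrow> 'a) chart set" where
  "power_atlas n A =
     {(\<Pi>\<^sub>E i\<in>{..<n}. fst (c i), {(\<lambda>x. s (x i)) | i s. i < n \<and> s \<in> snd (c i)}) | c.
        \<forall>i<n. c i \<in> A}"

text \<open>
  The quotient of \<open>X\<close> by a map \<open>\<pi>\<close> onto \<open>T\<close>: the finest topology on \<open>T\<close> and the largest sheaf of
  functions on \<open>T\<close> for which \<open>\<pi>\<close> is a morphism.
\<close>

definition quotient_space :: "'a fspace \<Rightarrow> ('a \<Rightarrow> 'b) \<Rightarrow> 'b set \<Rightarrow> 'b fspace" where
  "quotient_space X \<pi> T = \<lparr>
     zariski = topology (\<lambda>V. V \<subseteq> T \<and> openin (zariski X) {x \<in> topspace (zariski X). \<pi> x \<in> V}),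
     regular = (\<lambda>V. {h. h \<circ> \<pi> \<in> regular X {x \<in> topspace (zariski X). \<pi> x \<in> V}})\<rparr>"

lemma openin_quotient_space:
  "openin (zariski (quotient_space X \<pi> T)) V \<longleftrightarrow>
     V \<subseteq> T \<and> openin (zariski X) {x \<in> topspace (zariski X). \<pi> x \<in> V}"
proof -
  let ?L = "\<lambda>V. V \<subseteq> T \<and> openin (zariski X) {x \<in> topspace (zariski X). \<pi> x \<in> V}"
  have "istopology ?L"
    unfolding istopology_def
  proof (intro conjI allI impI)
    fix U V assume UV: "?L U" "?L V"
    have "{x \<in> topspace (zariski X). \<pi> x \<in> U \<inter> V} =
        {x \<in> topspace (zariski X). \<pi> x \<in> U} \<inter> {x \<in> topspace (zariski X). \<pi> x \<in> V}"
      by auto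
    with UV show "U \<inter> V \<subseteq> T" "openin (zariski X) {x \<in> topspace (zariski X). \<pi> x \<in> U \<inter> V}"
      by auto
  next
    fix K assume K: "\<forall>V\<in>K. ?L V"
    have "{x \<in> topspace (zariski X). \<pi> x \<in> \<Union>K} =
        (\<Union>V\<in>K. {x \<in> topspace (zariski X). \<pi> x \<in> V})"
      by auto
    with K show "\<Union>K \<subseteq> T" "openin (zariski X) {x \<in> topspace (zariski X). \<pi> x \<in> \<Union>K}"
      by auto
  qed
  then show ?thesis
    by (simp add: quotient_space_def topology_inverse')
qed


section \<open>Divisors on a non-singular curve\<close>

text \<open>\<open>\<pi>\<close> is regular near \<open>P\<close> and generates the maximal ideal of the local ring at \<open>P\<close>.\<close>

definition uniformizer :: "'a fspace \<Rightarrow> 'a \<Rightarrow> ('a \<Rightarrow> complex) \<Rightarrow> bool" where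
  "uniformizer X P \<pi> \<longleftrightarrow>
     \<pi> P = 0 \<and> (\<exists>W. openin (zariski X) W \<and> P \<in> W \<and> \<pi> \<in> regular X W) \<and>
     (\<forall>W h. openin (zariski X) W \<and> P \<in> W \<and> h \<in> regular X W \<and> h P = 0 \<longrightarrow>
        (\<exists>V k. openin (zariski X) V \<and> P \<in> V \<and> V \<subseteq> W \<and> k \<in> regular X V \<and>
           (\<forall>z \<in> V. h z = \<pi> z * k z)))"

definition has_order :: "'a fspace \<Rightarrow> ('a \<Rightarrow> complex) \<Rightarrow> 'a \<Rightarrow> int \<Rightarrow> bool" where
  "has_order X h P n \<longleftrightarrow>
     (\<exists>\<pi> W u. uniformizer X P \<pi> \<and> openin (zariski X) W \<and> P \<in> W \<and> u \<in> regular X W \<and> u P \<noteq> 0 \<and>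
        (\<forall>z \<in> W - {P}. \<pi> z \<noteq> 0 \<and> h z = (\<pi> z) powi n * u z))"

text \<open>
  A rational function is represented by a function regular on a non-empty open set, its values
  elsewhere being irrelevant; having an order everywhere forces it to be non-zero.
\<close>

definition principal_divisors :: "'a fspace \<Rightarrow> ('a \<Rightarrow>\<^sub>0 int) set" where
  "principal_divisors X =
     {D \<in> carrier (free_Abelian_group (topspace (zariski X))).
        \<exists>h. (\<exists>V. openin (zariski X) V \<and> V \<noteq> {} \<and> h \<in> regular X V) \<and>
            (\<forall>P \<in> topspace (zariski X). has_order X h P (Poly_Mapping.lookup D P))}"

definition divisor_degree :: "('a \<Rightarrow>\<^sub>0 int) \<Rightarrow> int" where
  "divisor_degree D = (\<Sum>P\<in>Poly_Mapping.keys D. Poly_Mapping.lookup D P)"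

definition degree_zero_divisors :: "'a fspace \<Rightarrow> ('a \<Rightarrow>\<^sub>0 int) monoid" where
  "degree_zero_divisors X =
     (free_Abelian_group (topspace (zariski X)))
       \<lparr>carrier := {D \<in> carrier (free_Abelian_group (topspace (zariski X))). divisor_degree D = 0}\<rparr>"

definition jacobian_group :: "'a fspace \<Rightarrow> ('a \<Rightarrow>\<^sub>0 int) set monoid" where
  "jacobian_group X = degree_zero_divisors X Mod principal_divisors X"

definition divisor_class :: "'a fspace \<Rightarrow> ('a \<Rightarrow>\<^sub>0 int) \<Rightarrow> ('a \<Rightarrow>\<^sub>0 int) set" where
  "divisor_class X D = principal_divisors X #>\<^bsub>degree_zero_divisors X\<^esub> D"


section \<open>The hyperelliptic curve and its Jacobian\<close>

datatype point = Affine complex complex | Infinity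

fun coord_x :: "point \<Rightarrow> complex" where
  "coord_x (Affine x y) = x" | "coord_x Infinity = 0"

fun coord_y :: "point \<Rightarrow> complex" where
  "coord_y (Affine x y) = y" | "coord_y Infinity = 0"

fun coord_t :: "point \<Rightarrow> complex" where
  "coord_t (Affine x y) = 1 / x" | "coord_t Infinity = 0"

fun coord_s :: "nat \<Rightarrow> point \<Rightarrow> complex" where
  "coord_s g (Affine x y) = y / x ^ (g + 1)" | "coord_s g Infinity = 0"

definition affine_curve :: "complex poly \<Rightarrow> point set" where
  "affine_curve f = {Affine x y | x y. y\<^sup>2 = poly f x}"

text \<open>
  For \<open>deg f = 2g + 1\<close> the completion is glued from \<open>y\<^sup>2 = f(x)\<close> and from the affine curve
  \<open>s\<^sup>2 = t\<^bsup>2g+2\<^esup> f(1/t)\<close>, whose only point with \<open>t = 0\<close> is \<open>t = s = 0\<close>,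
  via \<open>t = 1/x\<close>, \<open>s = y/x\<^bsup>g+1\<^esup>\<close>.
\<close>

definition curve_atlas :: "nat \<Rightarrow> complex poly \<Rightarrow> point chart set" where
  "curve_atlas g f =
     {(affine_curve f, {coord_x, coord_y}),
      (insert Infinity {P \<in> affine_curve f. coord_x P \<noteq> 0}, {coord_t, coord_s g})}"

definition completed_curve :: "nat \<Rightarrow> complex poly \<Rightarrow> point fspace" where
  "completed_curve g f = atlas_space (curve_atlas g f)"

definition Jac :: "nat \<Rightarrow> complex poly \<Rightarrow> (point \<Rightarrow>\<^sub>0 int) set monoid" where
  "Jac g f = jacobian_group (completed_curve g f)"

definition abel_jacobi :: "nat \<Rightarrow> complex poly \<Rightarrow> (nat \<Rightarrow> point) \<Rightarrow> (point \<Rightarrow>\<^sub>0 int) set" where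
  "abel_jacobi g f P = divisor_class (completed_curve g f)
     ((\<Sum>i<g. frag_of (P i)) - frag_cmul (int g) (frag_of Infinity))"

text \<open>
  The structure of algebraic variety on the Jacobian: it is the quotient of the \<open>g\<close>-fold product of
  the complete curve by the surjective map \<open>(P\<^sub>1, \<dots>, P\<^sub>g) \<mapsto> [P\<^sub>1 + \<dots> + P\<^sub>g - g \<infinity>]\<close>. This is the usual
  structure, because that map is proper and factors through a birational morphism from the
  \<open>g\<close>-fold symmetric product to the (normal) Jacobian.
\<close>

definition Jac_variety :: "nat \<Rightarrow> complex poly \<Rightarrow> (point \<Rightarrow>\<^sub>0 int) set fspace" where
  "Jac_variety g f =
     quotient_space (atlas_space (power_atlas g (curve_atlas g f))) (abel_jacobi g f)
       (carrier (Jac g f))"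

definition theta_divisor :: "nat \<Rightarrow> complex poly \<Rightarrow> (point \<Rightarrow>\<^sub>0 int) set set" where
  "theta_divisor g f =
     {divisor_class (completed_curve g f)
        ((\<Sum>i<g-1. frag_of (P i)) - frag_cmul (int (g-1)) (frag_of Infinity)) | P.
      \<forall>i<g-1. P i \<in> topspace (zariski (completed_curve g f))}"

text \<open>The translates \<open>\<Theta>\<^sub>+\<close> and \<open>\<Theta>\<^sub>-\<close> are obtained for \<open>e = 1\<close> and \<open>e = -1\<close>.\<close>

definition theta_translate :: "nat \<Rightarrow> complex poly \<Rightarrow> complex \<Rightarrow> (point \<Rightarrow>\<^sub>0 int) set set" where
  "theta_translate g f e =
     (\<lambda>c. c \<otimes>\<^bsub>Jac g f\<^esub>
        divisor_class (completed_curve g f) (frag_of (Affine 0 e) - frag_of Infinity))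
       ` theta_divisor g f"


section \<open>The space of triplets of polynomials and its fibres\<close>

type_synonym triplet = "complex poly \<times> complex poly \<times> complex poly"

definition M :: "nat \<Rightarrow> triplet set" where
  "M g = {(P, Q, R).
     degree P \<le> g \<and> poly P 0 = 1 \<and>
     degree Q \<le> g \<and> poly Q 0 = 2 \<and>
     degree R \<le> g + 1 \<and> poly R 0 = 0}"

definition mu :: "triplet \<Rightarrow> complex poly" where
  "mu = (\<lambda>(P, Q, R). P\<^sup>2 + Q * R)"

definition mu_fibre :: "nat \<Rightarrow> complex poly \<Rightarrow> triplet set" where
  "mu_fibre g f = {m \<in> M g. mu m = f}"

text \<open>The fibre as an algebraic subset of \<open>M g\<close>, whose affine coordinates are the coefficients.\<close>

definition mu_fibre_variety :: "nat \<Rightarrow> complex poly \<Rightarrow> triplet fspace" where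
  "mu_fibre_variety g f = atlas_space
     {(mu_fibre g f,
       {(\<lambda>(P, Q, R). coeff P i) | i. i \<le> g} \<union>
       {(\<lambda>(P, Q, R). coeff Q i) | i. i \<le> g} \<union>
       {(\<lambda>(P, Q, R). coeff R i) | i. i \<le> g + 1})}"

end

theory Submission
  imports Defs "HOL-Computational_Algebra.Fundamental_Theorem_Algebra"
begin

text \<open>
  A point \<open>(P, Q, R)\<close> of the fibre is the Mumford representation of the divisor of the points
  \<open>(a, P(a))\<close> with \<open>Q(a) = 0\<close>. These are exactly the effective divisors of degree \<open>g\<close> on the affine
  curve without conjugate pairs and without points over \<open>x = 0\<close>. Every class of degree zero is
  \<open>[D - g\<infinity>]\<close> with \<open>D\<close> effective, since the divisor of \<open>y - v(x)\<close> reduces \<open>g + 1\<close> points to \<open>g\<close>;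
  and \<open>D\<close> is unique if it has no conjugate pairs, because a function with poles of order at most
  \<open>2g\<close> at infinity only is a polynomial in \<open>x\<close>. Hence the fibre is in bijection with the complement
  of the three translates. The inverse map is regular because points can be added to a Mumford
  representation one at a time by rational formulas. The map itself is regular because the
  \<open>g\<close>-fold product is, over the fibre, a quotient by the symmetric group: averaging turns a
  fraction into a symmetric one, and symmetric functions of the points are polynomials in power
  sums, hence in the coefficients of \<open>P, Q, R\<close>.
\<close>

section \<open>Locally rational functions\<close>

text \<open>The normalisation of the triplets decides which divisors are lost.
  \<open>poly Q 0 = 2\<close> keeps the roots of \<open>Q\<close> away from 0, and
  \<open>poly P 0 = 1\<close> says that the graph of \<open>P\<close> also passes through (0,1). So
  \<open>P\<close> interpolates g + 1 points, one more than the divisor has, which is what pins it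
  down in degree at most g. A point at infinity or a conjugate pair puts a class into \<Theta>; a
  point over 0 puts it into one of the two translates. The obstacle is that the Jacobian is given
  only as a quotient of the product of curves: openness and regularity have to be tested on the
  product, whereas a point of the fibre comes with no regular choice of an order of its points in
  general. The map to the Jacobian therefore cannot be lifted, and functions have to be descended
  instead. This becomes manageable because the preimage \<open>C0\<close> of the complement lies in
  every chart of the product, so that a single affine chart describes all functions on it.\<close>

definition reg_at :: "'a topology \<Rightarrow> ('a \<Rightarrow> complex) set \<Rightarrow> ('a \<Rightarrow> complex) \<Rightarrow> 'a \<Rightarrow> bool" where
  "reg_at T S h x \<longleftrightarrow> (\<exists>p \<in> polyfuns S. \<exists>q \<in> polyfuns S. \<exists>V.
     openin T V \<and> x \<in> V \<and> (\<forall>z \<in> V. q z \<noteq> 0 \<and> h z = p z / q z))"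

lemma reg_atI:
  assumes "p \<in> polyfuns S" "q \<in> polyfuns S" "openin T V" "x \<in> V"
    and "\<And>z. z \<in> V \<Longrightarrow> q z \<noteq> 0" "\<And>z. z \<in> V \<Longrightarrow> h z = p z / q z"
  shows "reg_at T S h x"
  unfolding reg_at_def using assms by blast

lemma reg_atE:
  assumes "reg_at T S h x"
  obtains p q V where "p \<in> polyfuns S" "q \<in> polyfuns S" "openin T V" "x \<in> V"
    "\<And>z. z \<in> V \<Longrightarrow> q z \<noteq> 0" "\<And>z. z \<in> V \<Longrightarrow> h z = p z / q z"
  using assms unfolding reg_at_def by blast

section \<open>Closure properties of polynomial expressions and of locally rational
  functions\<close>

lemma polyfuns_uminus: "p \<in> polyfuns S \<Longrightarrow> (\<lambda>x. - p x) \<in> polyfuns S"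
  using polyfuns.mult[OF polyfuns.const[of "-1"]] by force

lemma polyfuns_diff: "p \<in> polyfuns S \<Longrightarrow> q \<in> polyfuns S \<Longrightarrow> (\<lambda>x. p x - q x) \<in> polyfuns S"
  using polyfuns.add[OF _ polyfuns_uminus] by force

lemma polyfuns_power: "p \<in> polyfuns S \<Longrightarrow> (\<lambda>x. p x ^ n) \<in> polyfuns S"
  by (induction n) (auto intro: polyfuns.const polyfuns.mult)

lemma polyfuns_sum: "(\<And>i. i \<in> I \<Longrightarrow> p i \<in> polyfuns S) \<Longrightarrow> (\<lambda>x. \<Sum>i\<in>I. p i x) \<in> polyfuns S"
  by (induction I rule: infinite_finite_induct) (auto intro: polyfuns.const polyfuns.add)

lemma polyfuns_prod: "(\<And>i. i \<in> I \<Longrightarrow> p i \<in> polyfuns S) \<Longrightarrow> (\<lambda>x. \<Prod>i\<in>I. p i x) \<in> polyfuns S"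
  by (induction I rule: infinite_finite_induct) (auto intro: polyfuns.const polyfuns.mult)

lemma polyfuns_poly: "p \<in> polyfuns S \<Longrightarrow> (\<lambda>x. poly A (p x)) \<in> polyfuns S"
  by (induction A) (auto intro: polyfuns.const polyfuns.mult polyfuns.add)

lemmas polyfuns_intros = polyfuns.const polyfuns.add polyfuns.mult polyfuns_uminus polyfuns_diff
  polyfuns_power polyfuns_sum polyfuns_prod polyfuns_poly

lemma reg_at_polyfuns:
  assumes "openin T V" "x \<in> V" "p \<in> polyfuns S"
  shows "reg_at T S p x"
  unfolding reg_at_def using assms polyfuns.const[of 1 S] by (metis div_by_1 zero_neq_one)

lemma reg_at_const: "openin T V \<Longrightarrow> x \<in> V \<Longrightarrow> reg_at T S (\<lambda>_. c) x"
  by (rule reg_at_polyfuns) (auto intro: polyfuns.const)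

lemma reg_at_add:
  assumes "reg_at T S h x" "reg_at T S k x"
  shows "reg_at T S (\<lambda>z. h z + k z) x"
proof -
  obtain p q V where 1: "p \<in> polyfuns S" "q \<in> polyfuns S" "openin T V" "x \<in> V"
    "\<And>z. z \<in> V \<Longrightarrow> q z \<noteq> 0" "\<And>z. z \<in> V \<Longrightarrow> h z = p z / q z"
    using assms(1) by (rule reg_atE) blast
  obtain p' q' V' where 2: "p' \<in> polyfuns S" "q' \<in> polyfuns S" "openin T V'" "x \<in> V'"
    "\<And>z. z \<in> V' \<Longrightarrow> q' z \<noteq> 0" "\<And>z. z \<in> V' \<Longrightarrow> k z = p' z / q' z"
    using assms(2) by (rule reg_atE) blast
  show ?thesis
  proof (rule reg_atI)
    show "(\<lambda>z. p z * q' z + p' z * q z) \<in> polyfuns S" "(\<lambda>z. q z * q' z) \<in> polyfuns S"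
      using 1 2 by (auto intro: polyfuns_intros)
    show "openin T (V \<inter> V')" "x \<in> V \<inter> V'" using 1 2 by auto
  qed (use 1 2 in \<open>auto simp: field_simps\<close>)
qed

lemma reg_at_mult:
  assumes "reg_at T S h x" "reg_at T S k x"
  shows "reg_at T S (\<lambda>z. h z * k z) x"
proof -
  obtain p q V where 1: "p \<in> polyfuns S" "q \<in> polyfuns S" "openin T V" "x \<in> V"
    "\<And>z. z \<in> V \<Longrightarrow> q z \<noteq> 0" "\<And>z. z \<in> V \<Longrightarrow> h z = p z / q z"
    using assms(1) by (rule reg_atE) blast
  obtain p' q' V' where 2: "p' \<in> polyfuns S" "q' \<in> polyfuns S" "openin T V'" "x \<in> V'"
    "\<And>z. z \<in> V' \<Longrightarrow> q' z \<noteq> 0" "\<And>z. z \<in> V' \<Longrightarrow> k z = p' z / q' z"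
    using assms(2) by (rule reg_atE) blast
  show ?thesis
  proof (rule reg_atI)
    show "(\<lambda>z. p z * p' z) \<in> polyfuns S" "(\<lambda>z. q z * q' z) \<in> polyfuns S"
      using 1 2 by (auto intro: polyfuns_intros)
    show "openin T (V \<inter> V')" "x \<in> V \<inter> V'" using 1 2 by auto
  qed (use 1 2 in auto)
qed

lemma reg_at_cong:
  assumes "reg_at T S h x" "openin T W" "x \<in> W" "\<And>z. z \<in> W \<Longrightarrow> k z = h z"
  shows "reg_at T S k x"
proof -
  obtain p q V where 1: "p \<in> polyfuns S" "q \<in> polyfuns S" "openin T V" "x \<in> V"
    "\<forall>z \<in> V. q z \<noteq> 0 \<and> h z = p z / q z"
    using assms(1) unfolding reg_at_def by blast
  have "openin T (V \<inter> W)" "x \<in> V \<inter> W" using 1 assms by auto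
  then show ?thesis unfolding reg_at_def using 1 assms(4) by (metis IntE)
qed

lemma reg_at_power: "reg_at T S h x \<Longrightarrow> reg_at T S (\<lambda>z. h z ^ n) x"
proof (induction n)
  case 0
  then obtain V where "openin T V" "x \<in> V" unfolding reg_at_def by blast
  then show ?case by (simp add: reg_at_const)
qed (simp add: reg_at_mult)

lemma reg_at_uminus:
  assumes "reg_at T S h x"
  shows "reg_at T S (\<lambda>z. - h z) x"
proof -
  obtain V where "openin T V" "x \<in> V" using assms unfolding reg_at_def by blast
  from reg_at_mult[OF reg_at_const[OF this, of S "-1"] assms] show ?thesis by simp
qed

lemma reg_at_diff: "reg_at T S h x \<Longrightarrow> reg_at T S k x \<Longrightarrow> reg_at T S (\<lambda>z. h z - k z) x"
  using reg_at_add[OF _ reg_at_uminus] by force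

text \<open>The numerator is nonzero at x, and the open set where it stays nonzero shrinks the
  neighbourhood. The hypothesis on \<open>U\<close> records what a chart contributes: its principal
  sets are open.\<close>

lemma reg_at_nonzero_nbhd:
  assumes h: "reg_at T S h x" "h x \<noteq> 0"
    and U: "x \<in> U" "\<And>p. p \<in> polyfuns S \<Longrightarrow> openin T {z \<in> U. p z \<noteq> 0}"
  shows "\<exists>p \<in> polyfuns S. \<exists>q \<in> polyfuns S. \<exists>V. openin T V \<and> x \<in> V \<and> V \<subseteq> U \<and>
    (\<forall>z \<in> V. p z \<noteq> 0 \<and> q z \<noteq> 0 \<and> h z = p z / q z)"
proof -
  obtain p q V where 1: "p \<in> polyfuns S" "q \<in> polyfuns S" "openin T V" "x \<in> V"
    "\<forall>z \<in> V. q z \<noteq> 0 \<and> h z = p z / q z"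
    using h(1) unfolding reg_at_def by blast
  then have "openin T (V \<inter> {z \<in> U. p z \<noteq> 0})" "x \<in> V \<inter> {z \<in> U. p z \<noteq> 0}"
    using U h(2) by auto
  with 1 show ?thesis by blast
qed

lemma reg_at_inverse:
  assumes h: "reg_at T S h x" "h x \<noteq> 0"
    and U: "x \<in> U" "\<And>p. p \<in> polyfuns S \<Longrightarrow> openin T {z \<in> U. p z \<noteq> 0}"
  shows "reg_at T S (\<lambda>z. inverse (h z)) x"
proof -
  obtain p q V where 1: "p \<in> polyfuns S" "q \<in> polyfuns S" "openin T V" "x \<in> V"
    "\<forall>z \<in> V. p z \<noteq> 0 \<and> q z \<noteq> 0 \<and> h z = p z / q z"
    using reg_at_nonzero_nbhd[of T S h x U] assms by blast
  then have "\<forall>z \<in> V. p z \<noteq> 0 \<and> inverse (h z) = q z / p z" by simp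
  with 1 show ?thesis unfolding reg_at_def by blast
qed

lemma reg_at_divide:
  assumes "reg_at T S k x" "reg_at T S h x" "h x \<noteq> 0"
    and "x \<in> U" "\<And>p. p \<in> polyfuns S \<Longrightarrow> openin T {z \<in> U. p z \<noteq> 0}"
  shows "reg_at T S (\<lambda>z. k z / h z) x"
  using reg_at_mult[OF assms(1) reg_at_inverse[of T S h x U]] assms
  by (simp add: divide_inverse)

lemma reg_at_sum:
  assumes "openin T V" "x \<in> V" "\<And>i. i \<in> I \<Longrightarrow> reg_at T S (h i) x"
  shows "reg_at T S (\<lambda>z. \<Sum>i\<in>I. h i z) x"
  using assms(3) by (induction I rule: infinite_finite_induct)
    (auto intro: reg_at_const[OF assms(1,2)] reg_at_add)

text \<open>Pullback along a map whose coordinates are locally rational: sums and products of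
  fractions are fractions, so induction on the polynomial expression suffices.\<close>

lemma reg_at_compose:
  assumes p: "p \<in> polyfuns S'" and "openin T V" "x \<in> V"
    and "\<And>s. s \<in> S' \<Longrightarrow> reg_at T S (\<lambda>z. s (\<phi> z)) x"
  shows "reg_at T S (\<lambda>z. p (\<phi> z)) x"
  using p by induction (auto intro: assms reg_at_const reg_at_add reg_at_mult)

text \<open>Change of coordinates; it serves to rewrite functions of the chart at infinity in terms
  of x and y.\<close>

lemma reg_at_change:
  assumes "p \<in> polyfuns S'" "openin T V" "x \<in> V" "\<And>s. s \<in> S' \<Longrightarrow> reg_at T S s x"
  shows "reg_at T S p x"
  using assms(1) by induction (auto intro: assms reg_at_const[OF assms(2,3)] reg_at_add reg_at_mult)

section \<open>Topology and regular functions of an atlas\<close>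

lemma zariski_atlas_space [simp]: "zariski (atlas_space A) = atlas_topology A"
  by (simp add: atlas_space_def)

lemma openin_atlas_basic:
  "(U, S) \<in> A \<Longrightarrow> p \<in> polyfuns S \<Longrightarrow> openin (atlas_topology A) {z \<in> U. p z \<noteq> 0}"
  unfolding atlas_topology_def by (rule topology_generated_by_Basis) blast

lemma openin_atlas_chart: "(U, S) \<in> A \<Longrightarrow> openin (atlas_topology A) U"
  using openin_atlas_basic[OF _ polyfuns.const[of 1]] by fastforce

lemma topspace_atlas: "topspace (atlas_topology A) = (\<Union>(U, S) \<in> A. U)"
proof -
  have "topspace (atlas_topology A) = \<Union>{{x \<in> U. p x \<noteq> 0} | U S p. (U, S) \<in> A \<and> p \<in> polyfuns S}"
    unfolding atlas_topology_def by simp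
  also have "\<dots> = (\<Union>(U, S) \<in> A. U)" (is "?l = ?r")
  proof
    show "?l \<subseteq> ?r" by auto
    show "?r \<subseteq> ?l"
    proof
      fix x assume "x \<in> ?r"
      then obtain U S where 1: "(U, S) \<in> A" "x \<in> {x \<in> U. (\<lambda>_. 1 :: complex) x \<noteq> 0}" by auto
      have "{x \<in> U. (\<lambda>_. 1 :: complex) x \<noteq> 0} \<in> {{x \<in> U. p x \<noteq> 0} | U S p. (U, S) \<in> A \<and> p \<in> polyfuns S}"
        by (rule CollectI, rule exI[of _ U], rule exI[of _ S], rule exI[of _ "\<lambda>_. 1"])
          (use 1(1) in \<open>auto intro: polyfuns.const\<close>)
      then show "x \<in> ?l" using 1(2) by (rule UnionI)
    qed
  qed
  finally show ?thesis .
qed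

lemma regular_atlas_reg_at:
  assumes "h \<in> regular (atlas_space A) W" "x \<in> W"
  shows "\<exists>(U, S) \<in> A. x \<in> U \<and> reg_at (atlas_topology A) S h x"
proof -
  obtain U S p q V where 1: "(U, S) \<in> A" "p \<in> polyfuns S" "q \<in> polyfuns S"
    "openin (atlas_topology A) V" "x \<in> V" "V \<subseteq> W \<inter> U" "\<forall>z \<in> V. q z \<noteq> 0 \<and> h z = p z / q z"
    using assms(1)[unfolded atlas_space_def, simplified, rule_format, OF assms(2)] by blast
  then have "reg_at (atlas_topology A) S h x" "x \<in> U" unfolding reg_at_def by blast+
  with 1 show ?thesis by blast
qed

text \<open>A fraction valid on some neighbourhood stays valid on its intersection with W and the
  chart, both open; this supplies the containment demanded by \<open>atlas_space\<close>.\<close>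

lemma regular_atlasI:
  assumes W: "openin (atlas_topology A) W"
    and h: "\<And>x. x \<in> W \<Longrightarrow> \<exists>(U, S) \<in> A. x \<in> U \<and> reg_at (atlas_topology A) S h x"
  shows "h \<in> regular (atlas_space A) W"
proof -
  have "\<exists>(U, S) \<in> A. \<exists>p \<in> polyfuns S. \<exists>q \<in> polyfuns S. \<exists>V.
      openin (atlas_topology A) V \<and> x \<in> V \<and> V \<subseteq> W \<inter> U \<and> (\<forall>z \<in> V. q z \<noteq> 0 \<and> h z = p z / q z)"
    if x: "x \<in> W" for x
  proof -
    obtain U S where US: "(U, S) \<in> A" "x \<in> U" "reg_at (atlas_topology A) S h x" using h[OF x] by blast
    then obtain p q V where 1: "p \<in> polyfuns S" "q \<in> polyfuns S" "openin (atlas_topology A) V" "x \<in> V"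
      "\<forall>z \<in> V. q z \<noteq> 0 \<and> h z = p z / q z" unfolding reg_at_def by blast
    have "openin (atlas_topology A) (V \<inter> (W \<inter> U))" "x \<in> V \<inter> (W \<inter> U)"
      using 1 W US openin_atlas_chart x by blast+
    then show ?thesis using 1 US(1) by (intro bexI[of _ "(U, S)"]) blast+
  qed
  then show ?thesis by (simp add: atlas_space_def)
qed


section \<open>Affine charts of a hyperelliptic curve\<close>

text \<open>With n the order of p at a, the power (x - a)^(n+1) divides q but not p, hence not p +
  q.\<close>

lemma order_add_eq_left:
  fixes p q :: "'a :: idom poly"
  assumes "p \<noteq> 0" "q = 0 \<or> order a p < order a q"
  shows "p + q \<noteq> 0" "order a (p + q) = order a p"
proof -
  have "p + q \<noteq> 0 \<and> order a (p + q) = order a p"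
  proof (cases "q = 0")
    case False
    with assms have lt: "order a p < order a q" by simp
    let ?n = "order a p"
    have d: "[:-a, 1:] ^ Suc ?n dvd q"
      by (rule dvd_trans[OF le_imp_power_dvd order_1]) (use lt in auto)
    have nd: "\<not> [:-a, 1:] ^ Suc ?n dvd p" using order_2[OF assms(1)] .
    then have n: "\<not> [:-a, 1:] ^ Suc ?n dvd p + q" using d by (simp add: dvd_add_left_iff)
    then have "p + q \<noteq> 0" by auto
    moreover have "[:-a, 1:] ^ ?n dvd p + q"
      by (rule dvd_add[OF order_1]) (rule power_le_dvd[OF d], simp)
    ultimately show ?thesis using n by (metis order_unique_lemma)
  qed (use assms in auto)
  then show "p + q \<noteq> 0" "order a (p + q) = order a p" by auto
qed

text \<open>Models both charts of the curve at once, as a plane curve Y^2 = F(X). The simple root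
  keeps F from being the square of a rational function of X.\<close>

locale hchart =
  fixes U :: "point set" and X Y :: "point \<Rightarrow> complex" and F :: "complex poly" and r :: complex
  assumes inj: "inj_on (\<lambda>z. (X z, Y z)) U"
    and eqn: "z \<in> U \<Longrightarrow> (Y z)\<^sup>2 = poly F (X z)"
    and onto: "b\<^sup>2 = poly F a \<Longrightarrow> \<exists>z \<in> U. X z = a \<and> Y z = b"
    and F_nz: "F \<noteq> 0" and simple_root: "order r F = 1"
begin

text \<open>This is the norm of A + B Y. If it vanished, the order of A^2 = B^2 F at
  \<open>r\<close> would be both even and odd.\<close>

lemma norm_nz:
  assumes "A \<noteq> 0 \<or> B \<noteq> 0"
  shows "A\<^sup>2 - B\<^sup>2 * F \<noteq> 0"
proof
  assume "A\<^sup>2 - B\<^sup>2 * F = 0"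
  then have e: "A\<^sup>2 = B\<^sup>2 * F" by simp
  show False
  proof (cases "B = 0")
    case False
    then have nz: "B\<^sup>2 * F \<noteq> 0" using F_nz by simp
    then have "A \<noteq> 0" using e by auto
    then have "order r (A\<^sup>2) = 2 * order r A" by (simp add: power2_eq_square order_mult)
    moreover have "order r (B\<^sup>2 * F) = 2 * order r B + 1"
      using nz False F_nz by (simp add: power2_eq_square order_mult simple_root)
    ultimately have "2 * order r A = 2 * order r B + 1" using e by simp
    then show False by arith
  qed (use e assms in auto)
qed

lemma finite_fibres:
  assumes "finite R"
  shows "finite {z \<in> U. X z \<in> R}"
proof -
  have sq: "finite {b :: complex. b\<^sup>2 = c}" for c
  proof (rule finite_subset)
    show "{b. b\<^sup>2 = c} \<subseteq> {csqrt c, - csqrt c}"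
      using power2_eq_iff[of _ "csqrt c"] by auto
  qed simp
  have "finite ((\<lambda>z. (X z, Y z)) ` {z \<in> U. X z \<in> R})"
  proof (rule finite_subset)
    show "(\<lambda>z. (X z, Y z)) ` {z \<in> U. X z \<in> R} \<subseteq> (\<Union>a\<in>R. {a} \<times> {b. b\<^sup>2 = poly F a})"
      using eqn by auto
  qed (use assms sq in auto)
  then show ?thesis
    by (rule finite_imageD) (rule inj_on_subset[OF inj], auto)
qed

text \<open>Multiplication by the conjugate A - B Y yields the norm, a nonzero polynomial in X,
  whose finitely many roots have finite fibres.\<close>

lemma finite_zeros:
  assumes "A \<noteq> 0 \<or> B \<noteq> 0"
  shows "finite {z \<in> U. poly A (X z) + poly B (X z) * Y z = 0}"
proof (rule finite_subset)
  show "{z \<in> U. poly A (X z) + poly B (X z) * Y z = 0} \<subseteq> {z \<in> U. X z \<in> {a. poly (A\<^sup>2 - B\<^sup>2 * F) a = 0}}"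
  proof safe
    fix z assume z: "z \<in> U" "poly A (X z) + poly B (X z) * Y z = 0"
    have "poly (A\<^sup>2 - B\<^sup>2 * F) (X z) = (poly A (X z) + poly B (X z) * Y z) * (poly A (X z) - poly B (X z) * Y z)"
      using eqn[OF z(1)] by (simp add: power2_eq_square algebra_simps)
    with z show "poly (A\<^sup>2 - B\<^sup>2 * F) (X z) = 0" by simp
  qed
  show "finite {z \<in> U. X z \<in> {a. poly (A\<^sup>2 - B\<^sup>2 * F) a = 0}}"
    by (rule finite_fibres) (use poly_roots_finite[OF norm_nz[OF assms]] in simp)
qed

lemma infinite_chart: "infinite U"
proof
  assume "finite U"
  then have "finite (X ` U)" by simp
  moreover have "X ` U = UNIV"
  proof -
    have "a \<in> X ` U" for a using onto[of "csqrt (poly F a)" a] by auto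
    then show ?thesis by auto
  qed
  ultimately show False using infinite_UNIV_char_0 by metis
qed

lemma polyfuns_normal_form:
  assumes "p \<in> polyfuns {X, Y}"
  shows "\<exists>A B. \<forall>z \<in> U. p z = poly A (X z) + poly B (X z) * Y z"
  using assms
proof induction
  case (gen s)
  then consider "s = X" | "s = Y" by auto
  then show ?case
  proof cases
    case 1 then show ?thesis by - (rule exI[of _ "[:0,1:]"], rule exI[of _ 0], auto)
  next
    case 2 then show ?thesis by - (rule exI[of _ 0], rule exI[of _ 1], auto)
  qed
next
  case (const c)
  show ?case by (rule exI[of _ "[:c:]"], rule exI[of _ 0]) auto
next
  case (add p q)
  then obtain A B A' B' where "\<forall>z \<in> U. p z = poly A (X z) + poly B (X z) * Y z"
    "\<forall>z \<in> U. q z = poly A' (X z) + poly B' (X z) * Y z" by blast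
  then show ?case by - (rule exI[of _ "A + A'"], rule exI[of _ "B + B'"], (auto simp: algebra_simps))
next
  case (mult p q)
  then obtain A B A' B' where 1: "\<forall>z \<in> U. p z = poly A (X z) + poly B (X z) * Y z"
    "\<forall>z \<in> U. q z = poly A' (X z) + poly B' (X z) * Y z" by blast
  show ?case
  proof (rule exI[of _ "A * A' + B * B' * F"], rule exI[of _ "A * B' + B * A'"], rule ballI)
    fix z assume "z \<in> U"
    with 1 eqn[of z] show "p z * q z = poly (A * A' + B * B' * F) (X z) + poly (A * B' + B * A') (X z) * Y z"
      by (simp add: power2_eq_square algebra_simps flip: eqn)
  qed
qed

lemma polyfuns_zeros:
  assumes "p \<in> polyfuns {X, Y}" "z0 \<in> U" "p z0 \<noteq> 0"
  shows "finite {z \<in> U. p z = 0}"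
proof -
  obtain A B where AB: "\<forall>z \<in> U. p z = poly A (X z) + poly B (X z) * Y z"
    using polyfuns_normal_form[OF assms(1)] by blast
  then have "A \<noteq> 0 \<or> B \<noteq> 0" using assms by auto
  from finite_zeros[OF this] show ?thesis by (rule finite_subset[rotated]) (use AB in auto)
qed

lemma polyfuns_X: "X \<in> polyfuns {X, Y}" and polyfuns_Y: "Y \<in> polyfuns {X, Y}"
  by (auto intro: polyfuns.gen)

text \<open>The local ring at a smooth point is a discrete valuation ring: the factor \<open>e\<close> is a unit there.\<close>

lemma local_division:
  assumes P: "P \<in> U" "Y P \<noteq> 0 \<or> order (X P) F = 1" and p: "p \<in> polyfuns {X, Y}"
  defines "\<pi> \<equiv> if Y P \<noteq> 0 then (\<lambda>z. X z - X P) else Y"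
  shows "\<exists>k \<in> polyfuns {X, Y}. \<exists>e \<in> polyfuns {X, Y}. e P \<noteq> 0 \<and> (\<forall>z \<in> U. (p z - p P) * e z = \<pi> z * k z)"
proof -
  have "[:- X P, 1:] dvd F - [:poly F (X P):]" by (simp add: poly_eq_0_iff_dvd[symmetric])
  then obtain F1 where F1: "F - [:poly F (X P):] = [:- X P, 1:] * F1" by (auto elim: dvdE)
  have F1e: "poly F a - poly F (X P) = (a - X P) * poly F1 a" for a
    using arg_cong[OF F1, of "\<lambda>p. poly p a"] by (simp add: algebra_simps)
  have Fz: "poly F1 (X P) \<noteq> 0" if "Y P = 0"
  proof
    assume "poly F1 (X P) = 0"
    then have "[:- X P, 1:] dvd F1" by (simp add: poly_eq_0_iff_dvd)
    moreover have "F = [:- X P, 1:] * F1" using F1 eqn[OF P(1)] that by simp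
    ultimately have "[:- X P, 1:]\<^sup>2 dvd F" by (metis mult_dvd_mono dvd_refl power2_eq_square)
    then have "2 \<le> order (X P) F" using F_nz by (simp add: order_divides)
    then show False using P(2) that by simp
  qed
  show ?thesis
    using p
  proof induction
    case (gen s)
    show ?case
    proof (cases "Y P = 0")
      case True
      show ?thesis
      proof (cases "s = X")
        case True
        \<comment> \<open>At a branch point F vanishes at \<open>X P\<close>, so Y^2 = (X - X P)
          F1(X), and F1 is a unit there because the root is simple.\<close>
        have "(X z - X P) * poly F1 (X z) = Y z * Y z" if "z \<in> U" for z
          using F1e[of "X z"] eqn[OF that] eqn[OF P(1)] \<open>Y P = 0\<close> by (simp add: power2_eq_square)
        then show ?thesis unfolding True \<pi>_def using Fz \<open>Y P = 0\<close>
          by (intro bexI[of _ Y] bexI[of _ "\<lambda>z. poly F1 (X z)"])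
            (auto intro: polyfuns_intros polyfuns_X polyfuns_Y)
      next
        case False
        then have "s = Y" using gen by auto
        then show ?thesis unfolding \<pi>_def using True
          by (intro bexI[of _ "\<lambda>_. 1"] bexI[of _ "\<lambda>_. 1"]) (auto intro: polyfuns_intros)
      qed
    next
      case nz: False
      show ?thesis
      proof (cases "s = X")
        case True
        then show ?thesis unfolding \<pi>_def using nz
          by (intro bexI[of _ "\<lambda>_. 1"] bexI[of _ "\<lambda>_. 1"]) (auto intro: polyfuns_intros)
      next
        case False
        then have s: "s = Y" using gen by auto
        \<comment> \<open>Away from branch points the unit is Y + Y P, whose value at P is twice
          \<open>Y P\<close>.\<close>
        have "(Y z - Y P) * (Y z + Y P) = (X z - X P) * poly F1 (X z)" if "z \<in> U" for z
          using F1e[of "X z"] eqn[OF that] eqn[OF P(1)] by (simp add: power2_eq_square algebra_simps)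
        then show ?thesis unfolding s \<pi>_def using nz
          by (intro bexI[of _ "\<lambda>z. poly F1 (X z)"] bexI[of _ "\<lambda>z. Y z + Y P"])
            (auto intro: polyfuns_intros polyfuns_X polyfuns_Y)
      qed
    qed
  next
    case (const c)
    show ?case by (intro bexI[of _ "\<lambda>_. 0"] bexI[of _ "\<lambda>_. 1"]) (auto intro: polyfuns_intros)
  next
    case (add p q)
    then obtain k e k' e' where 1: "k \<in> polyfuns {X, Y}" "e \<in> polyfuns {X, Y}" "e P \<noteq> 0"
      "\<forall>z \<in> U. (p z - p P) * e z = \<pi> z * k z"
      "k' \<in> polyfuns {X, Y}" "e' \<in> polyfuns {X, Y}" "e' P \<noteq> 0" "\<forall>z \<in> U. (q z - q P) * e' z = \<pi> z * k' z"
      by blast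
    show ?case
    proof (rule bexI[of _ "\<lambda>z. k z * e' z + k' z * e z"], rule bexI[of _ "\<lambda>z. e z * e' z"], intro conjI ballI)
      fix z assume "z \<in> U"
      then have "(p z - p P) * e z = \<pi> z * k z" "(q z - q P) * e' z = \<pi> z * k' z" using 1 by auto
      then show "(p z + q z - (p P + q P)) * (e z * e' z) = \<pi> z * (k z * e' z + k' z * e z)"
        by algebra
    qed (use 1 in \<open>auto intro: polyfuns_intros\<close>)
  next
    case (mult p q)
    then obtain k e k' e' where 1: "k \<in> polyfuns {X, Y}" "e \<in> polyfuns {X, Y}" "e P \<noteq> 0"
      "\<forall>z \<in> U. (p z - p P) * e z = \<pi> z * k z"
      "k' \<in> polyfuns {X, Y}" "e' \<in> polyfuns {X, Y}" "e' P \<noteq> 0" "\<forall>z \<in> U. (q z - q P) * e' z = \<pi> z * k' z"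
      by blast
    show ?case
    proof (rule bexI[of _ "\<lambda>z. k z * (e' z * q z) + k' z * (e z * p P)"], rule bexI[of _ "\<lambda>z. e z * e' z"], intro conjI ballI)
      fix z assume "z \<in> U"
      then have "(p z - p P) * e z = \<pi> z * k z" "(q z - q P) * e' z = \<pi> z * k' z" using 1 by auto
      then show "(p z * q z - p P * q P) * (e z * e' z) = \<pi> z * (k z * (e' z * q z) + k' z * (e z * p P))"
        by algebra
    qed (use 1 mult in \<open>auto intro!: polyfuns_intros\<close>)
  qed
qed

end

section \<open>Orders of functions on the completed curve\<close>

locale hyperelliptic =
  fixes g :: nat and f :: "complex poly"
  assumes g_pos: "g \<ge> 1" and deg_f: "degree f = 2 * g + 1" and sqfree: "rsquarefree f" and f_0: "poly f 0 = 1"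
begin

abbreviation "C \<equiv> insert Infinity (affine_curve f)"
abbreviation "X \<equiv> completed_curve g f"
abbreviation "T \<equiv> atlas_topology (curve_atlas g f)"
abbreviation "U_inf \<equiv> insert Infinity {P \<in> affine_curve f. coord_x P \<noteq> 0}"

lemma f_nz: "f \<noteq> 0" using f_0 by auto

lemma order_f: "order a f = (if poly f a = 0 then 1 else 0)"
  using sqfree f_nz unfolding rsquarefree_def by (metis order_root)

lemma Affine_iff: "Affine a b \<in> affine_curve f \<longleftrightarrow> b\<^sup>2 = poly f a"
  by (auto simp: affine_curve_def)

lemma affine_coords: "P \<in> affine_curve f \<Longrightarrow> P = Affine (coord_x P) (coord_y P) \<and> (coord_y P)\<^sup>2 = poly f (coord_x P)"
  by (auto simp: affine_curve_def)

lemma Infinity_not_affine [simp]: "Infinity \<notin> affine_curve f"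
  by (auto simp: affine_curve_def)

section \<open>The affine chart and the chart at infinity\<close>

definition root_f :: complex where "root_f = (SOME a. poly f a = 0)"

lemma root_f: "poly f root_f = 0"
proof -
  have "\<exists>a. poly f a = 0"
    by (rule fundamental_theorem_of_algebra_alt) (use deg_f in \<open>auto elim: degree_eq_zeroE\<close>)
  then show ?thesis unfolding root_f_def by (rule someI_ex)
qed

sublocale c1: hchart "affine_curve f" coord_x coord_y f root_f
proof
  show "inj_on (\<lambda>z. (coord_x z, coord_y z)) (affine_curve f)"
    by (auto simp: inj_on_def affine_curve_def)
  show "\<exists>z\<in>affine_curve f. coord_x z = a \<and> coord_y z = b" if "b\<^sup>2 = poly f a" for a b
    using that by (intro bexI[of _ "Affine a b"]) (auto simp: affine_curve_def)
qed (auto simp: f_nz order_f root_f affine_curve_def)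

text \<open>The polynomial t^(2g+2) f(1/t). Its exponent exceeds the degree of f by one, whence the
  factor t added by \<open>pCons 0\<close>; it makes 0 a simple root, so Infinity is a branch
  point.\<close>

definition f_inf :: "complex poly" where "f_inf = pCons 0 (reflect_poly f)"

lemma poly_f_inf: "t \<noteq> 0 \<Longrightarrow> poly f_inf t = t ^ (2 * g + 2) * poly f (1 / t)"
  by (simp add: f_inf_def poly_reflect_poly_nz deg_f inverse_eq_divide)

lemma order_f_inf: "order 0 f_inf = 1"
proof -
  have "f_inf = [:0, 1:] * reflect_poly f" by (simp add: f_inf_def)
  moreover have "order 0 (reflect_poly f) = 0" by (rule order_0I) (simp add: f_nz)
  moreover have "order 0 [:0, 1 :: complex:] = 1" using order_power_n_n[of 0 1] by simp
  ultimately show ?thesis by (simp add: order_mult f_nz del: mult_pCons_left)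
qed

sublocale c2: hchart U_inf coord_t "coord_s g" f_inf 0
proof
  show "inj_on (\<lambda>z. (coord_t z, coord_s g z)) U_inf"
    by (auto simp: inj_on_def affine_curve_def)
  show "(coord_s g z)\<^sup>2 = poly f_inf (coord_t z)" if "z \<in> U_inf" for z
  proof (cases z)
    case (Affine x y)
    then have "x \<noteq> 0" "y\<^sup>2 = poly f x" using that by (auto simp: affine_curve_def)
    then show ?thesis
      by (simp add: Affine poly_f_inf power_divide power_mult mult.commute[of 2] divide_simps)
        (simp add: power2_eq_square)
  qed (simp add: f_inf_def)
  show "\<exists>z\<in>U_inf. coord_t z = t \<and> coord_s g z = s" if st: "s\<^sup>2 = poly f_inf t" for t s
  proof (cases "t = 0")
    case True
    then show ?thesis using st by (intro bexI[of _ Infinity]) (auto simp: f_inf_def)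
  next
    case False
    have "(s / t ^ (g + 1))\<^sup>2 = poly f (1 / t)"
      using False st by (simp add: poly_f_inf power_divide power_mult mult.commute[of 2] divide_simps)
        (simp add: power2_eq_square)
    then show ?thesis using False
      by (intro bexI[of _ "Affine (1 / t) (s / t ^ (g + 1))"]) (auto simp: affine_curve_def power_divide)
  qed
  show "f_inf \<noteq> 0" using f_nz by (simp add: f_inf_def)
qed (rule order_f_inf)

section \<open>A preferred chart and local parameter at each point\<close>

definition S_at :: "point \<Rightarrow> (point \<Rightarrow> complex) set" where
  "S_at P = (if P = Infinity then {coord_t, coord_s g} else {coord_x, coord_y})"

definition U_at :: "point \<Rightarrow> point set" where
  "U_at P = (if P = Infinity then U_inf else affine_curve f)"

text \<open>At an affine point x - x(P) is a uniformizer unless y(P) = 0, where x is ramified and y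
  takes over. Infinity is a branch point too, so \<open>coord_s g\<close> is used there and not
  \<open>coord_t\<close>, which has order 2.\<close>

definition lp :: "point \<Rightarrow> point \<Rightarrow> complex" where
  "lp P = (if P = Infinity then coord_s g
     else if coord_y P \<noteq> 0 then (\<lambda>z. coord_x z - coord_x P) else coord_y)"

lemma chart_at_in: "(U_at P, S_at P) \<in> curve_atlas g f"
  by (auto simp: U_at_def S_at_def curve_atlas_def)

lemma finite_outside_chart: "finite (C - U_at P)"
proof -
  have "C - U_inf \<subseteq> {z \<in> affine_curve f. coord_x z \<in> {0}}" by auto
  then have "finite (C - U_inf)" by (rule finite_subset) (rule c1.finite_fibres, simp)
  moreover have "C - affine_curve f \<subseteq> {Infinity}" by auto
  then have "finite (C - affine_curve f)" by (rule finite_subset) simp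
  ultimately show ?thesis by (auto simp: U_at_def)
qed

lemma chart_at:
  assumes "P \<in> C"
  obtains x y F r where "hchart (U_at P) x y F r" "S_at P = {x, y}" "P \<in> U_at P"
    "y P \<noteq> 0 \<or> order (x P) F = 1" "lp P = (if y P \<noteq> 0 then (\<lambda>z. x z - x P) else y)"
proof (cases "P = Infinity")
  case True
  show ?thesis
    by (rule that[of coord_t "coord_s g" f_inf 0])
      (use c2.hchart_axioms order_f_inf in \<open>auto simp: U_at_def S_at_def lp_def True\<close>)
next
  case False
  then have "coord_y P \<noteq> 0 \<or> order (coord_x P) f = 1"
    using assms affine_coords[of P] by (auto simp: order_f)
  with False assms show ?thesis
    by (intro that[of coord_x coord_y f root_f]) (use c1.hchart_axioms in \<open>auto simp: U_at_def S_at_def lp_def\<close>)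
qed

lemma chart_mem: "P \<in> C \<Longrightarrow> P \<in> U_at P"
  by (auto simp: U_at_def)

section \<open>The Zariski topology of the completed curve\<close>

lemma infinite_C: "infinite C"
  using c1.infinite_chart by simp

lemma topspace_T: "topspace T = C"
  by (auto simp: topspace_atlas curve_atlas_def)

lemma zariski_X [simp]: "zariski X = T"
  by (simp add: completed_curve_def)

lemma open_basic: "p \<in> polyfuns (S_at P) \<Longrightarrow> openin T {z \<in> U_at P. p z \<noteq> 0}"
  by (rule openin_atlas_basic[OF chart_at_in])

lemma open_chart: "openin T (U_at P)"
  by (rule openin_atlas_chart[OF chart_at_in])

text \<open>Cofiniteness survives unions and finite intersections, so it is enough to treat a
  generator: the nonzero set of a polynomial expression on a chart, which omits finitely many points
  of the chart as soon as it is nonempty.\<close>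

lemma openin_T_imp:
  assumes "openin T V"
  shows "V = {} \<or> finite (C - V)"
proof -
  let ?B = "{{x \<in> U. p x \<noteq> 0} | U S p. (U, S) \<in> curve_atlas g f \<and> p \<in> polyfuns S}"
  have "generate_topology_on ?B V"
    using assms unfolding atlas_topology_def openin_topology_generated_by_iff .
  then show ?thesis
  proof induction
    case (Int a b)
    have "C - a \<inter> b = (C - a) \<union> (C - b)" by auto
    with Int show ?case by auto
  next
    case (UN K)
    show ?case
    proof (cases "\<Union>K = {}")
      case False
      then obtain k where "k \<in> K" "k \<noteq> {}" by auto
      then have "finite (C - k)" using UN by auto
      then have "finite (C - \<Union>K)" by (rule finite_subset[rotated]) (use \<open>k \<in> K\<close> in auto)
      then show ?thesis by simp
    qed simp
  next
    case (Basis s)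
    then obtain U S p where s: "s = {x \<in> U. p x \<noteq> 0}" "(U, S) \<in> curve_atlas g f" "p \<in> polyfuns S" by auto
    have ch: "finite (C - s)" if "s \<noteq> {}" "hchart U x y F r" "S = {x, y}" "finite (C - U)" for x y F r
    proof -
      interpret hchart U x y F r by fact
      from that(1) obtain z0 where "z0 \<in> U" "p z0 \<noteq> 0" unfolding s(1) by blast
      then have "finite {z \<in> U. p z = 0}" using polyfuns_zeros s that by blast
      moreover have "C - s \<subseteq> (C - U) \<union> {z \<in> U. p z = 0}" using s by auto
      ultimately show ?thesis using that by (meson finite_UnI finite_subset)
    qed
    from s(2) consider "U = affine_curve f" "S = {coord_x, coord_y}" | "U = U_inf" "S = {coord_t, coord_s g}"
      unfolding curve_atlas_def by blast
    then show ?case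
    proof cases
      case 1
      then show ?thesis using ch[OF _ _ 1(2)] c1.hchart_axioms finite_outside_chart[of "Affine 0 1"]
        by (auto simp: U_at_def)
    next
      case 2
      then show ?thesis using ch[OF _ _ 2(2)] c2.hchart_axioms finite_outside_chart[of Infinity]
        by (auto simp: U_at_def)
    qed
  qed simp
qed

lemma open_remove_point:
  shows "openin T (C - {P})"
proof (cases P)
  case Infinity
  then have "C - {P} = affine_curve f" by auto
  then show ?thesis using open_chart[of "Affine 0 1"] by (simp add: U_at_def)
next
  case (Affine a b)
  have m: "(\<lambda>z. coord_x z - a) \<in> polyfuns {coord_x, coord_y}" "(\<lambda>z. coord_y z - b) \<in> polyfuns {coord_x, coord_y}"
    "(\<lambda>z. 1 - a * coord_t z) \<in> polyfuns {coord_t, coord_s g}"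
    by (auto intro!: polyfuns_intros intro: polyfuns.gen)
  have "openin T {z \<in> affine_curve f. coord_x z - a \<noteq> 0}" "openin T {z \<in> affine_curve f. coord_y z - b \<noteq> 0}"
    using open_basic[of "\<lambda>z. coord_x z - a" "Affine 0 1"] open_basic[of "\<lambda>z. coord_y z - b" "Affine 0 1"] m
    unfolding S_at_def U_at_def by simp_all
  \<comment> \<open>The two affine sets miss Infinity. On the chart at infinity 1 - a t has value 1
    at Infinity and can vanish only where x = a.\<close>
  moreover have "openin T {z \<in> U_inf. 1 - a * coord_t z \<noteq> 0}"
    using open_basic[of "\<lambda>z. 1 - a * coord_t z" Infinity] m(3)
    unfolding S_at_def U_at_def by simp
  ultimately have "openin T ({z \<in> affine_curve f. coord_x z - a \<noteq> 0} \<union> {z \<in> affine_curve f. coord_y z - b \<noteq> 0}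
      \<union> {z \<in> U_inf. 1 - a * coord_t z \<noteq> 0})" by blast
  also have "{z \<in> affine_curve f. coord_x z - a \<noteq> 0} \<union> {z \<in> affine_curve f. coord_y z - b \<noteq> 0}
      \<union> {z \<in> U_inf. 1 - a * coord_t z \<noteq> 0} = C - {P}"
    by (auto simp: Affine affine_curve_def)
  finally show ?thesis .
qed

lemma openin_T_iff: "openin T V \<longleftrightarrow> V \<subseteq> C \<and> (V = {} \<or> finite (C - V))"
proof
  assume "openin T V"
  then show "V \<subseteq> C \<and> (V = {} \<or> finite (C - V))"
    using openin_T_imp openin_subset[of T V] topspace_T by auto
next
  assume r: "V \<subseteq> C \<and> (V = {} \<or> finite (C - V))"
  show "openin T V"
  proof (cases "V = {}")
    case False
    show ?thesis
    proof (cases "C - V = {}")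
      case True
      then have "V = topspace T" using r topspace_T by auto
      then show ?thesis by simp
    next
      case ne: False
      have "openin T (\<Inter>P\<in>C - V. C - {P})"
        by (rule openin_INT2) (use r False ne open_remove_point in auto)
      also have "(\<Inter>P\<in>C - V. C - {P}) = V" using r ne by auto
      finally show ?thesis .
    qed
  qed simp
qed

text \<open>
  The non-empty open sets of the curve being the cofinite ones, rational functions are compared
  almost everywhere, and \<open>HO\<close> measures orders by one fixed uniformizer \<open>lp P\<close>.
\<close>

definition ae :: "point filter" where "ae = inf cofinite (principal C)"

lemma eventually_ae: "eventually P ae \<longleftrightarrow> finite {z \<in> C. \<not> P z}"
  unfolding ae_def eventually_inf_principal eventually_cofinite by (rule arg_cong[of _ _ finite]) auto

lemma ae_not_bot: "ae \<noteq> bot"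
proof
  assume "ae = bot"
  then have "eventually (\<lambda>_. False) ae" by simp
  then show False using infinite_C by (simp add: eventually_ae)
qed

lemma ae_chart: "\<forall>\<^sub>F z in ae. z \<in> U_at P"
  using finite_outside_chart[of P] by (simp add: eventually_ae set_diff_eq)

lemma ae_open: "openin T V \<Longrightarrow> P \<in> V \<Longrightarrow> \<forall>\<^sub>F z in ae. z \<in> V"
  using openin_T_imp[of V] by (auto simp: eventually_ae set_diff_eq)

text \<open>A cofinite set stays open when P is put back, so an almost everywhere property holds on
  a punctured neighbourhood, the form in which \<open>has_order\<close> asks for it.\<close>

lemma ae_nbhd:
  assumes "eventually Q ae" "openin T W" "P \<in> W"
  obtains V where "openin T V" "P \<in> V" "V \<subseteq> W" "\<And>z. z \<in> V \<Longrightarrow> z \<noteq> P \<Longrightarrow> Q z"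
proof
  let ?V = "insert P {z \<in> W. Q z}"
  have "W \<subseteq> C" "finite (C - W)" using assms openin_T_iff by auto
  moreover have "C - ?V \<subseteq> (C - W) \<union> {z \<in> C. \<not> Q z}" by auto
  ultimately show "openin T ?V"
    unfolding openin_T_iff using assms by (auto simp: eventually_ae intro: finite_subset)
qed (use assms in auto)

section \<open>Regularity at a point of the curve\<close>

abbreviation reg :: "(point \<Rightarrow> complex) \<Rightarrow> point \<Rightarrow> bool" where
  "reg h P \<equiv> reg_at T (S_at P) h P"

lemma reg_polyfuns: "P \<in> C \<Longrightarrow> p \<in> polyfuns (S_at P) \<Longrightarrow> reg p P"
  by (rule reg_at_polyfuns[OF open_chart chart_mem])

lemma reg_const: "P \<in> C \<Longrightarrow> reg (\<lambda>_. c) P"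
  by (rule reg_polyfuns) (auto intro: polyfuns.const)

lemma reg_inverse: "P \<in> C \<Longrightarrow> reg h P \<Longrightarrow> h P \<noteq> 0 \<Longrightarrow> reg (\<lambda>z. inverse (h z)) P"
  by (rule reg_at_inverse[where U = "U_at P"]) (auto intro: open_basic chart_mem)

lemma reg_divide: "P \<in> C \<Longrightarrow> reg k P \<Longrightarrow> reg h P \<Longrightarrow> h P \<noteq> 0 \<Longrightarrow> reg (\<lambda>z. k z / h z) P"
  by (rule reg_at_divide[where U = "U_at P"]) (auto intro: open_basic chart_mem)

lemma reg_power_int:
  assumes "P \<in> C" "reg h P" "h P \<noteq> 0"
  shows "reg (\<lambda>z. h z powi n) P"
  by (cases "n \<ge> 0") (auto simp: power_int_def intro!: reg_at_power reg_inverse assms)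

lemma reg_nonzero_ae:
  assumes "P \<in> C" "reg u P" "u P \<noteq> 0"
  shows "\<forall>\<^sub>F z in ae. u z \<noteq> 0"
proof -
  obtain p q V where V: "openin T V" "P \<in> V" "\<forall>z \<in> V. p z \<noteq> 0 \<and> q z \<noteq> 0 \<and> u z = p z / q z"
    using reg_at_nonzero_nbhd[OF assms(2,3) chart_mem[OF assms(1)] open_basic] by blast
  from ae_open[OF V(1,2)] show ?thesis by eventually_elim (use V in auto)
qed

text \<open>Plays the role of continuity: a difference that is nonzero at P would be nonzero almost
  everywhere. Values at P can thus be read off identities that hold only almost everywhere.\<close>

lemma reg_ae_eq:
  assumes P: "P \<in> C" "reg h P" "reg k P" "\<forall>\<^sub>F z in ae. h z = k z"
  shows "h P = k P"
proof (rule ccontr)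
  assume "h P \<noteq> k P"
  then have "h P - k P \<noteq> 0" by simp
  from reg_nonzero_ae[OF P(1) reg_at_diff[OF P(2,3)] this] P(4)
  have "eventually (\<lambda>_. False) ae" by eventually_elim auto
  then show False using ae_not_bot by simp
qed

lemma lp_polyfuns: "lp P \<in> polyfuns (S_at P)"
  by (auto simp: lp_def S_at_def intro!: polyfuns_intros intro: polyfuns.gen)

lemma lp_self [simp]: "lp P P = 0"
  by (auto simp: lp_def)

lemma reg_lp: "P \<in> C \<Longrightarrow> reg (lp P) P"
  by (rule reg_polyfuns[OF _ lp_polyfuns])

lemma lp_nonzero_ae:
  assumes "P \<in> C"
  shows "\<forall>\<^sub>F z in ae. lp P z \<noteq> 0"
proof -
  obtain x y F r where h: "hchart (U_at P) x y F r" and lp: "lp P = (if y P \<noteq> 0 then (\<lambda>z. x z - x P) else y)"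
    using chart_at[OF assms] by metis
  interpret hchart "U_at P" x y F r by (rule h)
  have "finite {z \<in> U_at P. lp P z = 0}"
    using finite_zeros[of "[:- x P, 1:]" 0] finite_zeros[of 0 1] lp by (auto split: if_splits)
  then have "\<forall>\<^sub>F z in ae. \<not> (z \<in> U_at P \<and> lp P z = 0)"
    unfolding eventually_ae by (rule finite_subset[rotated]) auto
  with ae_chart[of P] show ?thesis by eventually_elim auto
qed

text \<open>Regularity at an affine point may be witnessed in the chart at infinity. There x is
  nonzero and t = 1/x, s = y/x^(g+1) are fractions in x and y, which moves the witness to the
  preferred chart.\<close>

lemma regular_reg:
  assumes "h \<in> regular X W" "P \<in> W"
  shows "reg h P"
proof -
  obtain U S where US: "(U, S) \<in> curve_atlas g f" "P \<in> U" "reg_at T S h P"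
    using regular_atlas_reg_at[of h "curve_atlas g f" W P] assms by (auto simp: completed_curve_def)
  show ?thesis
  proof (cases "S = S_at P")
    case False
    moreover from US(1) have "U = affine_curve f \<and> S = {coord_x, coord_y} \<or> U = U_inf \<and> S = {coord_t, coord_s g}"
      unfolding curve_atlas_def by blast
    moreover have "P \<noteq> Infinity" if "U = affine_curve f" using that US(2) by auto
    ultimately have PU: "P \<noteq> Infinity" "P \<in> U_inf" and S: "S = {coord_t, coord_s g}"
      using US(2) unfolding S_at_def by (metis, metis, metis)
    then have PS: "P \<in> affine_curve f" "coord_x P \<noteq> 0" "S_at P = {coord_x, coord_y}"
      unfolding S_at_def by auto
    have PC: "P \<in> C" using PS by simp
    have x: "reg coord_x P" and y: "reg coord_y P"
      by (rule reg_polyfuns[OF PC]; simp add: PS polyfuns.gen)+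
    have W: "openin T (affine_curve f)" using open_chart[of "Affine 0 1"] by (simp add: U_at_def)
    have r: "reg (\<lambda>z. 1 / coord_x z) P" "reg (\<lambda>z. coord_y z / coord_x z ^ (g + 1)) P"
      using PS(2) by (auto intro!: reg_divide[OF PC] reg_const[OF PC] reg_at_power x y simp del: power_Suc)
    have ts: "reg coord_t P" "reg (coord_s g) P"
      by (rule reg_at_cong[OF r(1) W PS(1)] reg_at_cong[OF r(2) W PS(1)]; auto simp: affine_curve_def)+
    obtain p q V where 1: "p \<in> polyfuns S" "q \<in> polyfuns S" "openin T V" "P \<in> V"
      "\<And>z. z \<in> V \<Longrightarrow> q z \<noteq> 0" "\<And>z. z \<in> V \<Longrightarrow> h z = p z / q z"
      using US(3) by (rule reg_atE) blast
    have "reg p P" "reg q P" using reg_at_change[OF _ 1(3,4), of _ S "S_at P"] 1(1,2) ts unfolding S by blast+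
    then have "reg (\<lambda>z. p z / q z) P" using PC 1 by (auto intro: reg_divide)
    then show ?thesis by (rule reg_at_cong[OF _ 1(3,4)]) (rule 1(6))
  qed (use US in simp)
qed

lemma regularI:
  assumes "openin T W" "\<And>P. P \<in> W \<Longrightarrow> reg h P"
  shows "h \<in> regular X W"
  unfolding completed_curve_def
proof (rule regular_atlasI)
  fix P assume "P \<in> W"
  then have "P \<in> U_at P" using assms(1) openin_T_iff chart_mem by blast
  then show "\<exists>(U, S) \<in> curve_atlas g f. P \<in> U \<and> reg_at T S h P"
    using chart_at_in[of P] assms(2)[OF \<open>P \<in> W\<close>] by blast
qed (rule assms)

lemma reg_imp_regular:
  assumes "P \<in> C" "reg h P"
  obtains W where "openin T W" "P \<in> W" "h \<in> regular X W"
proof -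
  obtain p q V where 1: "p \<in> polyfuns (S_at P)" "q \<in> polyfuns (S_at P)" "openin T V" "P \<in> V"
    "\<And>z. z \<in> V \<Longrightarrow> q z \<noteq> 0" "\<And>z. z \<in> V \<Longrightarrow> h z = p z / q z"
    using assms(2) by (rule reg_atE) blast
  have "h \<in> regular X (V \<inter> U_at P)"
    unfolding completed_curve_def
  proof (rule regular_atlasI)
    fix z assume "z \<in> V \<inter> U_at P"
    then have "z \<in> U_at P" "reg_at T (S_at P) h z" using 1 by (auto intro: reg_atI)
    then show "\<exists>(U, S) \<in> curve_atlas g f. z \<in> U \<and> reg_at T S h z" using chart_at_in[of P] by blast
  qed (use 1 open_chart in auto)
  then show ?thesis using that[of "V \<inter> U_at P"] 1 open_chart chart_mem assms by auto
qed

lemma regular_subset: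
  assumes "h \<in> regular X W" "openin T V" "V \<subseteq> W"
  shows "h \<in> regular X V"
  using assms regular_reg by (blast intro: regularI)

text \<open>For h = p/q with p(P) = 0, \<open>hchart.local_division\<close> gives p e = lp k with e
  nonzero at P; the quotient of h by the parameter is then k/(e q).\<close>

lemma uniformizer_lp:
  assumes P: "P \<in> C"
  shows "uniformizer X P (lp P)"
  unfolding uniformizer_def
proof (intro conjI allI impI)
  show "\<exists>W. openin (zariski X) W \<and> P \<in> W \<and> lp P \<in> regular X W"
    using reg_imp_regular[OF P reg_lp[OF P]] by auto
  fix W h assume W: "openin (zariski X) W \<and> P \<in> W \<and> h \<in> regular X W \<and> h P = 0"
  then have "reg h P" using regular_reg by blast
  then obtain p q V where 1: "p \<in> polyfuns (S_at P)" "q \<in> polyfuns (S_at P)" "openin T V" "P \<in> V"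
    "\<And>z. z \<in> V \<Longrightarrow> q z \<noteq> 0" "\<And>z. z \<in> V \<Longrightarrow> h z = p z / q z"
    by (rule reg_atE) blast
  obtain x y F r where h: "hchart (U_at P) x y F r" and S: "S_at P = {x, y}" and Pm: "P \<in> U_at P"
    and sm: "y P \<noteq> 0 \<or> order (x P) F = 1" and lp: "lp P = (if y P \<noteq> 0 then (\<lambda>z. x z - x P) else y)"
    using chart_at[OF P] by metis
  have "p P = 0" using 1 W by fastforce
  then obtain k e where ke: "k \<in> polyfuns (S_at P)" "e \<in> polyfuns (S_at P)" "e P \<noteq> 0"
    "\<forall>z \<in> U_at P. p z * e z = lp P z * k z"
    using hchart.local_division[OF h Pm sm, of p] 1(1) unfolding S lp by auto
  let ?V = "V \<inter> W \<inter> {z \<in> U_at P. e z \<noteq> 0}" and ?k = "\<lambda>z. k z / (e z * q z)"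
  have V: "openin T ?V" "P \<in> ?V" using 1 W ke open_basic Pm by auto
  have "reg ?k P" using ke 1 by (intro reg_divide P reg_at_mult reg_polyfuns) auto
  then obtain W' where W': "openin T W'" "P \<in> W'" "?k \<in> regular X W'" using reg_imp_regular[OF P] by blast
  have "?k \<in> regular X (?V \<inter> W')" by (rule regular_subset[OF W'(3)]) (use V W' in auto)
  moreover have "\<forall>z\<in>?V \<inter> W'. h z = lp P z * ?k z"
  proof
    fix z assume z: "z \<in> ?V \<inter> W'"
    then have "p z * e z = lp P z * k z" "q z \<noteq> 0" "h z = p z / q z" "e z \<noteq> 0" using ke 1 by auto
    then show "h z = lp P z * ?k z" by (simp add: field_simps)
  qed
  moreover have "openin (zariski X) (?V \<inter> W')" "P \<in> ?V \<inter> W'" "?V \<inter> W' \<subseteq> W" using V W' by auto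
  ultimately show "\<exists>V k. openin (zariski X) V \<and> P \<in> V \<and> V \<subseteq> W \<and> k \<in> regular X V \<and> (\<forall>z\<in>V. h z = lp P z * k z)"
    by blast
qed simp

section \<open>Calculus of orders\<close>

definition HO :: "(point \<Rightarrow> complex) \<Rightarrow> point \<Rightarrow> int \<Rightarrow> bool" where
  "HO h P n \<longleftrightarrow> (\<exists>u. reg u P \<and> u P \<noteq> 0 \<and> (\<forall>\<^sub>F z in ae. h z = lp P z powi n * u z))"

lemma HO_cong: "HO h P n \<Longrightarrow> \<forall>\<^sub>F z in ae. k z = h z \<Longrightarrow> HO k P n"
  unfolding HO_def by (elim exE conjE, rule exI, intro conjI, assumption, assumption)
    (auto elim: eventually_elim2)

lemma HO_mult:
  assumes "P \<in> C" "HO h P n" "HO k P m"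
  shows "HO (\<lambda>z. h z * k z) P (n + m)"
proof -
  obtain u where u: "reg u P" "u P \<noteq> 0" "\<forall>\<^sub>F z in ae. h z = lp P z powi n * u z" using assms(2) HO_def by auto
  obtain v where v: "reg v P" "v P \<noteq> 0" "\<forall>\<^sub>F z in ae. k z = lp P z powi m * v z" using assms(3) HO_def by auto
  have "\<forall>\<^sub>F z in ae. h z * k z = lp P z powi (n + m) * (u z * v z)"
    using u(3) v(3) lp_nonzero_ae[OF assms(1)] by eventually_elim (simp add: power_int_add)
  then show ?thesis unfolding HO_def using u v by (intro exI[of _ "\<lambda>z. u z * v z"]) (auto intro: reg_at_mult)
qed

lemma HO_inverse:
  assumes "P \<in> C" "HO h P n"
  shows "HO (\<lambda>z. inverse (h z)) P (- n)"
proof -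
  obtain u where u: "reg u P" "u P \<noteq> 0" "\<forall>\<^sub>F z in ae. h z = lp P z powi n * u z" using assms(2) HO_def by auto
  from u(3) have "\<forall>\<^sub>F z in ae. inverse (h z) = lp P z powi (- n) * inverse (u z)"
    by eventually_elim (simp add: power_int_minus)
  then show ?thesis unfolding HO_def using u assms(1)
    by (intro exI[of _ "\<lambda>z. inverse (u z)"]) (auto intro: reg_inverse)
qed

lemma HO_divide:
  assumes "P \<in> C" "HO h P n" "HO k P m"
  shows "HO (\<lambda>z. h z / k z) P (n - m)"
  using HO_mult[OF assms(1,2) HO_inverse[OF assms(1,3)]] by (simp add: divide_inverse)

lemma HO_reg_nonzero: "P \<in> C \<Longrightarrow> reg h P \<Longrightarrow> h P \<noteq> 0 \<Longrightarrow> HO h P 0"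
  unfolding HO_def by (intro exI[of _ h]) auto

lemma HO_const: "P \<in> C \<Longrightarrow> c \<noteq> 0 \<Longrightarrow> HO (\<lambda>_. c) P 0"
  by (rule HO_reg_nonzero) (auto intro: reg_const)

lemma HO_power:
  assumes "P \<in> C" "HO h P n"
  shows "HO (\<lambda>z. h z ^ k) P (int k * n)"
proof (induction k)
  case (Suc k)
  then show ?case using HO_mult[OF assms(1) assms(2) Suc] by (simp add: algebra_simps)
qed (use HO_const[OF assms(1), of 1] in simp)

lemma HO_lp: "P \<in> C \<Longrightarrow> HO (lp P) P 1"
  unfolding HO_def by (intro exI[of _ "\<lambda>_. 1"]) (auto intro: reg_const)

lemma HO_nonzero_ae:
  assumes "P \<in> C" "HO h P n"
  shows "\<forall>\<^sub>F z in ae. h z \<noteq> 0"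
proof -
  obtain u where u: "reg u P" "u P \<noteq> 0" "\<forall>\<^sub>F z in ae. h z = lp P z powi n * u z" using assms(2) HO_def by auto
  show ?thesis using u(3) lp_nonzero_ae[OF assms(1)] reg_nonzero_ae[OF assms(1) u(1,2)]
    by eventually_elim auto
qed

text \<open>The identity h = lp^n u holds almost everywhere. Written without negative powers it has
  regular sides, so it holds at P as well, where lp vanishes and u does not.\<close>

lemma HO_reg:
  assumes P: "P \<in> C" "HO h P n" "reg h P"
  shows "n \<ge> 0" "h P = 0 \<longleftrightarrow> n > 0"
proof -
  obtain u where u: "reg u P" "u P \<noteq> 0" "\<forall>\<^sub>F z in ae. h z = lp P z powi n * u z" using assms(2) HO_def by auto
  show n: "n \<ge> 0"
  proof (rule ccontr)
    assume n: "\<not> n \<ge> 0"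
    have "\<forall>\<^sub>F z in ae. u z = lp P z ^ nat (- n) * h z"
      using u(3) lp_nonzero_ae[OF P(1)]
      by eventually_elim (use n in \<open>simp add: power_int_def power_inverse\<close>)
    then have "u P = lp P P ^ nat (- n) * h P"
      by (intro reg_ae_eq P u reg_at_mult reg_at_power reg_lp)
    then show False using u n by simp
  qed
  have "\<forall>\<^sub>F z in ae. h z = lp P z ^ nat n * u z"
    using u(3) by eventually_elim (use n in \<open>simp add: power_int_def\<close>)
  then have "h P = lp P P ^ nat n * u P"
    by (intro reg_ae_eq P u reg_at_mult reg_at_power reg_lp)
  then show "h P = 0 \<longleftrightarrow> n > 0" using u n by auto
qed

lemma HO_unique:
  assumes P: "P \<in> C" "HO h P n" "HO h P m"
  shows "n = m"
proof -
  have "HO (\<lambda>z. h z / h z) P (n - m)" using HO_divide[OF P] .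
  moreover have "\<forall>\<^sub>F z in ae. 1 = h z / h z"
    using HO_nonzero_ae[OF P(1,2)] by eventually_elim auto
  ultimately have "HO (\<lambda>_. 1) P (n - m)" by (rule HO_cong)
  from HO_reg[OF P(1) this reg_const[OF P(1)]] show ?thesis by simp
qed

text \<open>After lp^n is factored out, the cofactor u + lp^(m-n) v has the value u(P) at P because
  m - n is positive.\<close>

lemma HO_add:
  assumes P: "P \<in> C" "HO h P n" "HO k P m" "n < m"
  shows "HO (\<lambda>z. h z + k z) P n"
proof -
  obtain u where u: "reg u P" "u P \<noteq> 0" "\<forall>\<^sub>F z in ae. h z = lp P z powi n * u z" using assms(2) HO_def by auto
  obtain v where v: "reg v P" "v P \<noteq> 0" "\<forall>\<^sub>F z in ae. k z = lp P z powi m * v z" using assms(3) HO_def by auto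
  have "\<forall>\<^sub>F z in ae. h z + k z = lp P z powi n * (u z + lp P z ^ nat (m - n) * v z)"
    using u(3) v(3) lp_nonzero_ae[OF assms(1)]
  proof eventually_elim
    case (elim z)
    have "lp P z powi m = lp P z powi (n + (m - n))" by simp
    also have "\<dots> = lp P z powi n * lp P z ^ nat (m - n)"
      using elim P(4) by (subst power_int_add) (auto simp: power_int_def)
    finally show ?case using elim by (simp add: algebra_simps)
  qed
  then show ?thesis unfolding HO_def using u v P
    by (intro exI[of _ "\<lambda>z. u z + lp P z ^ nat (m - n) * v z"])
      (auto simp: zero_power intro!: reg_at_add reg_at_mult reg_at_power reg_lp)
qed

text \<open>Two uniformizers divide each other. The product of the quotients is 1 almost everywhere,
  hence at P, so they differ by a unit whose n-th power is absorbed into u.\<close>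

lemma has_order_imp_HO:
  assumes P: "P \<in> C" and h: "has_order X h P n"
  shows "HO h P n"
proof -
  obtain \<pi> W u where 1: "uniformizer X P \<pi>" "openin T W" "P \<in> W" "u \<in> regular X W" "u P \<noteq> 0"
    "\<forall>z \<in> W - {P}. \<pi> z \<noteq> 0 \<and> h z = (\<pi> z) powi n * u z"
    using h unfolding has_order_def by auto
  obtain W0 where W0: "openin T W0" "P \<in> W0" "lp P \<in> regular X W0" using reg_imp_regular[OF P reg_lp[OF P]] .
  obtain V k where k: "openin T V" "P \<in> V" "k \<in> regular X V" "\<forall>z \<in> V. lp P z = \<pi> z * k z"
    using 1(1)[unfolded uniformizer_def] W0 lp_self[of P] unfolding zariski_X by meson
  obtain W1 where W1: "openin T W1" "P \<in> W1" "\<pi> \<in> regular X W1" "\<pi> P = 0"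
    using 1(1)[unfolded uniformizer_def] unfolding zariski_X by meson
  obtain V' k' where k': "openin T V'" "P \<in> V'" "k' \<in> regular X V'" "\<forall>z \<in> V'. \<pi> z = lp P z * k' z"
    using uniformizer_lp[OF P, unfolded uniformizer_def] W1 unfolding zariski_X by meson
  have rk: "reg k P" "reg k' P" "reg u P" using k k' 1 regular_reg by blast+
  have "\<forall>\<^sub>F z in ae. k' z * k z = 1"
    using ae_open[OF k(1,2)] ae_open[OF k'(1,2)] lp_nonzero_ae[OF P]
  proof eventually_elim
    case (elim z)
    then have "lp P z = lp P z * (k' z * k z)" using k k' by (metis mult.assoc)
    then show ?case using elim by simp
  qed
  then have "k' P * k P = 1" by (rule reg_ae_eq[OF P reg_at_mult[OF rk(2,1)] reg_const[OF P]])
  then have k0: "k' P \<noteq> 0" by auto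
  have "\<forall>\<^sub>F z in ae. h z = lp P z powi n * (k' z powi n * u z)"
    using ae_open[OF 1(2,3)] ae_open[OF k'(1,2)] lp_nonzero_ae[OF P]
  proof eventually_elim
    case (elim z)
    then have "z \<noteq> P" by auto
    then show ?case using 1(6) elim k'(4) by (simp add: power_int_mult_distrib)
  qed
  then show ?thesis unfolding HO_def using rk k0 1(5) P
    by (intro exI[of _ "\<lambda>z. k' z powi n * u z"]) (auto intro: reg_at_mult reg_power_int)
qed

lemma HO_imp_has_order:
  assumes P: "P \<in> C" and h: "HO h P n"
  shows "has_order X h P n"
proof -
  obtain u where u: "reg u P" "u P \<noteq> 0" "\<forall>\<^sub>F z in ae. h z = lp P z powi n * u z" using h HO_def by auto
  obtain W where W: "openin T W" "P \<in> W" "u \<in> regular X W" using reg_imp_regular[OF P u(1)] .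
  have "\<forall>\<^sub>F z in ae. lp P z \<noteq> 0 \<and> h z = lp P z powi n * u z"
    using lp_nonzero_ae[OF P] u(3) by eventually_elim auto
  then obtain V where V: "openin T V" "P \<in> V" "V \<subseteq> W"
    "\<And>z. z \<in> V \<Longrightarrow> z \<noteq> P \<Longrightarrow> lp P z \<noteq> 0 \<and> h z = lp P z powi n * u z"
    by (rule ae_nbhd[OF _ W(1,2)]) blast
  moreover have "u \<in> regular X V" by (rule regular_subset[OF W(3) V(1,3)])
  ultimately show ?thesis unfolding has_order_def using uniformizer_lp[OF P] u(2)
    by (intro exI[of _ "lp P"] exI[of _ V] exI[of _ u]) auto
qed

lemma has_order_iff: "P \<in> C \<Longrightarrow> has_order X h P n \<longleftrightarrow> HO h P n"
  using has_order_imp_HO HO_imp_has_order by blast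

text \<open>Supplies the open set of regularity that \<open>principal_divisors\<close> asks of a
  rational function: on a punctured neighbourhood of P the parameter is nonzero, so all its integer
  powers are fractions.\<close>

lemma HO_imp_regular_somewhere:
  assumes P: "P \<in> C" "HO h P n"
  obtains V where "openin T V" "V \<noteq> {}" "h \<in> regular X V"
proof -
  obtain u where u: "reg u P" "u P \<noteq> 0" "\<forall>\<^sub>F z in ae. h z = lp P z powi n * u z" using P(2) HO_def by auto
  obtain p q V where 1: "p \<in> polyfuns (S_at P)" "q \<in> polyfuns (S_at P)" "openin T V" "P \<in> V"
    "V \<subseteq> U_at P" "\<forall>z\<in>V. p z \<noteq> 0 \<and> q z \<noteq> 0 \<and> u z = p z / q z"
    using reg_at_nonzero_nbhd[OF u(1,2) chart_mem[OF P(1)] open_basic] by blast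
  have "\<forall>\<^sub>F z in ae. lp P z \<noteq> 0 \<and> h z = lp P z powi n * u z"
    using lp_nonzero_ae[OF P(1)] u(3) by eventually_elim auto
  then obtain V' where V': "openin T V'" "P \<in> V'" "V' \<subseteq> V"
    "\<And>z. z \<in> V' \<Longrightarrow> z \<noteq> P \<Longrightarrow> lp P z \<noteq> 0 \<and> h z = lp P z powi n * u z"
    by (rule ae_nbhd[OF _ 1(3,4)]) blast
  let ?V = "V' \<inter> (C - {P})"
  have V: "openin T ?V" using V' open_remove_point by blast
  show ?thesis
  proof (rule that[OF V])
    have "finite (C - V')" using openin_T_imp[OF V'(1)] V'(2) by auto
    moreover have "C \<subseteq> (C - V') \<union> {P} \<union> ?V" by auto
    ultimately show "?V \<noteq> {}" using infinite_C by (metis finite.emptyI finite_Un finite_insert finite_subset)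
    show "h \<in> regular X ?V"
      unfolding completed_curve_def
    proof (rule regular_atlasI[OF V])
      fix z assume z: "z \<in> ?V"
      then have zU: "z \<in> U_at P" using 1 V' by auto
      have lpz: "lp P z \<noteq> 0" using V'(4) z by auto
      have ge: "reg_at T (S_at P) (lp P) z" by (rule reg_at_polyfuns[OF open_chart zU lp_polyfuns])
      have "reg_at T (S_at P) (\<lambda>z. inverse (lp P z)) z"
        by (rule reg_at_inverse[OF ge lpz zU open_basic])
      then have "reg_at T (S_at P) (\<lambda>z. lp P z powi n) z" using ge
        by (cases "n \<ge> 0") (auto simp: power_int_def intro: reg_at_power)
      moreover have "reg_at T (S_at P) u z" by (rule reg_atI[OF 1(1,2,3)]) (use 1(6) V' z in auto)
      ultimately have "reg_at T (S_at P) (\<lambda>z. lp P z powi n * u z) z" by (rule reg_at_mult)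
      then have "reg_at T (S_at P) h z" by (rule reg_at_cong[OF _ V z]) (use V'(4) in auto)
      then show "\<exists>(U, S) \<in> curve_atlas g f. z \<in> U \<and> reg_at T S h z"
        using chart_at_in[of P] zU by blast
    qed
  qed
qed

lemma principal_iff:
  "D \<in> principal_divisors X \<longleftrightarrow>
     Poly_Mapping.keys D \<subseteq> C \<and> (\<exists>h. \<forall>P \<in> C. HO h P (Poly_Mapping.lookup D P))"
proof -
  have "(\<exists>V. openin T V \<and> V \<noteq> {} \<and> h \<in> regular X V)" if "\<forall>P \<in> C. HO h P (Poly_Mapping.lookup D P)" for h
    using HO_imp_regular_somewhere[of Infinity h] that by (metis insertI1)
  then have "(\<exists>h. (\<exists>V. openin T V \<and> V \<noteq> {} \<and> h \<in> regular X V) \<and> (\<forall>P \<in> C. HO h P (Poly_Mapping.lookup D P)))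
      \<longleftrightarrow> (\<exists>h. \<forall>P \<in> C. HO h P (Poly_Mapping.lookup D P))" by (intro ex_cong1) metis
  then show ?thesis
    unfolding principal_divisors_def by (simp add: topspace_T has_order_iff del: ball_simps)
qed

section \<open>Orders of polynomials in x and y\<close>

abbreviation px :: "complex poly \<Rightarrow> point \<Rightarrow> complex" where
  "px A \<equiv> (\<lambda>z. poly A (coord_x z))"

abbreviation pxy :: "complex poly \<Rightarrow> complex poly \<Rightarrow> point \<Rightarrow> complex" where
  "pxy A B \<equiv> (\<lambda>z. poly A (coord_x z) + poly B (coord_x z) * coord_y z)"

abbreviation Nm :: "complex poly \<Rightarrow> complex poly \<Rightarrow> complex poly" where
  "Nm A B \<equiv> A\<^sup>2 - B\<^sup>2 * f"

lemma S_at_affine [simp]: "P \<in> affine_curve f \<Longrightarrow> S_at P = {coord_x, coord_y}"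
  by (auto simp: S_at_def)

lemma affine_ae: "\<forall>\<^sub>F z in ae. z \<in> affine_curve f"
  using ae_chart[of "Affine 0 1"] by (simp add: U_at_def)

lemma eqn_affine: "z \<in> affine_curve f \<Longrightarrow> (coord_y z)\<^sup>2 = poly f (coord_x z)"
  using affine_coords by blast

lemma reg_px: "P \<in> affine_curve f \<Longrightarrow> reg (px A) P"
  by (rule reg_polyfuns) (auto intro!: polyfuns_intros intro: polyfuns.gen)

lemma reg_pxy: "P \<in> affine_curve f \<Longrightarrow> reg (pxy A B) P"
  by (rule reg_polyfuns) (auto intro!: polyfuns_intros intro: polyfuns.gen)

lemma pxy_conj: "z \<in> affine_curve f \<Longrightarrow> pxy A B z * pxy A (- B) z = px (Nm A B) z"
  using eqn_affine[of z] by (simp add: algebra_simps power2_eq_square)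

text \<open>The ramification index at an affine point of the double cover of the line given by
  x.\<close>

definition ram :: "point \<Rightarrow> int" where "ram P = (if coord_y P = 0 then 2 else 1)"

text \<open>At a branch point f = (x - a) f1 with f1(a) nonzero, so x - a = y^2/f1, and y is the
  local parameter.\<close>

lemma HO_x_minus:
  assumes P: "P \<in> affine_curve f"
  shows "HO (px [:- coord_x P, 1:]) P (ram P)"
proof (cases "coord_y P = 0")
  case False
  then have "lp P = px [:- coord_x P, 1:]" using P by (auto simp: lp_def)
  then show ?thesis using HO_lp[of P] P False by (simp add: ram_def)
next
  case True
  have PC: "P \<in> C" using P by simp
  let ?a = "coord_x P"
  have f0: "poly f ?a = 0" using eqn_affine[OF P] True by simp
  obtain f1 where f1: "f = [:- ?a, 1:] ^ order ?a f * f1" "\<not> [:- ?a, 1:] dvd f1"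
    using order_decomp[OF f_nz] by blast
  then have fe: "f = [:- ?a, 1:] * f1" using f0 by (simp add: order_f)
  have nz: "poly f1 ?a \<noteq> 0" using f1(2) by (simp add: poly_eq_0_iff_dvd)
  have lp: "lp P = coord_y" using P True by (auto simp: lp_def)
  have "HO (\<lambda>z. coord_y z ^ 2 / px f1 z) P (2 - 0)"
    using HO_divide[OF PC HO_power[OF PC HO_lp[OF PC], of 2] HO_reg_nonzero[OF PC reg_px[OF P] nz]]
    by (simp add: lp)
  moreover have "\<forall>\<^sub>F z in ae. px [:- ?a, 1:] z = coord_y z ^ 2 / px f1 z"
    using affine_ae reg_nonzero_ae[OF PC reg_px[OF P] nz]
  proof eventually_elim
    case (elim z)
    have "(coord_y z)\<^sup>2 = px [:- ?a, 1:] z * px f1 z"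
      using eqn_affine[OF elim(1)] by (subst (asm) fe) (simp only: poly_mult)
    then show ?case using elim by simp
  qed
  ultimately show ?thesis using HO_cong True by (auto simp: ram_def)
qed

lemma HO_px:
  assumes P: "P \<in> affine_curve f" and A: "A \<noteq> 0"
  shows "HO (px A) P (int (order (coord_x P) A) * ram P)"
proof -
  have PC: "P \<in> C" using P by simp
  let ?a = "coord_x P"
  obtain A1 where A1: "A = [:- ?a, 1:] ^ order ?a A * A1" "\<not> [:- ?a, 1:] dvd A1"
    using order_decomp[OF A] by blast
  have nz: "poly A1 ?a \<noteq> 0" using A1(2) by (simp add: poly_eq_0_iff_dvd)
  have "HO (\<lambda>z. px [:- ?a, 1:] z ^ order ?a A * px A1 z) P (int (order ?a A) * ram P + 0)"
    by (rule HO_mult[OF PC HO_power[OF PC HO_x_minus[OF P]] HO_reg_nonzero[OF PC reg_px[OF P] nz]])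
  moreover have "px A z = px [:- ?a, 1:] z ^ order ?a A * px A1 z" for z
    by (subst A1(1)) (simp only: poly_mult poly_power)
  ultimately show ?thesis by simp
qed

lemma HO_y:
  assumes P: "P \<in> affine_curve f"
  shows "HO coord_y P (ram P - 1)"
proof (cases "coord_y P = 0")
  case True
  then have "lp P = coord_y" using P by (auto simp: lp_def)
  then show ?thesis using HO_lp[of P] P True by (simp add: ram_def)
next
  case False
  have "reg coord_y P" by (rule reg_polyfuns) (use P in \<open>auto intro: polyfuns.gen\<close>)
  then show ?thesis using HO_reg_nonzero[of P coord_y] P False by (simp add: ram_def)
qed

text \<open>The equation at infinity reads s^2 = t F(t) with F(0) the leading coefficient of f, and
  s is the local parameter.\<close>

lemma HO_t_Infinity: "HO coord_t Infinity 2"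
proof -
  have PC: "Infinity \<in> C" by simp
  have S: "S_at Infinity = {coord_t, coord_s g}" by (simp add: S_at_def)
  let ?F = "\<lambda>z. poly (reflect_poly f) (coord_t z)"
  have r: "reg ?F Infinity" by (rule reg_polyfuns[OF PC]) (auto simp: S intro!: polyfuns_intros intro: polyfuns.gen)
  have nz: "?F Infinity \<noteq> 0" using f_nz by simp
  have "lp Infinity = coord_s g" by (simp add: lp_def)
  then have "HO (\<lambda>z. coord_s g z ^ 2 / ?F z) Infinity (2 - 0)"
    using HO_divide[OF PC HO_power[OF PC HO_lp[OF PC], of 2] HO_reg_nonzero[OF PC r nz]] by simp
  moreover have "\<forall>\<^sub>F z in ae. coord_t z = coord_s g z ^ 2 / ?F z"
    using ae_chart[of Infinity] reg_nonzero_ae[OF PC r nz]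
    by eventually_elim (use c2.eqn in \<open>auto simp: U_at_def f_inf_def\<close>)
  ultimately show ?thesis using HO_cong by auto
qed

lemma HO_x_Infinity: "HO coord_x Infinity (- 2)"
proof -
  have "HO (\<lambda>z. inverse (coord_t z)) Infinity (- 2)" by (rule HO_inverse[OF _ HO_t_Infinity]) simp
  moreover have "\<forall>\<^sub>F z in ae. coord_x z = inverse (coord_t z)"
    using affine_ae by eventually_elim (auto simp: affine_curve_def)
  ultimately show ?thesis by (rule HO_cong)
qed

lemma x_nonzero_ae: "\<forall>\<^sub>F z in ae. z \<in> affine_curve f \<and> coord_x z \<noteq> 0"
  using affine_ae ae_chart[of Infinity] by eventually_elim (auto simp: U_at_def)

lemma HO_px_Infinity:
  assumes A: "A \<noteq> 0"
  shows "HO (px A) Infinity (- 2 * int (degree A))"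
proof -
  have PC: "Infinity \<in> C" by simp
  have S: "S_at Infinity = {coord_t, coord_s g}" by (simp add: S_at_def)
  let ?F = "\<lambda>z. poly (reflect_poly A) (coord_t z)"
  have r: "reg ?F Infinity" by (rule reg_polyfuns[OF PC]) (auto simp: S intro!: polyfuns_intros intro: polyfuns.gen)
  have nz: "?F Infinity \<noteq> 0" using A by simp
  have "HO (\<lambda>z. coord_x z ^ degree A * ?F z) Infinity (int (degree A) * (- 2) + 0)"
    by (rule HO_mult[OF PC HO_power[OF PC HO_x_Infinity] HO_reg_nonzero[OF PC r nz]])
  moreover have "\<forall>\<^sub>F z in ae. px A z = coord_x z ^ degree A * ?F z"
    using x_nonzero_ae
    by eventually_elim (auto simp: affine_curve_def poly_reflect_poly_nz inverse_eq_divide field_simps)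
  ultimately show ?thesis using HO_cong by (auto simp: mult.commute)
qed

lemma HO_y_Infinity: "HO coord_y Infinity (- int (2 * g + 1))"
proof -
  have PC: "Infinity \<in> C" by simp
  have "lp Infinity = coord_s g" by (simp add: lp_def)
  then have "HO (\<lambda>z. coord_s g z * coord_x z ^ (g + 1)) Infinity (1 + int (g + 1) * (- 2))"
    using HO_mult[OF PC HO_lp[OF PC] HO_power[OF PC HO_x_Infinity]] by metis
  moreover have "\<forall>\<^sub>F z in ae. coord_y z = coord_s g z * coord_x z ^ (g + 1)"
    using x_nonzero_ae by eventually_elim (auto simp: affine_curve_def)
  ultimately have "HO coord_y Infinity (1 + int (g + 1) * (- 2))" by (rule HO_cong)
  then show ?thesis by (simp add: algebra_simps)
qed

text \<open>2 deg A is even and 2 deg B + deg f is odd, so the leading terms of the norm never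
  cancel.\<close>

lemma degree_Nm:
  "A \<noteq> 0 \<Longrightarrow> B = 0 \<Longrightarrow> degree (Nm A B) = 2 * degree A"
  "B \<noteq> 0 \<Longrightarrow> A = 0 \<Longrightarrow> degree (Nm A B) = 2 * degree B + (2 * g + 1)"
  "A \<noteq> 0 \<Longrightarrow> B \<noteq> 0 \<Longrightarrow> degree (Nm A B) = max (2 * degree A) (2 * degree B + (2 * g + 1))"
proof -
  show "A \<noteq> 0 \<Longrightarrow> B = 0 \<Longrightarrow> degree (Nm A B) = 2 * degree A" by (simp add: degree_power_eq)
  have d: "degree (B\<^sup>2 * f) = 2 * degree B + (2 * g + 1)" if "B \<noteq> 0"
    using that f_nz by (simp add: degree_mult_eq degree_power_eq deg_f)
  then show "B \<noteq> 0 \<Longrightarrow> A = 0 \<Longrightarrow> degree (Nm A B) = 2 * degree B + (2 * g + 1)" by simp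
  show "degree (Nm A B) = max (2 * degree A) (2 * degree B + (2 * g + 1))" if nz: "A \<noteq> 0" "B \<noteq> 0"
  proof -
    have a: "degree (A\<^sup>2) = 2 * degree A" using nz by (simp add: degree_power_eq)
    have "2 * degree A < 2 * degree B + (2 * g + 1) \<or> 2 * degree B + (2 * g + 1) < 2 * degree A" by presburger
    then show ?thesis
    proof
      assume lt: "2 * degree A < 2 * degree B + (2 * g + 1)"
      then have "degree (A\<^sup>2 + - (B\<^sup>2 * f)) = degree (- (B\<^sup>2 * f))"
        by (intro degree_add_eq_right) (use a d nz in simp)
      then show ?thesis using lt d nz by simp
    next
      assume lt: "2 * degree B + (2 * g + 1) < 2 * degree A"
      then have "degree (A\<^sup>2 + - (B\<^sup>2 * f)) = degree (A\<^sup>2)"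
        by (intro degree_add_eq_left) (use a d nz in simp)
      then show ?thesis using lt a by simp
    qed
  qed
qed

text \<open>By the same parity, A and B y have different pole orders at Infinity, and the larger one
  wins.\<close>

lemma HO_pxy_Infinity:
  assumes "A \<noteq> 0 \<or> B \<noteq> 0"
  shows "HO (pxy A B) Infinity (- int (degree (Nm A B)))"
proof -
  have PC: "Infinity \<in> C" by simp
  have By: "HO (\<lambda>z. px B z * coord_y z) Infinity (- int (2 * degree B + (2 * g + 1)))" if "B \<noteq> 0"
    using HO_mult[OF PC HO_px_Infinity[OF that] HO_y_Infinity] by (simp add: algebra_simps)
  have Ax: "HO (px A) Infinity (- int (2 * degree A))" if "A \<noteq> 0"
    using HO_px_Infinity[OF that] by simp
  have "2 * degree A < 2 * degree B + (2 * g + 1) \<or> 2 * degree B + (2 * g + 1) < 2 * degree A" by presburger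
  then consider "B = 0" | "A = 0" | "A \<noteq> 0" "B \<noteq> 0" "2 * degree A < 2 * degree B + (2 * g + 1)"
    | "A \<noteq> 0" "B \<noteq> 0" "2 * degree B + (2 * g + 1) < 2 * degree A" by blast
  then show ?thesis
  proof cases
    case 1 then show ?thesis using Ax assms degree_Nm(1) by simp
  next
    case 2 then show ?thesis using By assms degree_Nm(2) by simp
  next
    case 3
    then have "HO (\<lambda>z. px B z * coord_y z + px A z) Infinity (- int (2 * degree B + (2 * g + 1)))"
      by (intro HO_add[OF PC By Ax]) auto
    then show ?thesis using degree_Nm(3) 3 by (simp add: add.commute max_def)
  next
    case 4
    then have "HO (\<lambda>z. px A z + px B z * coord_y z) Infinity (- int (2 * degree A))"
      by (intro HO_add[OF PC Ax By]) auto
    then show ?thesis using degree_Nm(3) 4 by (simp add: max_def)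
  qed
qed

section \<open>Orders along a fibre of x and the degree of the divisor of a function\<close>

definition over :: "complex \<Rightarrow> point set" where "over a = {P \<in> affine_curve f. coord_x P = a}"

lemma over_branch: "poly f a = 0 \<Longrightarrow> over a = {Affine a 0}"
  by (auto simp: over_def affine_curve_def)

lemma over_split:
  assumes "poly f a \<noteq> 0"
  obtains c where "c \<noteq> 0" "over a = {Affine a c, Affine a (- c)}"
proof
  define c where "c = csqrt (poly f a)"
  show "c \<noteq> 0" using assms by (simp add: c_def)
  have c2: "poly f a = c\<^sup>2" by (simp add: c_def)
  show "over a = {Affine a c, Affine a (- c)}"
    by (auto simp: over_def affine_curve_def c2 power2_eq_iff)
qed

lemma finite_over: "finite (over a)"
proof (cases "poly f a = 0")
  case True then show ?thesis by (simp add: over_branch)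
next
  case False
  then obtain c where "over a = {Affine a c, Affine a (- c)}" by (rule over_split)
  then show ?thesis by simp
qed

lemma sum_ram: "(\<Sum>P\<in>over a. ram P) = 2"
proof (cases "poly f a = 0")
  case True then show ?thesis by (simp add: over_branch ram_def)
next
  case False
  then obtain c where "c \<noteq> 0" "over a = {Affine a c, Affine a (- c)}" by (rule over_split)
  then show ?thesis by (simp add: ram_def)
qed

text \<open>Suppose A + B y vanishes at P. If y(P) is nonzero, the conjugate A - B y does not vanish
  at P, and A + B y is the norm divided by it. At a branch point B y has order 1 and A, if nonzero,
  order at least 2, while the norm has order 1.\<close>

lemma HO_pxy_primitive:
  assumes P: "P \<in> affine_curve f" and prim: "poly A (coord_x P) \<noteq> 0 \<or> poly B (coord_x P) \<noteq> 0"
  shows "HO (pxy A B) P (if pxy A B P = 0 then int (order (coord_x P) (Nm A B)) else 0)"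
proof (cases "pxy A B P = 0")
  case False
  then show ?thesis using HO_reg_nonzero[OF _ reg_pxy[OF P] False] P by simp
next
  case True
  have PC: "P \<in> C" using P by simp
  have nz: "A \<noteq> 0 \<or> B \<noteq> 0" using prim by auto
  have N: "Nm A B \<noteq> 0" by (rule c1.norm_nz[OF nz])
  let ?a = "coord_x P"
  show ?thesis
  proof (cases "coord_y P = 0")
    case False
    then have B: "poly B ?a \<noteq> 0" using True prim by auto
    have "poly A ?a = - (poly B ?a * coord_y P)" using True by (simp add: eq_neg_iff_add_eq_0)
    then have e: "pxy A (- B) P = - 2 * (poly B ?a * coord_y P)" by simp
    have nz': "pxy A (- B) P \<noteq> 0" unfolding e using B False by simp
    have "HO (\<lambda>z. px (Nm A B) z / pxy A (- B) z) P (int (order ?a (Nm A B)) * ram P - 0)"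
      by (rule HO_divide[OF PC HO_px[OF P N] HO_reg_nonzero[OF PC reg_pxy[OF P] nz']])
    moreover have "\<forall>\<^sub>F z in ae. pxy A B z = px (Nm A B) z / pxy A (- B) z"
      using affine_ae reg_nonzero_ae[OF PC reg_pxy[OF P] nz']
    proof eventually_elim
      case (elim z)
      then show ?case using pxy_conj[of z A B] by (metis nonzero_mult_div_cancel_right)
    qed
    ultimately have "HO (pxy A B) P (int (order ?a (Nm A B)) * ram P - 0)" by (rule HO_cong)
    then show ?thesis using True False by (simp add: ram_def)
  next
    case y0: True
    then have A0: "poly A ?a = 0" and B: "poly B ?a \<noteq> 0" using True prim by auto
    have f0: "poly f ?a = 0" using eqn_affine[OF P] y0 by simp
    have B0: "B \<noteq> 0" using B by auto
    have ord: "order ?a (B\<^sup>2 * f) = 1" "B\<^sup>2 * f \<noteq> 0"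
      using B B0 f_nz f0 by (auto simp: order_mult order_0I order_f)
    have ordA: "order ?a (A\<^sup>2) = 2 * order ?a A" "order ?a A \<ge> 1" if "A \<noteq> 0"
      using that A0 order_root[of A ?a] by (simp_all add: power2_eq_square order_mult)
    have "order ?a (- (B\<^sup>2 * f) + A\<^sup>2) = order ?a (- (B\<^sup>2 * f))"
      by (rule order_add_eq_left) (use ord ordA in \<open>cases "A = 0"; simp add: order_uminus\<close>)+
    then have oN: "order ?a (Nm A B) = 1" using ord by (simp add: order_uminus)
    have By: "HO (\<lambda>z. px B z * coord_y z) P 1"
      using HO_mult[OF PC HO_reg_nonzero[OF PC reg_px[OF P] B] HO_y[OF P]] y0 by (simp add: ram_def)
    have "HO (pxy A B) P 1"
    proof (cases "A = 0")
      case False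
      have "HO (px A) P (int (order ?a A) * 2)" using HO_px[OF P False] y0 by (simp add: ram_def)
      then have "HO (\<lambda>z. px B z * coord_y z + px A z) P 1"
        by (rule HO_add[OF PC By]) (use ordA(2)[OF False] in simp)
      then show ?thesis by (simp add: add.commute)
    qed (use By in simp)
    then show ?thesis using True oN by simp
  qed
qed

text \<open>A common factor x - a of A and B adds \<open>ram P\<close> at each point of the fibre, 2
  in total, and 2 to the order of the norm; induction on that order removes it. In the primitive
  case at most one point of the fibre is a zero, and it carries the full order of the norm.\<close>

lemma local_orders:
  assumes "A \<noteq> 0 \<or> B \<noteq> 0"
  shows "\<exists>n. (\<forall>P\<in>over a. HO (pxy A B) P (n P)) \<and> (\<Sum>P\<in>over a. n P) = int (order a (Nm A B))"
  using assms
proof (induction "order a (Nm A B)" arbitrary: A B rule: less_induct)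
  case less
  have N: "Nm A B \<noteq> 0" by (rule c1.norm_nz[OF less.prems])
  show ?case
  proof (cases "poly A a = 0 \<and> poly B a = 0")
    case True
    then obtain A' B' where AB: "A = [:- a, 1:] * A'" "B = [:- a, 1:] * B'"
      by (auto simp: poly_eq_0_iff_dvd elim!: dvdE)
    have N': "Nm A B = [:- a, 1:]\<^sup>2 * Nm A' B'"
      unfolding AB by (simp only: power_mult_distrib right_diff_distrib mult.assoc)
    have nz: "A' \<noteq> 0 \<or> B' \<noteq> 0" using less.prems AB by auto
    have "order a (Nm A B) = 2 + order a (Nm A' B')"
      unfolding N' by (subst order_mult) (use N N' in \<open>auto simp: order_power_n_n\<close>)
    moreover from this obtain n' where n': "\<forall>P\<in>over a. HO (pxy A' B') P (n' P)"
      "(\<Sum>P\<in>over a. n' P) = int (order a (Nm A' B'))"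
      using less.hyps[of A' B'] nz by auto
    moreover have "HO (pxy A B) P (ram P + n' P)" if "P \<in> over a" for P
    proof -
      have P: "P \<in> affine_curve f" "coord_x P = a" using that by (auto simp: over_def)
      have "HO (\<lambda>z. px [:- a, 1:] z * pxy A' B' z) P (ram P + n' P)"
        using HO_mult[of P _ _ _ _] HO_x_minus[OF P(1)] n' that P by auto
      moreover have "px [:- a, 1:] z * pxy A' B' z = pxy A B z" for z
        unfolding AB by (simp add: algebra_simps)
      ultimately show ?thesis by simp
    qed
    ultimately show ?thesis
      by (intro exI[of _ "\<lambda>P. ram P + n' P"]) (auto simp: sum.distrib sum_ram)
  next
    case prim: False
    let ?n = "\<lambda>P. if pxy A B P = 0 then int (order (coord_x P) (Nm A B)) else 0"
    have H: "\<forall>P\<in>over a. HO (pxy A B) P (?n P)"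
    proof
      fix P assume "P \<in> over a"
      then have P: "P \<in> affine_curve f" "coord_x P = a" by (auto simp: over_def)
      with prim show "HO (pxy A B) P (?n P)" by (intro HO_pxy_primitive) auto
    qed
    have "(\<Sum>P\<in>over a. ?n P) = int (order a (Nm A B))"
    proof (cases "poly f a = 0")
      case True
      have "order a (Nm A B) = 0" if "poly A a \<noteq> 0"
        by (rule order_0I) (use that True in simp)
      then show ?thesis unfolding over_branch[OF True] by (cases "poly A a = 0") simp_all
    next
      case False
      then obtain c where c: "c \<noteq> 0" "over a = {Affine a c, Affine a (- c)}" by (rule over_split)
      have "Affine a c \<in> affine_curve f" using c(2) over_def by auto
      from pxy_conj[OF this, of A B] have
        e: "(poly A a + poly B a * c) * (poly A a - poly B a * c) = poly (Nm A B) a" by simp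
      have "\<not> (poly A a + poly B a * c = 0 \<and> poly A a - poly B a * c = 0)"
      proof
        assume z: "poly A a + poly B a * c = 0 \<and> poly A a - poly B a * c = 0"
        then have "2 * poly A a = 0" by algebra
        with z c(1) prim show False by simp
      qed
      moreover have "order a (Nm A B) = 0"
        if "poly A a + poly B a * c \<noteq> 0" "poly A a - poly B a * c \<noteq> 0"
        by (rule order_0I) (use that e in \<open>metis mult_eq_0_iff\<close>)
      ultimately show ?thesis using c by auto
    qed
    with H show ?thesis by (intro exI[of _ ?n]) auto
  qed
qed

lemma sum_order_degree:
  fixes p :: "complex poly"
  shows "(\<Sum>a | poly p a = 0. order a p) = (if p = 0 then 0 else degree p)"
proof (cases "p = 0")
  case False
  have "degree p = size (proots p)" by (simp add: size_proots_complex)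
  also have "\<dots> = (\<Sum>a | poly p a = 0. order a p)"
    using False by (simp add: size_multiset_overloaded_eq)
  finally show ?thesis using False by simp
qed (simp add: infinite_UNIV_char_0)

text \<open>The orders at affine points add up to the number of roots of the norm with multiplicity,
  hence to its degree, and the order at Infinity is minus that degree.\<close>

lemma global_orders:
  assumes nz: "A \<noteq> 0 \<or> B \<noteq> 0"
  shows "\<exists>n. (\<forall>P\<in>C. HO (pxy A B) P (n P)) \<and> finite {P \<in> C. n P \<noteq> 0} \<and>
    (\<Sum>P | P \<in> C \<and> n P \<noteq> 0. n P) = 0"
proof -
  let ?N = "Nm A B"
  obtain m where m: "\<forall>P\<in>over a. HO (pxy A B) P (m a P)" "(\<Sum>P\<in>over a. m a P) = int (order a ?N)" for a
    using local_orders[OF nz] by metis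
  define n where "n P = (if P = Infinity then - int (degree ?N) else m (coord_x P) P)" for P
  have HOn: "HO (pxy A B) P (n P)" if "P \<in> C" for P
    using that m(1)[of "coord_x P"] HO_pxy_Infinity[OF nz] by (auto simp: n_def over_def)
  have pos: "m a P \<ge> 0" if "P \<in> over a" for a P
    using HO_reg(1)[of P "pxy A B" "m a P"] m(1) that reg_pxy by (auto simp: over_def)
  have N: "?N \<noteq> 0" by (rule c1.norm_nz[OF nz])
  let ?R = "{a. poly ?N a = 0}" let ?S = "\<Union>a\<in>?R. over a"
  have fin: "finite ?R" by (rule poly_roots_finite[OF N])
  \<comment> \<open>Orders are nonnegative on the affine curve, so a vanishing sum over the fibre
    makes each of them vanish.\<close>
  have z: "m a P = 0" if "P \<in> over a" "a \<notin> ?R" for a P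
  proof -
    have "order a ?N = 0" by (rule order_0I) (use that in simp)
    then have "(\<Sum>P\<in>over a. m a P) = 0" using m(2)[of a] by simp
    then show ?thesis using that pos sum_nonneg_eq_0_iff[OF finite_over, of a "m a"] by auto
  qed
  have sub: "{P \<in> C. n P \<noteq> 0} \<subseteq> insert Infinity ?S"
  proof
    fix P assume P: "P \<in> {P \<in> C. n P \<noteq> 0}"
    show "P \<in> insert Infinity ?S"
    proof (cases "P = Infinity")
      case False
      then have "P \<in> over (coord_x P)" "m (coord_x P) P \<noteq> 0" using P by (auto simp: n_def over_def)
      then show ?thesis using z by blast
    qed simp
  qed
  have finS: "finite (insert Infinity ?S)" using fin finite_over by auto
  have inC: "insert Infinity ?S \<subseteq> C" by (auto simp: over_def)
  have "(\<Sum>P | P \<in> C \<and> n P \<noteq> 0. n P) = (\<Sum>P\<in>insert Infinity ?S. n P)"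
    by (rule sum.mono_neutral_left[OF finS sub]) (use inC in auto)
  also have "\<dots> = n Infinity + (\<Sum>P\<in>?S. n P)"
    by (rule sum.insert) (use finS in \<open>auto simp: over_def\<close>)
  also have "(\<Sum>P\<in>?S. n P) = (\<Sum>a\<in>?R. \<Sum>P\<in>over a. n P)"
    by (rule sum.UNION_disjoint[OF fin]) (auto simp: finite_over, auto simp: over_def)
  also have "\<dots> = (\<Sum>a\<in>?R. int (order a ?N))"
  proof (rule sum.cong[OF refl])
    fix a
    have "(\<Sum>P\<in>over a. n P) = (\<Sum>P\<in>over a. m a P)"
      by (rule sum.cong) (auto simp: n_def over_def)
    then show "(\<Sum>P\<in>over a. n P) = int (order a ?N)" using m(2) by simp
  qed
  also have "\<dots> = int (degree ?N)" using sum_order_degree[of ?N] N by (simp flip: of_nat_sum)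
  finally have "(\<Sum>P | P \<in> C \<and> n P \<noteq> 0. n P) = 0" by (simp add: n_def)
  then show ?thesis using HOn finite_subset[OF sub finS] by blast
qed

text \<open>Multiplication by the conjugate turns the denominator into a polynomial in x. P is taken
  off the branch locus so that the power of its local parameter is a power of x - x(P).\<close>

lemma rational_form:
  assumes P: "P \<in> affine_curve f" and y: "coord_y P \<noteq> 0" and h: "HO h P n"
  obtains A B D where "D \<noteq> 0" "A \<noteq> 0 \<or> B \<noteq> 0" "\<forall>\<^sub>F z in ae. h z = pxy A B z / px D z"
proof -
  have PC: "P \<in> C" using P by simp
  obtain u where u: "reg u P" "u P \<noteq> 0" "\<forall>\<^sub>F z in ae. h z = lp P z powi n * u z" using h HO_def by auto
  obtain p q V where 1: "p \<in> polyfuns {coord_x, coord_y}" "q \<in> polyfuns {coord_x, coord_y}" "openin T V" "P \<in> V"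
    "\<And>z. z \<in> V \<Longrightarrow> q z \<noteq> 0" "\<And>z. z \<in> V \<Longrightarrow> u z = p z / q z"
    using u(1) P by (auto elim!: reg_atE)
  obtain A B where AB: "\<forall>z\<in>affine_curve f. p z = pxy A B z" using c1.polyfuns_normal_form[OF 1(1)] by blast
  obtain A' B' where AB': "\<forall>z\<in>affine_curve f. q z = pxy A' B' z" using c1.polyfuns_normal_form[OF 1(2)] by blast
  have nz': "A' \<noteq> 0 \<or> B' \<noteq> 0" using 1(5)[OF 1(4)] AB' P by auto
  let ?x = "[:- coord_x P, 1:]"
  \<comment> \<open>\<open>nat\<close> sends negative integers to 0, so at most one of the two
    powers is nontrivial and the sign of n decides where it goes.\<close>
  let ?num = "?x ^ nat n" and ?den = "?x ^ nat (- n)"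
  let ?A = "?num * (A * A' - B * B' * f)" and ?B = "?num * (B * A' - A * B')" and ?D = "?den * Nm A' B'"
  have lp: "lp P = px ?x" using P y by (auto simp: lp_def)
  have D: "?D \<noteq> 0" using c1.norm_nz[OF nz'] by simp
  have eq: "\<forall>\<^sub>F z in ae. h z = pxy ?A ?B z / px ?D z"
    using u(3) affine_ae ae_open[OF 1(3,4)] lp_nonzero_ae[OF PC]
      HO_nonzero_ae[OF PC HO_px[OF P c1.norm_nz[OF nz']]]
  proof eventually_elim
    case (elim z)
    define X where "X = px ?x z"
    have X: "X \<noteq> 0" using elim lp by (simp add: X_def)
    have c: "pxy A' B' z * pxy A' (- B') z = px (Nm A' B') z" using elim by (intro pxy_conj)
    have cnz: "pxy A' (- B') z \<noteq> 0" "pxy A' B' z \<noteq> 0" using elim(5) c by (metis mult_eq_0_iff)+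
    have num: "pxy ?A ?B z = X ^ nat n * (pxy A B z * pxy A' (- B') z)"
      using eqn_affine[OF elim(2)] by (simp add: X_def algebra_simps power2_eq_square)
    have "h z = X powi n * (pxy A B z / pxy A' B' z)"
      using elim 1(6)[OF elim(3)] AB AB' by (simp add: lp X_def)
    also have "X powi n = X ^ nat n / X ^ nat (- n)"
      using X by (simp add: power_int_def power_inverse divide_inverse)
    also have "pxy A B z / pxy A' B' z = (pxy A B z * pxy A' (- B') z) / px (Nm A' B') z"
      using cnz by (subst c[symmetric]) simp
    finally have "h z = (X ^ nat n * (pxy A B z * pxy A' (- B') z)) / (X ^ nat (- n) * px (Nm A' B') z)"
      by simp
    also have "X ^ nat (- n) * px (Nm A' B') z = px ?D z" by (simp add: X_def poly_power)
    finally show ?case using num by simp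
  qed
  have "?A \<noteq> 0 \<or> ?B \<noteq> 0"
  proof (rule ccontr)
    assume "\<not> (?A \<noteq> 0 \<or> ?B \<noteq> 0)"
    then have z: "?A = 0" "?B = 0" by blast+
    have "\<forall>\<^sub>F z in ae. h z = 0" using eq unfolding z by eventually_elim simp
    with HO_nonzero_ae[OF PC h] have "eventually (\<lambda>_. False) ae" by eventually_elim simp
    then show False using ae_not_bot by simp
  qed
  with D eq that show ?thesis by blast
qed

lemma Affine_0_1: "Affine 0 e \<in> affine_curve f \<longleftrightarrow> e = 1 \<or> e = -1"
  by (simp add: Affine_iff f_0 power2_eq_1_iff)

section \<open>Degrees, principal divisors and the Jacobian group\<close>

lemma divisor_degree_superset:
  assumes "finite S" "Poly_Mapping.keys D \<subseteq> S"
  shows "divisor_degree D = (\<Sum>P\<in>S. Poly_Mapping.lookup D P)"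
  unfolding divisor_degree_def
  by (rule sum.mono_neutral_left) (use assms in \<open>auto simp: in_keys_iff\<close>)

lemma divisor_degree_add: "divisor_degree (D + E) = divisor_degree D + divisor_degree E"
proof -
  let ?S = "Poly_Mapping.keys D \<union> Poly_Mapping.keys E"
  have "finite ?S" by simp
  then show ?thesis
    using keys_add[of D E] by (simp add: divisor_degree_superset[of ?S] lookup_add sum.distrib)
qed

lemma divisor_degree_0 [simp]: "divisor_degree 0 = 0"
  by (simp add: divisor_degree_def)

lemma divisor_degree_uminus: "divisor_degree (- D) = - divisor_degree D"
  using divisor_degree_add[of D "- D"] by simp

lemma divisor_degree_diff: "divisor_degree (D - E) = divisor_degree D - divisor_degree E"
  using divisor_degree_add[of D "- E"] by (simp add: divisor_degree_uminus)

lemma divisor_degree_frag_of [simp]: "divisor_degree (frag_of P) = 1"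
  by (simp add: divisor_degree_def)

lemma divisor_degree_cmul: "divisor_degree (frag_cmul k D) = k * divisor_degree D"
  using divisor_degree_superset[of "Poly_Mapping.keys D" "frag_cmul k D"] keys_cmul[of k D]
  by (simp add: divisor_degree_def sum_distrib_left)

abbreviation "PD \<equiv> principal_divisors X"

text \<open>Any rational function is a quotient of two polynomial functions, each of which has
  orders summing to zero by \<open>global_orders\<close>.\<close>

lemma principal_degree:
  assumes "D \<in> PD"
  shows "divisor_degree D = 0"
proof -
  obtain h where D: "Poly_Mapping.keys D \<subseteq> C" and h: "\<And>P. P \<in> C \<Longrightarrow> HO h P (Poly_Mapping.lookup D P)"
    using assms unfolding principal_iff by blast
  \<comment> \<open>The condition f(0) = 1 provides a point off the branch locus, as
    \<open>rational_form\<close> requires.\<close>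
  have P1: "Affine 0 1 \<in> affine_curve f" "coord_y (Affine 0 1) \<noteq> 0" by (simp_all add: Affine_0_1)
  obtain A B E where E: "E \<noteq> 0" and AB: "A \<noteq> 0 \<or> B \<noteq> 0" and eq: "\<forall>\<^sub>F z in ae. h z = pxy A B z / px E z"
    by (rule rational_form[OF P1 h]) (use P1 in auto)
  obtain n where n: "\<And>P. P \<in> C \<Longrightarrow> HO (pxy A B) P (n P)" "finite {P \<in> C. n P \<noteq> 0}"
    "(\<Sum>P | P \<in> C \<and> n P \<noteq> 0. n P) = 0"
    using global_orders[OF AB] by blast
  have "E \<noteq> 0 \<or> (0 :: complex poly) \<noteq> 0" using E by simp
  then obtain m where m: "\<And>P. P \<in> C \<Longrightarrow> HO (pxy E 0) P (m P)" "finite {P \<in> C. m P \<noteq> 0}"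
    "(\<Sum>P | P \<in> C \<and> m P \<noteq> 0. m P) = 0"
    using global_orders[of E 0] by blast
  have lk: "Poly_Mapping.lookup D P = n P - m P" if "P \<in> C" for P
  proof -
    have "HO (\<lambda>z. pxy A B z / pxy E 0 z) P (n P - m P)" by (rule HO_divide[OF that n(1) m(1)]) fact+
    then have "HO (\<lambda>z. pxy A B z / px E z) P (n P - m P)" by simp
    from HO_cong[OF this eq] show ?thesis using HO_unique[OF that h[OF that]] by simp
  qed
  let ?S = "{P \<in> C. n P \<noteq> 0} \<union> {P \<in> C. m P \<noteq> 0}"
  have S: "finite ?S" "?S \<subseteq> C" using n m by auto
  have "Poly_Mapping.keys D \<subseteq> ?S" using D lk by (auto simp: in_keys_iff)
  then have "divisor_degree D = (\<Sum>P\<in>?S. Poly_Mapping.lookup D P)" by (rule divisor_degree_superset[OF S(1)])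
  also have "\<dots> = (\<Sum>P\<in>?S. n P) - (\<Sum>P\<in>?S. m P)"
    unfolding sum_subtractf[symmetric] by (rule sum.cong) (use S(2) lk in auto)
  also have "(\<Sum>P\<in>?S. n P) = (\<Sum>P | P \<in> C \<and> n P \<noteq> 0. n P)"
    by (rule sum.mono_neutral_right[OF S(1)]) auto
  also have "(\<Sum>P\<in>?S. m P) = (\<Sum>P | P \<in> C \<and> m P \<noteq> 0. m P)"
    by (rule sum.mono_neutral_right[OF S(1)]) auto
  finally show ?thesis using n m by simp
qed

lemma principal_0: "0 \<in> PD"
  unfolding principal_iff by (auto intro!: exI[of _ "\<lambda>_. 1"] HO_const)

lemma principal_add:
  assumes "D \<in> PD" "E \<in> PD"
  shows "D + E \<in> PD"
proof -
  obtain h k where "\<forall>P\<in>C. HO h P (Poly_Mapping.lookup D P)" "\<forall>P\<in>C. HO k P (Poly_Mapping.lookup E P)"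
    using assms principal_iff by blast
  then have "\<forall>P\<in>C. HO (\<lambda>z. h z * k z) P (Poly_Mapping.lookup (D + E) P)"
    using HO_mult by (auto simp: lookup_add simp del: ball_simps)
  moreover have "Poly_Mapping.keys (D + E) \<subseteq> C" using keys_add[of D E] assms principal_iff by blast
  ultimately show ?thesis unfolding principal_iff by blast
qed

lemma principal_uminus:
  assumes "D \<in> PD"
  shows "- D \<in> PD"
proof -
  obtain h where "\<forall>P\<in>C. HO h P (Poly_Mapping.lookup D P)" using assms principal_iff by blast
  then have "\<forall>P\<in>C. HO (\<lambda>z. inverse (h z)) P (Poly_Mapping.lookup (- D) P)"
    using HO_inverse by (auto simp del: ball_simps)
  then show ?thesis using assms unfolding principal_iff by auto
qed

lemma principal_diff: "D \<in> PD \<Longrightarrow> E \<in> PD \<Longrightarrow> D - E \<in> PD"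
  using principal_add[OF _ principal_uminus] by force

abbreviation "D0 \<equiv> degree_zero_divisors X"

lemma carrier_D0: "D \<in> carrier D0 \<longleftrightarrow> Poly_Mapping.keys D \<subseteq> C \<and> divisor_degree D = 0"
  by (simp add: degree_zero_divisors_def topspace_T)

lemma mult_D0 [simp]: "D \<otimes>\<^bsub>D0\<^esub> E = D + E" and one_D0 [simp]: "\<one>\<^bsub>D0\<^esub> = 0"
  by (simp_all add: degree_zero_divisors_def free_Abelian_group_def)

lemma comm_group_D0: "comm_group D0"
proof (rule comm_groupI)
  fix D E assume "D \<in> carrier D0" "E \<in> carrier D0"
  then show "D \<otimes>\<^bsub>D0\<^esub> E \<in> carrier D0"
    using keys_add[of D E] by (auto simp: carrier_D0 divisor_degree_add)
  fix D assume "D \<in> carrier D0"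
  then show "\<exists>E\<in>carrier D0. E \<otimes>\<^bsub>D0\<^esub> D = \<one>\<^bsub>D0\<^esub>"
    by (intro bexI[of _ "- D"]) (auto simp: carrier_D0 divisor_degree_uminus)
qed (auto simp: carrier_D0 add_ac)

lemma inv_D0: "D \<in> carrier D0 \<Longrightarrow> inv\<^bsub>D0\<^esub> D = - D"
  using comm_group_D0 unfolding comm_group_def
  by (intro group.inv_equality) (auto simp: carrier_D0 divisor_degree_uminus)

lemma subgroup_PD: "subgroup PD D0"
proof (rule group.subgroupI)
  show "group D0" using comm_group_D0 comm_group_def by blast
  show sub: "PD \<subseteq> carrier D0" using principal_degree principal_iff by (auto simp: carrier_D0)
  show "PD \<noteq> {}" using principal_0 by blast
  fix D E assume "D \<in> PD" "E \<in> PD"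
  then show "D \<otimes>\<^bsub>D0\<^esub> E \<in> PD" by (simp add: principal_add)
  fix D assume "D \<in> PD"
  then show "inv\<^bsub>D0\<^esub> D \<in> PD" using sub by (subst inv_D0) (auto simp: principal_uminus)
qed

abbreviation "J \<equiv> Jac g f"
abbreviation "cls \<equiv> divisor_class X"

lemma J_eq: "J = D0 Mod PD"
  by (simp add: Jac_def jacobian_group_def)

lemma comm_group_J: "comm_group J"
  unfolding J_eq by (rule comm_group.abelian_FactGroup[OF comm_group_D0 subgroup_PD])

lemma carrier_J: "carrier J = cls ` carrier D0"
  unfolding J_eq carrier_FactGroup divisor_class_def by simp

lemma cls_iff: "E \<in> cls D \<longleftrightarrow> E - D \<in> PD"
  by (auto simp: divisor_class_def r_coset_def) (metis diff_add_cancel)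

lemma cls_eq_iff: "cls D = cls E \<longleftrightarrow> D - E \<in> PD"
proof
  assume "cls D = cls E"
  then show "D - E \<in> PD" using cls_iff[of D D] cls_iff[of D E] principal_0 by auto
next
  assume DE: "D - E \<in> PD"
  have "F - D \<in> PD \<longleftrightarrow> F - E \<in> PD" for F
    using principal_add[of "F - D" "D - E"] principal_diff[of "F - E" "D - E"] DE by auto
  then show "cls D = cls E" by (auto simp: cls_iff)
qed

lemma cls_mult: "D \<in> carrier D0 \<Longrightarrow> E \<in> carrier D0 \<Longrightarrow> cls D \<otimes>\<^bsub>J\<^esub> cls E = cls (D + E)"
  using normal.rcos_sum[OF comm_group.subgroup_imp_normal[OF comm_group_D0 subgroup_PD]]
  unfolding J_eq divisor_class_def by simp

lemma cls_inv: "D \<in> carrier D0 \<Longrightarrow> inv\<^bsub>J\<^esub> (cls D) = cls (- D)"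
proof -
  assume D: "D \<in> carrier D0"
  then have D': "- D \<in> carrier D0" by (simp add: carrier_D0 divisor_degree_uminus)
  have "cls (- D) \<otimes>\<^bsub>J\<^esub> cls D = \<one>\<^bsub>J\<^esub>"
    unfolding cls_mult[OF D' D] by (auto simp: J_eq FactGroup_def cls_iff)
  moreover have "cls D \<in> carrier J" "cls (- D) \<in> carrier J" using D D' carrier_J by auto
  moreover have "group J" using comm_group_J comm_group_def by blast
  ultimately show ?thesis using group.inv_equality by metis
qed

end

section \<open>Effective divisors and reduction\<close>

fun invol :: "point \<Rightarrow> point" where
  "invol (Affine a b) = Affine a (- b)" | "invol Infinity = Infinity"

lemma invol_invol [simp]: "invol (invol P) = P"
  by (cases P) auto

lemma coord_x_invol [simp]: "coord_x (invol P) = coord_x P"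
  and coord_y_invol [simp]: "coord_y (invol P) = - coord_y P"
  by (cases P; simp)+

lemma count_invol: "count (image_mset invol Z) P = count Z (invol P)"
proof (induction Z)
  case (add Q Z)
  have "P = invol Q \<longleftrightarrow> invol P = Q" by (metis invol_invol)
  then show ?case using add by auto
qed simp

definition eff :: "'a multiset \<Rightarrow> ('a \<Rightarrow>\<^sub>0 int)" where "eff Z = (\<Sum>P\<in>#Z. frag_of P)"

lemma eff_add_mset [simp]: "eff (add_mset P Z) = frag_of P + eff Z"
  and eff_empty [simp]: "eff {#} = 0"
  and eff_union: "eff (Z + N) = eff Z + eff N"
  by (simp_all add: eff_def)

lemma lookup_eff: "Poly_Mapping.lookup (eff Z) P = int (count Z P)"
  by (induction Z) (auto simp: lookup_add)

lemma divisor_degree_eff [simp]: "divisor_degree (eff Z) = int (size Z)"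
proof -
  have "Poly_Mapping.keys (eff Z) = set_mset Z" by (auto simp: in_keys_iff lookup_eff)
  then show ?thesis
    by (simp add: divisor_degree_def lookup_eff size_multiset_overloaded_eq)
qed

text \<open>Normalised to degree zero at Infinity: additive in Z and blind to copies of Infinity, so
  multisets can be padded to any size.\<close>

definition dv :: "point multiset \<Rightarrow> (point \<Rightarrow>\<^sub>0 int)" where
  "dv Z = eff Z - frag_cmul (int (size Z)) (frag_of Infinity)"

lemma dv_union: "dv (Z + N) = dv Z + dv N"
  by (simp add: dv_def eff_union frag_cmul_distrib)

lemma dv_empty [simp]: "dv {#} = 0"
  by (simp add: dv_def)

lemma dv_Infinity [simp]: "dv {#Infinity#} = 0"
  by (simp add: dv_def)

lemma dv_add_mset: "dv (add_mset P Z) = dv {#P#} + dv Z"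
  using dv_union[of "{#P#}" Z] by simp

lemma dv_add_Infinity [simp]: "dv (add_mset Infinity Z) = dv Z"
  by (simp add: dv_add_mset[of Infinity Z])

lemma dv_replicate_Infinity [simp]: "dv (replicate_mset n Infinity) = 0"
  by (induction n) auto

lemma lookup_dv: "Poly_Mapping.lookup (dv Z) P = int (count Z P) - (if P = Infinity then int (size Z) else 0)"
  by (simp add: dv_def lookup_minus lookup_eff)

lemma count_image_graph:
  "count (image_mset (\<lambda>a. Affine a (p a)) Z) (Affine a b) = (if b = p a then count Z a else 0)"
  "count (image_mset (\<lambda>a. Affine a (p a)) Z) Infinity = 0"
  by (induction Z) auto

text \<open>The constant c is chosen so that v + c u takes the value b at a. If u(a) = 0, a point is
  being repeated; then (b - v(a)) (b + v(a)) = u(a) w(a) suggests the second quotient, a Newton step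
  that raises the order of contact. The last component comes from f - (v + c u)^2 = u (w - 2 c v -
  c^2 u), whose second factor vanishes at a.\<close>

definition mstep :: "point \<Rightarrow> triplet \<Rightarrow> triplet" where
  "mstep P = (\<lambda>(u, v, w). let a = coord_x P; b = coord_y P;
     c = (if poly u a \<noteq> 0 then (b - poly v a) / poly u a else poly w a / (b + poly v a))
     in ([:- a, 1:] * u, v + smult c u, synthetic_div (w - smult (2 * c) v - smult (c\<^sup>2) u) a))"

text \<open>
  For a list of points without conjugate pairs this computes the Mumford representation
  \<open>f = v\<^sup>2 + u w\<close>: the points are the zeros \<open>x\<close> of \<open>u\<close> with \<open>y = v(x)\<close>.
\<close>

fun mum :: "complex poly \<Rightarrow> point list \<Rightarrow> triplet" where
  "mum f [] = (1, 0, f)" | "mum f (P # Ps) = mstep P (mum f Ps)"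

context hyperelliptic
begin

section \<open>The hyperelliptic involution and the divisors of x - a and y - v(x)\<close>

lemma invol_affine [simp]: "invol P \<in> affine_curve f \<longleftrightarrow> P \<in> affine_curve f"
  by (cases P) (auto simp: affine_curve_def)

lemma invol_C [simp]: "invol P \<in> C \<longleftrightarrow> P \<in> C"
  by (cases P) (auto simp: affine_curve_def)

lemma invol_image_C: "set_mset Z \<subseteq> C \<Longrightarrow> set_mset (image_mset invol Z) \<subseteq> C"
  by (metis image_subset_iff invol_C set_image_mset subset_iff)

lemma same_x:
  assumes "P \<in> affine_curve f" "Q \<in> affine_curve f" "coord_x P = coord_x Q"
  shows "P = Q \<or> P = invol Q"
proof -
  have "(coord_y P)\<^sup>2 = (coord_y Q)\<^sup>2" using assms eqn_affine by metis
  then show ?thesis using assms affine_coords[of P] affine_coords[of Q] by (metis invol.simps(1) power2_eq_iff)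
qed

lemma dv_carrier: "set_mset Z \<subseteq> C \<Longrightarrow> dv Z \<in> carrier D0"
proof -
  assume Z: "set_mset Z \<subseteq> C"
  have "Poly_Mapping.keys (dv Z) \<subseteq> set_mset Z \<union> {Infinity}"
    by (auto simp: in_keys_iff lookup_dv split: if_splits)
  then show ?thesis
    using Z by (auto simp: carrier_D0 dv_def divisor_degree_diff divisor_degree_cmul)
qed

lemma dv_keys: "set_mset Z \<subseteq> C \<Longrightarrow> Poly_Mapping.keys (dv Z) \<subseteq> C"
  using dv_carrier carrier_D0 by blast

text \<open>For affine P this is the divisor of x - x(P); at a branch point the pair is twice P,
  matching \<open>ram P = 2\<close>.\<close>

lemma dv_conj:
  assumes "P \<in> C"
  shows "dv {#P, invol P#} \<in> PD"
proof (cases "P = Infinity")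
  case True
  then show ?thesis by (simp add: principal_0)
next
  case False
  then have P: "P \<in> affine_curve f" using assms by simp
  let ?h = "px [:- coord_x P, 1:]"
  have "HO ?h Q (Poly_Mapping.lookup (dv {#P, invol P#}) Q)" if Q: "Q \<in> C" for Q
  proof (cases "Q = Infinity")
    case True
    have "invol P \<noteq> Infinity" using False by (cases P) auto
    then show ?thesis using HO_px_Infinity[of "[:- coord_x P, 1:]"] True False by (simp add: lookup_dv)
  next
    case Qf: False
    then have Qa: "Q \<in> affine_curve f" using Q by simp
    have "int (order (coord_x Q) [:- coord_x P, 1:]) * ram Q = int (count {#P, invol P#} Q)"
    proof (cases "coord_x Q = coord_x P")
      case True
      have o: "order (coord_x Q) [:- coord_x P, 1:] = 1" using order_power_n_n[of "coord_x P" 1] True by simp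
      from same_x[OF Qa P True] have "Q = P \<or> Q = invol P" .
      moreover have "P = invol P \<longleftrightarrow> coord_y P = 0" using P by (auto simp: affine_curve_def)
      ultimately show ?thesis unfolding o by (auto simp: ram_def)
    next
      case ne: False
      have "order (coord_x Q) [:- coord_x P, 1:] = 0" by (rule order_0I) (use ne in simp)
      then show ?thesis using ne by auto
    qed
    then show ?thesis using HO_px[OF Qa, of "[:- coord_x P, 1:]"] Qf by (simp add: lookup_dv)
  qed
  moreover have "Poly_Mapping.keys (dv {#P, invol P#}) \<subseteq> C" by (rule dv_keys) (use P in simp)
  ultimately show ?thesis unfolding principal_iff by blast
qed

text \<open>Up to principal divisors the involution is negation; this is how negative divisors
  become effective.\<close>

lemma dv_invol: "set_mset Z \<subseteq> C \<Longrightarrow> dv Z + dv (image_mset invol Z) \<in> PD"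
proof (induction Z)
  case (add P Z)
  then have "dv {#P, invol P#} + (dv Z + dv (image_mset invol Z)) \<in> PD"
    by (intro principal_add[OF dv_conj]) auto
  moreover have "dv {#P, invol P#} + (dv Z + dv (image_mset invol Z))
      = dv (add_mset P Z) + dv (image_mset invol (add_mset P Z))"
    by (simp add: dv_add_mset[of P Z] dv_add_mset[of P "{#invol P#}"] dv_add_mset[of "invol P" "image_mset invol Z"])
  ultimately show ?case by simp
qed (simp add: principal_0)

text \<open>The divisor of y - v(x): its norm is v^2 - f, so a root a of f - v^2 contributes the
  point (a, v(a)) with the multiplicity of the root.\<close>

lemma dv_graph:
  "dv (image_mset (\<lambda>a. Affine a (poly v a)) (proots (f - v\<^sup>2))) \<in> PD"
proof -
  let ?Z = "image_mset (\<lambda>a. Affine a (poly v a)) (proots (f - v\<^sup>2))"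
  have nz: "- v \<noteq> 0 \<or> (1 :: complex poly) \<noteq> 0" by simp
  have N: "Nm (- v) 1 = - (f - v\<^sup>2)" by simp
  have N0: "f - v\<^sup>2 \<noteq> 0" using c1.norm_nz[OF nz] N by simp
  have MC: "set_mset ?Z \<subseteq> C"
    using N0 by (auto simp: Affine_iff)
  have "HO (pxy (- v) 1) Q (Poly_Mapping.lookup (dv ?Z) Q)" if Q: "Q \<in> C" for Q
  proof (cases "Q = Infinity")
    case True
    have "degree (Nm (- v) 1) = size ?Z" unfolding N degree_minus by (simp only: size_image_mset size_proots_complex)
    moreover have "Poly_Mapping.lookup (dv ?Z) Q = - int (size ?Z)"
      using True by (simp add: lookup_dv count_image_graph)
    ultimately show ?thesis using HO_pxy_Infinity[OF nz] unfolding True by metis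
  next
    case False
    then have Qa: "Q \<in> affine_curve f" using Q by simp
    obtain a b where ab: "Q = Affine a b" using Qa by (auto simp: affine_curve_def)
    have "HO (pxy (- v) 1) Q (if pxy (- v) 1 Q = 0 then int (order (coord_x Q) (Nm (- v) 1)) else 0)"
      by (rule HO_pxy_primitive[OF Qa]) simp
    also have "(if pxy (- v) 1 Q = 0 then int (order (coord_x Q) (Nm (- v) 1)) else 0)
        = Poly_Mapping.lookup (dv ?Z) Q"
      unfolding N order_uminus using N0 by (simp add: ab lookup_dv count_image_graph)
    finally show ?thesis .
  qed
  then show ?thesis unfolding principal_iff using dv_keys[OF MC] by blast
qed

text \<open>Inclusion of multisets counts multiplicities, so a branch point, being its own
  conjugate, may occur only once.\<close>

definition reduced :: "point multiset \<Rightarrow> bool" where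
  "reduced Z \<longleftrightarrow> set_mset Z \<subseteq> affine_curve f \<and> (\<forall>P. \<not> {#P, invol P#} \<subseteq># Z)"

lemma reduced_add_mset:
  assumes "reduced (add_mset P Z)"
  shows "reduced Z" "P \<in> affine_curve f" "invol P \<notin># Z"
proof -
  have "Z \<subseteq># add_mset P Z" by simp
  then show "reduced Z" using assms unfolding reduced_def
    by (meson set_mset_mono subset_mset.order_trans subset_trans)
  show "P \<in> affine_curve f" using assms by (simp add: reduced_def)
  show "invol P \<notin># Z"
  proof
    assume "invol P \<in># Z"
    then obtain N where "Z = add_mset (invol P) N" by (metis insert_DiffM)
    then have "{#P, invol P#} \<subseteq># add_mset P Z" by simp
    then show False using assms unfolding reduced_def by blast
  qed
qed

text \<open>For distinct points v is the interpolation polynomial; at repeated points the tangency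
  is encoded in \<open>f = v\<^sup>2 + u * w\<close>. For an empty list the truncated bound says
  that v is constant.\<close>

definition mrep :: "point list \<Rightarrow> triplet \<Rightarrow> bool" where
  "mrep Ps = (\<lambda>(u, v, w). u = (\<Prod>P\<leftarrow>Ps. [:- coord_x P, 1:]) \<and> (\<forall>P\<in>set Ps. poly v (coord_x P) = coord_y P) \<and>
     f = v\<^sup>2 + u * w \<and> degree v \<le> length Ps - 1)"

lemma degree_linear_prod: "degree (\<Prod>P\<leftarrow>Ps. [:- c P, 1 :: complex:]) = length Ps"
  and linear_prod_nz: "(\<Prod>P\<leftarrow>Ps. [:- c P, 1 :: complex:]) \<noteq> 0"
proof (induction Ps)
  case (Cons P Ps)
  show nz: "(\<Prod>P\<leftarrow>P # Ps. [:- c P, 1:]) \<noteq> 0" using Cons by (simp del: mult_pCons_left)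
  show "degree (\<Prod>P\<leftarrow>P # Ps. [:- c P, 1:]) = length (P # Ps)"
    using Cons by (simp add: degree_mult_eq del: mult_pCons_left)
qed simp_all

lemma poly_linear_prod: "poly (\<Prod>P\<leftarrow>Ps. [:- c P, 1 :: complex:]) a = 0 \<longleftrightarrow> (\<exists>P\<in>set Ps. c P = a)"
  by (induction Ps) auto

text \<open>The equation of the curve at P reads (b - v(a)) (b + v(a)) = u(a) w(a). It makes both
  product identities true whichever quotient defines c.\<close>

lemma mstep_coeff:
  assumes uvw: "mrep Ps (u, v, w)" and Ps: "set Ps \<subseteq> affine_curve f"
    and P: "P \<in> affine_curve f" "invol P \<notin> set Ps"
  defines "a \<equiv> coord_x P" and "b \<equiv> coord_y P"
  defines "c \<equiv> if poly u a \<noteq> 0 then (b - poly v a) / poly u a else poly w a / (b + poly v a)"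
  shows "poly u a = 0 \<Longrightarrow> b + poly v a \<noteq> 0" "c * poly u a = b - poly v a" "c * (b + poly v a) = poly w a"
proof -
  have u: "u = (\<Prod>P\<leftarrow>Ps. [:- coord_x P, 1:])" and v: "\<And>P. P \<in> set Ps \<Longrightarrow> poly v (coord_x P) = coord_y P"
    and f: "f = v\<^sup>2 + u * w"
    using uvw by (auto simp: mrep_def)
  \<comment> \<open>A root of u is the abscissa of some Q in the list. As \<open>invol P\<close> is
    excluded, Q = P and v(a) = b; and b = 0 would make P its own conjugate, which is excluded as
    well.\<close>
  have z: "b + poly v a \<noteq> 0 \<and> poly v a = b" if ua: "poly u a = 0"
  proof -
    obtain Q where Q: "Q \<in> set Ps" "coord_x Q = a" using ua unfolding u poly_linear_prod by auto
    then have Qa: "Q \<in> affine_curve f" "Q \<noteq> invol P" using Ps P by auto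
    then have "Q = P" using same_x[OF Qa(1) P(1)] Q by (auto simp: a_def)
    then have vb: "poly v a = b" using v[OF Q(1)] Q(2) b_def by simp
    moreover have "b \<noteq> 0"
    proof
      assume "b = 0"
      then have "invol P = P" using P affine_coords[of P] unfolding b_def by (metis invol.simps(1) minus_zero)
      then show False using Qa \<open>Q = P\<close> by simp
    qed
    ultimately show ?thesis by simp
  qed
  then show "poly u a = 0 \<Longrightarrow> b + poly v a \<noteq> 0" by blast
  show cu: "c * poly u a = b - poly v a" using z by (auto simp: c_def)
  have "b\<^sup>2 = (poly v a)\<^sup>2 + poly u a * poly w a"
    using eqn_affine[OF P(1)] arg_cong[OF f, of "\<lambda>p. poly p a"] by (simp add: a_def b_def)
  then have "(b - poly v a) * (b + poly v a) = poly u a * poly w a" by algebra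
  then have "poly u a * (c * (b + poly v a)) = poly u a * poly w a"
    using cu by (metis mult.assoc mult.commute)
  moreover have "c * (b + poly v a) = poly w a" if "poly u a = 0"
  proof -
    have "b + poly v a \<noteq> 0" using z[OF that] by blast
    then show ?thesis by (simp add: c_def that)
  qed
  ultimately show "c * (b + poly v a) = poly w a" by (cases "poly u a = 0") auto
qed

lemma mrep_step:
  assumes uvw: "mrep Ps m" and Ps: "set Ps \<subseteq> affine_curve f"
    and P: "P \<in> affine_curve f" "invol P \<notin> set Ps"
  shows "mrep (P # Ps) (mstep P m)"
proof -
  obtain u v w where m: "m = (u, v, w)" by (cases m) auto
  let ?a = "coord_x P" and ?b = "coord_y P"
  define c where "c = (if poly u ?a \<noteq> 0 then (?b - poly v ?a) / poly u ?a else poly w ?a / (?b + poly v ?a))"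
  define q where "q = w - smult (2 * c) v - smult (c\<^sup>2) u"
  have r: "mrep Ps (u, v, w)" using uvw m by simp
  then have u: "u = (\<Prod>P\<leftarrow>Ps. [:- coord_x P, 1:])" and v: "\<And>P. P \<in> set Ps \<Longrightarrow> poly v (coord_x P) = coord_y P"
    and f: "f = v\<^sup>2 + u * w" and dv: "degree v \<le> length Ps - 1"
    by (auto simp: mrep_def)
  note mc = mstep_coeff[OF r Ps P, folded c_def]
  \<comment> \<open>With w(a) = c (b + v(a)) and c u(a) = b - v(a) everything cancels, so the
    division by x - a is exact.\<close>
  have "poly q ?a = poly w ?a - 2 * c * poly v ?a - c * (c * poly u ?a)"
    by (simp add: q_def power2_eq_square mult.assoc)
  also have "\<dots> = 0" unfolding mc(2) mc(3)[symmetric] by algebra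
  finally have q: "[:- ?a, 1:] * synthetic_div q ?a = q"
    using synthetic_div_correct'[of ?a q] by simp
  have ms: "mstep P m = ([:- ?a, 1:] * u, v + smult c u, synthetic_div q ?a)"
    by (simp add: mstep_def m c_def q_def Let_def del: mult_pCons_left)
  have "f = (v + smult c u)\<^sup>2 + [:- ?a, 1:] * u * synthetic_div q ?a"
  proof -
    define K where "K = [:c:]"
    have "smult (2 * c) v = smult c v + smult c v" by (metis mult_2 smult_add_left)
    then have K: "smult c u = K * u" "smult (2 * c) v = K * v + K * v" "smult (c\<^sup>2) u = K * (K * u)"
      by (simp_all add: K_def power2_eq_square)
    have "[:- ?a, 1:] * u * synthetic_div q ?a = u * q" using q by (metis mult.assoc mult.commute)
    with f show ?thesis unfolding q_def K by algebra
  qed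
  note F1 = this
  have F2: "poly (v + smult c u) (coord_x Q) = coord_y Q" if "Q \<in> set (P # Ps)" for Q
  proof (cases "Q = P")
    case True
    then show ?thesis using mc(2) by simp
  next
    case False
    then have Q: "Q \<in> set Ps" using that by simp
    then have "poly u (coord_x Q) = 0" unfolding u poly_linear_prod by auto
    then show ?thesis using v[OF Q] by simp
  qed
  have F3: "degree (v + smult c u) \<le> length Ps"
  proof (rule degree_add_le)
    show "degree v \<le> length Ps" using dv by simp
    show "degree (smult c u) \<le> length Ps"
      using degree_smult_le[of c u] degree_linear_prod[of coord_x Ps] u by simp
  qed
  have "[:- ?a, 1:] * u = (\<Prod>P\<leftarrow>P # Ps. [:- coord_x P, 1:])" unfolding u by simp
  with F1 F2 F3 show ?thesis unfolding ms mrep_def prod.case by (intro conjI ballI) simp_all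
qed

lemma mrep_mum: "reduced (mset Ps) \<Longrightarrow> mrep Ps (mum f Ps)"
proof (induction Ps)
  case Nil
  show ?case by (simp add: mrep_def)
next
  case (Cons P Ps)
  then have r: "reduced (add_mset P (mset Ps))" by simp
  note rd = reduced_add_mset[OF r]
  have "set Ps \<subseteq> affine_curve f" using rd(1) by (simp add: reduced_def)
  then show ?case using mrep_step[OF Cons.IH[OF rd(1)]] rd by simp
qed

lemma proots_linear_prod: "proots (\<Prod>P\<leftarrow>Ps. [:- c P, 1 :: complex:]) = image_mset c (mset Ps)"
proof (induction Ps)
  case (Cons P Ps)
  have "(\<Prod>P\<leftarrow>P # Ps. [:- c P, 1:]) = [:- c P, 1:] * (\<Prod>P\<leftarrow>Ps. [:- c P, 1:])" by simp
  moreover have "[:- c P, 1:] * (\<Prod>P\<leftarrow>Ps. [:- c P, 1:]) \<noteq> 0" using linear_prod_nz[of c "P # Ps"] by simp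
  ultimately show ?case using Cons by (simp add: proots_mult del: mult_pCons_left)
qed simp

text \<open>As v^2 has degree at most 2g, the product u w keeps the degree 2g + 1 of f; the g + 1
  points in u leave degree g for w.\<close>

lemma mrep_degree:
  assumes "mrep Ps (u, v, w)" "length Ps = g + 1"
  shows "degree w = g" "degree v \<le> g"
proof -
  have u: "u = (\<Prod>P\<leftarrow>Ps. [:- coord_x P, 1:])" and f: "f = v\<^sup>2 + u * w" and v: "degree v \<le> g"
    using assms by (auto simp: mrep_def)
  show "degree v \<le> g" by (rule v)
  have "degree (v\<^sup>2) \<le> 2 * g" using v by (metis degree_power_le le_trans mult.commute mult_le_mono1 power2_eq_square)
  then have "degree (f + - v\<^sup>2) = degree f" by (intro degree_add_eq_left) (simp add: deg_f)
  moreover have uw: "f + - v\<^sup>2 = u * w" by (subst f) simp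
  ultimately have d: "degree (u * w) = 2 * g + 1" using deg_f by simp
  then have "w \<noteq> 0" "u \<noteq> 0" by auto
  then have "degree u + degree w = 2 * g + 1" using d by (simp add: degree_mult_eq)
  then show "degree w = g" using degree_linear_prod[of coord_x Ps] u assms(2) by simp
qed

text \<open>The zeros of y - v(x) split according to f - v^2 = u w, and those over the roots of u
  are the given points.\<close>

lemma dv_mrep:
  assumes m: "mrep Ps (u, v, w)" and Ps: "set Ps \<subseteq> affine_curve f"
  shows "dv (mset Ps) + dv (image_mset (\<lambda>a. Affine a (poly v a)) (proots w)) \<in> PD"
    "set_mset (image_mset (\<lambda>a. Affine a (poly v a)) (proots w)) \<subseteq> C"
proof -
  have u: "u = (\<Prod>P\<leftarrow>Ps. [:- coord_x P, 1:])" and v: "\<And>P. P \<in> set Ps \<Longrightarrow> poly v (coord_x P) = coord_y P"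
    and f: "f = v\<^sup>2 + u * w"
    using m by (auto simp: mrep_def)
  have uw: "f - v\<^sup>2 = u * w" by (subst f) simp
  have "v\<^sup>2 - f \<noteq> 0" using c1.norm_nz[of v 1] by simp
  then have "u * w \<noteq> 0" unfolding uw[symmetric] by (metis minus_diff_eq neg_equal_0_iff_equal)
  then have nz: "u \<noteq> 0" "w \<noteq> 0" by auto
  have "image_mset (\<lambda>a. Affine a (poly v a)) (proots u) = image_mset (\<lambda>P. P) (mset Ps)"
    unfolding u proots_linear_prod image_mset.compositionality
    by (rule image_mset_cong) (use v Ps affine_coords in fastforce)
  then have "image_mset (\<lambda>a. Affine a (poly v a)) (proots (f - v\<^sup>2))
      = mset Ps + image_mset (\<lambda>a. Affine a (poly v a)) (proots w)"
    unfolding uw proots_mult[OF nz] by simp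
  then show "dv (mset Ps) + dv (image_mset (\<lambda>a. Affine a (poly v a)) (proots w)) \<in> PD"
    using dv_graph[of v] by (simp add: dv_union)
  have "(poly v a)\<^sup>2 = poly f a" if "a \<in># proots w" for a
    using that nz by (subst f) auto
  then show "set_mset (image_mset (\<lambda>a. Affine a (poly v a)) (proots w)) \<subseteq> C"
    by (auto simp: Affine_iff)
qed

section \<open>Every class of degree zero comes from g points\<close>

lemma reduce_step:
  assumes Z: "size Z = g + 1" "set_mset Z \<subseteq> C"
  shows "\<exists>Z'. size Z' = g \<and> set_mset Z' \<subseteq> C \<and> dv Z - dv Z' \<in> PD"
proof -
  consider "Infinity \<in># Z" | P where "{#P, invol P#} \<subseteq># Z" | "reduced Z"
    using Z(2) unfolding reduced_def by blast
  then show ?thesis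
  proof cases
    case 1
    then obtain N where "Z = add_mset Infinity N" by (metis insert_DiffM)
    then show ?thesis using Z dv_add_mset[of Infinity N] principal_0 by (intro exI[of _ N]) auto
  next
    case 2
    then obtain N where N: "Z = {#P, invol P#} + N" by (metis subset_mset.le_iff_add)
    then have P: "P \<in> C" using Z(2) by auto
    show ?thesis
    \<comment> \<open>The pair is equivalent to two copies of Infinity; one of them brings the size
      to g.\<close>
    proof (intro exI[of _ "add_mset Infinity N"] conjI)
      show "size (add_mset Infinity N) = g" "set_mset (add_mset Infinity N) \<subseteq> C" using Z N by auto
      have "dv Z - dv (add_mset Infinity N) = dv {#P, invol P#}"
        unfolding N dv_union dv_add_mset[of Infinity N] by simp
      then show "dv Z - dv (add_mset Infinity N) \<in> PD" using dv_conj[OF P] by simp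
    qed
  next
    case 3
    obtain Ps where Ps: "mset Ps = Z" using ex_mset by blast
    obtain u v w where uvw: "mum f Ps = (u, v, w)" by (cases "mum f Ps") auto
    have m: "mrep Ps (u, v, w)" using mrep_mum[of Ps] 3 Ps uvw by simp
    have len: "length Ps = g + 1" using Ps Z by (metis size_mset)
    have PsA: "set Ps \<subseteq> affine_curve f" using 3 Ps by (auto simp: reduced_def)
    let ?N = "image_mset (\<lambda>a. Affine a (poly v a)) (proots w)"
    have sN: "size ?N = g" using mrep_degree(1)[OF m len] by (simp add: size_proots_complex)
    show ?thesis
    \<comment> \<open>The class of the given points is minus that of \<open>?N\<close>, and the
      involution makes this effective.\<close>
    proof (intro exI[of _ "image_mset invol ?N"] conjI)
      show "size (image_mset invol ?N) = g" using sN by simp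
      show "set_mset (image_mset invol ?N) \<subseteq> C" by (rule invol_image_C[OF dv_mrep(2)[OF m PsA]])
      have "(dv Z + dv ?N) - (dv ?N + dv (image_mset invol ?N)) \<in> PD"
        using dv_mrep[OF m PsA] Ps by (intro principal_diff dv_invol) auto
      then show "dv Z - dv (image_mset invol ?N) \<in> PD" by (simp add: algebra_simps)
    qed
  qed
qed

lemma reduce:
  assumes "size Z = g + n" "set_mset Z \<subseteq> C"
  shows "\<exists>Z'. size Z' = g \<and> set_mset Z' \<subseteq> C \<and> dv Z - dv Z' \<in> PD"
  using assms
proof (induction n arbitrary: Z)
  case 0
  then show ?case using principal_0 by (intro exI[of _ Z]) auto
next
  case (Suc n)
  then obtain P N where Z: "Z = add_mset P N" by (metis add_Suc_right size_eq_Suc_imp_eq_union)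
  then obtain N' where N': "size N' = g" "set_mset N' \<subseteq> C" "dv N - dv N' \<in> PD" using Suc by auto
  obtain Z' where Z': "size Z' = g" "set_mset Z' \<subseteq> C" "dv (add_mset P N') - dv Z' \<in> PD"
    using reduce_step[of "add_mset P N'"] N' Z Suc.prems by auto
  have "(dv (add_mset P N') - dv Z') + (dv N - dv N') \<in> PD" by (rule principal_add) fact+
  then have "dv Z - dv Z' \<in> PD" unfolding Z dv_add_mset[of P N] dv_add_mset[of P N'] by (simp add: algebra_simps)
  with Z' show ?case by blast
qed

lemma degree_zero_effective:
  assumes D: "D \<in> carrier D0"
  shows "\<exists>Z. size Z = g \<and> set_mset Z \<subseteq> C \<and> D - dv Z \<in> PD"
proof -
  \<comment> \<open>\<open>frag_induction\<close> passes through divisors of nonzero degree, so the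
    claim is extended to all degrees with a correction at Infinity.\<close>
  let ?Q = "\<lambda>D. \<exists>Z. size Z = g \<and> set_mset Z \<subseteq> C \<and>
    D - frag_cmul (divisor_degree D) (frag_of Infinity) - dv Z \<in> PD"
  have "Poly_Mapping.keys D \<subseteq> C" using D carrier_D0 by blast
  then have "?Q D"
  proof (induction rule: frag_induction)
    case zero
    show ?case using principal_0 by (intro exI[of _ "replicate_mset g Infinity"]) auto
  next
    case (one P)
    show ?case
    proof (intro exI[of _ "add_mset P (replicate_mset (g - 1) Infinity)"] conjI)
      show "size (add_mset P (replicate_mset (g - 1) Infinity)) = g" using g_pos by simp
      show "set_mset (add_mset P (replicate_mset (g - 1) Infinity)) \<subseteq> C" using one by auto
      have "dv (add_mset P (replicate_mset (g - 1) Infinity)) = frag_of P - frag_of Infinity"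
        unfolding dv_add_mset[of P "replicate_mset (g - 1) Infinity"] dv_replicate_Infinity
        by (simp add: dv_def)
      then show "frag_of P - frag_cmul (divisor_degree (frag_of P)) (frag_of Infinity)
          - dv (add_mset P (replicate_mset (g - 1) Infinity)) \<in> PD" by (simp add: principal_0)
    qed
  next
    case (diff D E)
    let ?n = "\<lambda>D. D - frag_cmul (divisor_degree D) (frag_of Infinity)"
    obtain Z N where Z: "size Z = g" "set_mset Z \<subseteq> C" "?n D - dv Z \<in> PD"
      and N: "size N = g" "set_mset N \<subseteq> C" "?n E - dv N \<in> PD" using diff by blast
    \<comment> \<open>Subtraction becomes addition of conjugates, and the resulting 2g points are
      reduced to g.\<close>
    have "set_mset (Z + image_mset invol N) \<subseteq> C" using Z invol_image_C[of N] N by simp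
    then obtain Z' where Z': "size Z' = g" "set_mset Z' \<subseteq> C" "dv (Z + image_mset invol N) - dv Z' \<in> PD"
      using reduce[of "Z + image_mset invol N" g] Z N by auto
    have "(?n D - dv Z) - (?n E - dv N) - (dv N + dv (image_mset invol N))
        + (dv (Z + image_mset invol N) - dv Z') \<in> PD"
      by (intro principal_add principal_diff dv_invol Z N Z')
    moreover have "(?n D - dv Z) - (?n E - dv N) - (dv N + dv (image_mset invol N))
        + (dv (Z + image_mset invol N) - dv Z') = ?n (D - E) - dv Z'"
      by (simp add: dv_union divisor_degree_diff frag_cmul_diff_distrib)
    ultimately show ?case using Z' by metis
  qed
  moreover have "divisor_degree D = 0" using D carrier_D0 by blast
  ultimately show ?thesis by simp
qed

section \<open>Uniqueness of the reduced representative\<close>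

lemma HO_ge_ram_imp_common_root:
  assumes P: "P \<in> affine_curve f" and h: "HO (pxy A B) P n" and n: "n \<ge> ram P"
    and P': "invol P \<in> affine_curve f" and h': "HO (pxy A B) (invol P) n'" and n': "n' \<ge> ram P"
  shows "poly A (coord_x P) = 0 \<and> poly B (coord_x P) = 0"
proof (rule ccontr)
  assume prim: "\<not> ?thesis"
  have PC: "P \<in> C" "invol P \<in> C" using P by auto
  have r: "ram P \<ge> 1" by (simp add: ram_def)
  have z: "pxy A B P = 0" "pxy A B (invol P) = 0"
    using HO_reg(2)[OF PC(1) h reg_pxy[OF P]] HO_reg(2)[OF PC(2) h' reg_pxy[OF P']] n n' r by auto
  have zz: "poly A (coord_x P) + poly B (coord_x P) * coord_y P = 0"
    "poly A (coord_x P) - poly B (coord_x P) * coord_y P = 0" using z by auto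
  then have "2 * poly A (coord_x P) = 0" by algebra
  then have A: "poly A (coord_x P) = 0" by simp
  with zz prim have y: "coord_y P = 0" and B: "poly B (coord_x P) \<noteq> 0" by auto
  \<comment> \<open>What remains is a branch point over which B is nonzero; there A + B y has order
    exactly 1, against the assumed 2.\<close>
  have r2: "ram P = 2" using y by (simp add: ram_def)
  have By: "HO (\<lambda>z. px B z * coord_y z) P 1"
    using HO_mult[OF PC(1) HO_reg_nonzero[OF PC(1) reg_px[OF P] B] HO_y[OF P]] r2 by simp
  have "HO (pxy A B) P 1"
  proof (cases "A = 0")
    case False
    have "HO (px A) P (int (order (coord_x P) A) * 2)" using HO_px[OF P False] r2 by simp
    moreover have "order (coord_x P) A \<ge> 1" using A False order_root[of A "coord_x P"] by simp
    ultimately have "HO (\<lambda>z. px B z * coord_y z + px A z) P 1"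
      using HO_add[OF PC(1) By] by fastforce
    then show ?thesis by (simp add: add.commute)
  qed (use By in simp)
  then show False using HO_unique[OF PC(1) h] n r2 by simp
qed

text \<open>An explicit form of the integral closedness of C[x, y]: over a root a of the
  denominator, the absence of poles forces A + B y to vanish to order at least \<open>ram\<close> at
  every point, so x - a divides A and B and cancels.\<close>

lemma no_poles_imp_polynomial:
  assumes "D \<noteq> 0" "A \<noteq> 0 \<or> B \<noteq> 0" "\<forall>\<^sub>F z in ae. h z = pxy A B z / px D z"
    and "\<And>P. P \<in> affine_curve f \<Longrightarrow> HO h P (n P) \<and> n P \<ge> 0"
  shows "\<exists>A B. (A \<noteq> 0 \<or> B \<noteq> 0) \<and> (\<forall>\<^sub>F z in ae. h z = pxy A B z)"
  using assms(1-3)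
proof (induction "degree D" arbitrary: A B D)
  case 0
  then obtain d where d: "D = [:d:]" "d \<noteq> 0" by (metis degree_eq_zeroE pCons_0_0)
  show ?case
  proof (intro exI conjI)
    show "smult (inverse d) A \<noteq> 0 \<or> smult (inverse d) B \<noteq> 0" using 0 d by simp
    show "\<forall>\<^sub>F z in ae. h z = pxy (smult (inverse d) A) (smult (inverse d) B) z"
      using 0(4) by eventually_elim (simp add: d field_simps)
  qed
next
  case (Suc m)
  have "\<exists>a. poly D a = 0"
    by (rule fundamental_theorem_of_algebra_alt) (use Suc.hyps(2) in \<open>auto elim: degree_eq_zeroE\<close>)
  then obtain a where a: "poly D a = 0" by blast
  have H: "HO (pxy A B) P (n P + int (order a D) * ram P)" if "P \<in> over a" for P
  proof -
    have P: "P \<in> affine_curve f" "coord_x P = a" "P \<in> C" using that by (auto simp: over_def)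
    have "HO (\<lambda>z. h z * px D z) P (n P + int (order (coord_x P) D) * ram P)"
      using HO_mult[OF P(3) _ HO_px[OF P(1) Suc.prems(1)]] assms(4)[OF P(1)] by blast
    moreover have "\<forall>\<^sub>F z in ae. pxy A B z = h z * px D z"
      using Suc.prems(3) HO_nonzero_ae[OF P(3) HO_px[OF P(1) Suc.prems(1)]] by eventually_elim simp
    ultimately show ?thesis using HO_cong P(2) by metis
  qed
  have o: "order a D \<ge> 1" using a Suc.prems(1) order_root[of D a] by simp
  obtain P where P: "P \<in> over a"
    using c1.onto[of "csqrt (poly f a)" a] by (auto simp: over_def)
  then have Pa: "P \<in> affine_curve f" "coord_x P = a" "invol P \<in> affine_curve f" "invol P \<in> over a" "P \<in> C"
    by (auto simp: over_def)
  have rp: "ram (invol P) = ram P" "ram P \<ge> 1" by (simp_all add: ram_def)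
  have ge: "n P' + int (order a D) * ram P \<ge> ram P" if "P' \<in> affine_curve f" for P'
  proof -
    have "1 * ram P \<le> int (order a D) * ram P" by (rule mult_right_mono) (use o rp in auto)
    then show ?thesis using assms(4)[OF that] by linarith
  qed
  have "poly A a = 0 \<and> poly B a = 0"
    using HO_ge_ram_imp_common_root[OF Pa(1) H[OF P] ge[OF Pa(1)] Pa(3) H[OF Pa(4)]] ge[OF Pa(3)] rp Pa(2) by simp
  then obtain A' B' where AB: "A = [:- a, 1:] * A'" "B = [:- a, 1:] * B'"
    by (auto simp: poly_eq_0_iff_dvd elim!: dvdE)
  obtain D' where D': "D = [:- a, 1:] * D'" using a by (auto simp: poly_eq_0_iff_dvd elim!: dvdE)
  have nz: "D' \<noteq> 0" "A' \<noteq> 0 \<or> B' \<noteq> 0" using Suc.prems AB D' by auto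
  have "degree D = 1 + degree D'" unfolding D' using nz by (subst degree_mult_eq) auto
  then have "m = degree D'" using Suc.hyps(2) by simp
  moreover have "\<forall>\<^sub>F z in ae. h z = pxy A' B' z / px D' z"
    using Suc.prems(3) HO_nonzero_ae[OF Pa(5) HO_x_minus[OF Pa(1)]]
  proof eventually_elim
    case (elim z)
    then have nz: "coord_x z \<noteq> a" using Pa(2) by simp
    have "pxy A B z = (coord_x z - a) * pxy A' B' z" "px D z = (coord_x z - a) * px D' z"
      unfolding AB D' by (simp_all add: algebra_simps)
    then show ?case using nz elim(1) by simp
  qed
  ultimately show ?case using Suc.hyps(1)[of D' A' B'] nz by blast
qed

lemma reduced_count:
  assumes "reduced Z" "P \<in># Z"
  shows "if coord_y P = 0 then count Z P = 1 else count Z (invol P) = 0"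
proof -
  obtain N where N: "Z = add_mset P N" using assms(2) by (metis insert_DiffM)
  have nP: "invol P \<notin># N" and P: "P \<in> affine_curve f" using reduced_add_mset[of P N] assms N by auto
  have "invol P = P \<longleftrightarrow> coord_y P = 0" using P by (auto simp: affine_curve_def)
  then show ?thesis using nP N by (auto simp: not_in_iff)
qed

lemma reduced_unique:
  assumes Z: "reduced Z" "size Z = g" and Z': "size Z' = g" "set_mset Z' \<subseteq> C" and eq: "dv Z - dv Z' \<in> PD"
  shows "Z = Z'"
proof -
  have MA: "set_mset Z \<subseteq> affine_curve f" using Z by (simp add: reduced_def)
  \<comment> \<open>Replacing -Z' by the conjugate of Z' gives a function with poles at Infinity
    only.\<close>
  have "(dv Z - dv Z') + (dv Z' + dv (image_mset invol Z')) \<in> PD"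
    by (intro principal_add eq dv_invol Z')
  then have "dv Z + dv (image_mset invol Z') \<in> PD" by simp
  then obtain h where h: "\<And>P. P \<in> C \<Longrightarrow> HO h P (Poly_Mapping.lookup (dv Z + dv (image_mset invol Z')) P)"
    unfolding principal_iff by blast
  have ha: "HO h P (int (count Z P + count Z' (invol P)))" if "P \<in> affine_curve f" for P
  proof -
    have "P \<noteq> Infinity" using that by auto
    then show ?thesis using h[of P] that by (simp add: lookup_add lookup_dv count_invol)
  qed
  have hi: "HO h Infinity (int (count Z Infinity + count Z' Infinity) - 2 * int g)"
    using h[of Infinity] Z Z' by (simp add: lookup_add lookup_dv count_invol algebra_simps)
  have P1: "Affine 0 1 \<in> affine_curve f" "coord_y (Affine 0 1) \<noteq> 0" by (simp_all add: Affine_0_1)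
  obtain A0 B0 E where "E \<noteq> 0" "A0 \<noteq> 0 \<or> B0 \<noteq> 0" "\<forall>\<^sub>F z in ae. h z = pxy A0 B0 z / px E z"
    by (rule rational_form[OF P1 ha[OF P1(1)]])
  then obtain A B where AB: "A \<noteq> 0 \<or> B \<noteq> 0" "\<forall>\<^sub>F z in ae. h z = pxy A B z"
    using no_poles_imp_polynomial[of E A0 B0 h "\<lambda>P. int (count Z P + count Z' (invol P))"] ha by auto
  have "HO h Infinity (- int (degree (Nm A B)))"
    using HO_cong[OF HO_pxy_Infinity[OF AB(1)] AB(2)] .
  then have "int (count Z Infinity + count Z' Infinity) - 2 * int g = - int (degree (Nm A B))"
    using HO_unique[OF _ hi] by simp
  then have "degree (Nm A B) \<le> 2 * g" by linarith
  \<comment> \<open>A nonzero B would give the norm degree at least 2g + 1.\<close>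
  then have B: "B = 0" using degree_Nm(2)[of B A] degree_Nm(3)[of A B] by (cases "A = 0"; cases "B = 0") auto
  then have A: "A \<noteq> 0" using AB by simp
  have key: "int (count Z P + count Z' (invol P)) = int (order (coord_x P) A) * ram P"
    if P: "P \<in> affine_curve f" for P
  proof -
    have "HO h P (int (order (coord_x P) A) * ram P)"
      using HO_cong[OF HO_px[OF P A], of h] AB(2) B by simp
    then show ?thesis using HO_unique[OF _ ha[OF P]] P by simp
  qed
  have "count Z P \<le> count Z' P" for P
  proof (cases "P \<in># Z")
    case True
    then have P: "P \<in> affine_curve f" "invol P \<in> affine_curve f" using MA by auto
    show ?thesis
    proof (cases "coord_y P = 0")
      case y: True
      then have "invol P = P" using P by (auto simp: affine_curve_def)
      moreover have "count Z P = 1" using reduced_count[OF Z(1) True] y by simp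
      \<comment> \<open>A function of x has even order at a branch point, so the count in Z' is odd,
        hence positive.\<close>
      ultimately have "1 + int (count Z' P) = int (order (coord_x P) A) * 2"
        using key[OF P(1)] y by (simp add: ram_def)
      then have "count Z' P \<ge> 1" by presburger
      then show ?thesis using \<open>count Z P = 1\<close> by simp
    next
      case y: False
      then have "count Z (invol P) = 0" using reduced_count[OF Z(1) True] by simp
      then show ?thesis using key[OF P(1)] key[OF P(2)] by (simp add: ram_def y)
    qed
  qed (simp add: not_in_iff)
  then have "Z \<subseteq># Z'" by (simp add: subseteq_mset_def)
  then show ?thesis using Z Z' by (metis nat_less_le mset_subset_size subset_mset.less_le)
qed

section \<open>The theta divisor and its translates\<close>

lemma dv_map_upt: "dv (mset (map P [0..<n])) = (\<Sum>i<n. frag_of (P i)) - frag_cmul (int n) (frag_of Infinity)"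
  by (simp add: dv_def eff_def sum_unfold_sum_mset atLeast0LessThan multiset.map_comp o_def)

lemma ex_map_upt: "\<exists>P. Z = mset (map P [0..<size Z])"
proof -
  obtain xs where "mset xs = Z" using ex_mset by blast
  then show ?thesis by (intro exI[of _ "\<lambda>i. xs ! i"]) (metis map_nth size_mset)
qed

lemma abel_jacobi_dv: "abel_jacobi g f P = cls (dv (mset (map P [0..<g])))"
  unfolding abel_jacobi_def dv_map_upt ..

lemma theta_dv: "theta_divisor g f = {cls (dv Z) | Z. size Z = g - 1 \<and> set_mset Z \<subseteq> C}"
proof (intro equalityI subsetI)
  fix c assume "c \<in> theta_divisor g f"
  then obtain P where "c = cls (dv (mset (map P [0..<g-1])))" "\<forall>i<g-1. P i \<in> C"
    unfolding theta_divisor_def dv_map_upt zariski_X topspace_T by blast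
  moreover from this have "set_mset (mset (map P [0..<g-1])) \<subseteq> C" by auto
  moreover have "size (mset (map P [0..<g-1])) = g - 1" by simp
  ultimately show "c \<in> {cls (dv Z) | Z. size Z = g - 1 \<and> set_mset Z \<subseteq> C}" by blast
next
  fix c assume "c \<in> {cls (dv Z) | Z. size Z = g - 1 \<and> set_mset Z \<subseteq> C}"
  then obtain Z where Z: "c = cls (dv Z)" "size Z = g - 1" "set_mset Z \<subseteq> C" by blast
  obtain P where P: "Z = mset (map P [0..<g-1])" using ex_map_upt[of Z] Z by auto
  then have "c = cls ((\<Sum>i<g-1. frag_of (P i)) - frag_cmul (int (g-1)) (frag_of Infinity))"
    unfolding Z(1) P dv_map_upt by simp
  moreover have "\<forall>i<g-1. P i \<in> topspace (zariski X)"
    using Z(3) P by (auto simp: topspace_T image_subset_iff)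
  ultimately show "c \<in> theta_divisor g f" unfolding theta_divisor_def by blast
qed

lemma translate_dv:
  assumes e: "e = 1 \<or> e = -1"
  shows "theta_translate g f e =
    {cls (dv (add_mset (Affine 0 e) Z)) | Z. size Z = g - 1 \<and> set_mset Z \<subseteq> C}"
proof -
  have "cls (dv Z) \<otimes>\<^bsub>J\<^esub> cls (frag_of (Affine 0 e) - frag_of Infinity) = cls (dv (add_mset (Affine 0 e) Z))"
    if "set_mset Z \<subseteq> C" for Z
  proof -
    have d: "frag_of (Affine 0 e) - frag_of Infinity = dv {#Affine 0 e#}" by (simp add: dv_def)
    have "Affine 0 e \<in> C" using e Affine_0_1 by blast
    then have "dv {#Affine 0 e#} \<in> carrier D0" by (intro dv_carrier) simp
    then show ?thesis unfolding d
      by (subst cls_mult) (use dv_carrier[OF that] in \<open>auto simp: dv_add_mset[of "Affine 0 e" Z] add.commute\<close>)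
  qed
  then show ?thesis unfolding theta_translate_def theta_dv by (auto simp: image_iff)
qed

definition theta_compl :: "(point \<Rightarrow>\<^sub>0 int) set set" where
  "theta_compl = carrier J - (theta_divisor g f \<union> theta_translate g f 1 \<union> theta_translate g f (-1))"

text \<open>Forwards, a point at Infinity or a conjugate pair leaves g - 1 points up to equivalence,
  and a point over 0 is (0,1) or (0,-1). Backwards, a class in one of the three sets has a
  representative containing Infinity or a point over 0; it differs from Z, against
  \<open>reduced_unique\<close>.\<close>

lemma cls_dv_in_compl:
  assumes Z: "size Z = g" "set_mset Z \<subseteq> C"
  shows "cls (dv Z) \<in> theta_compl \<longleftrightarrow> reduced Z \<and> (\<forall>P\<in>#Z. coord_x P \<noteq> 0)"
proof
  assume U: "cls (dv Z) \<in> theta_compl"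
  then have nT: "cls (dv Z) \<noteq> cls (dv N)" if "size N = g - 1" "set_mset N \<subseteq> C" for N
    using that unfolding theta_compl_def theta_dv by blast
  have nTe: "cls (dv Z) \<noteq> cls (dv (add_mset (Affine 0 e) N))"
    if "size N = g - 1" "set_mset N \<subseteq> C" "e = 1 \<or> e = -1" for N e
    using that U unfolding theta_compl_def translate_dv[OF that(3)] by (auto simp: translate_dv)
  have "set_mset Z \<subseteq> affine_curve f"
  proof (rule ccontr)
    assume "\<not> ?thesis"
    then have "Infinity \<in># Z" using Z by auto
    then obtain N where "Z = add_mset Infinity N" by (metis insert_DiffM)
    then show False using nT[of N] Z dv_add_mset[of Infinity N] by auto
  qed
  moreover have "\<not> {#P, invol P#} \<subseteq># Z" for P
  proof
    assume "{#P, invol P#} \<subseteq># Z"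
    then obtain N where N: "Z = {#P, invol P#} + N" by (metis subset_mset.le_iff_add)
    then have P: "P \<in> C" using Z by auto
    \<comment> \<open>Removing the pair leaves g - 2 points, and one copy of Infinity makes them g -
      1.\<close>
    have "dv Z - dv (add_mset Infinity N) = dv {#P, invol P#}"
      unfolding N dv_union dv_add_mset[of Infinity N] by simp
    then have "cls (dv Z) = cls (dv (add_mset Infinity N))" using dv_conj[OF P] cls_eq_iff by simp
    moreover have "size (add_mset Infinity N) = g - 1" "set_mset (add_mset Infinity N) \<subseteq> C" using Z N by auto
    ultimately show False using nT by blast
  qed
  moreover have "coord_x P \<noteq> 0" if "P \<in># Z" for P
  proof
    assume x: "coord_x P = 0"
    have "P \<in> affine_curve f" using calculation(1) that by blast
    then obtain e where e: "P = Affine 0 e" using affine_coords[of P] x by metis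
    then have e1: "e = 1 \<or> e = -1" using \<open>P \<in> affine_curve f\<close> Affine_0_1 by blast
    obtain N where N: "Z = add_mset P N" using \<open>P \<in># Z\<close> by (metis insert_DiffM)
    then show False using nTe[of N e] Z e e1 by auto
  qed
  ultimately show "reduced Z \<and> (\<forall>P\<in>#Z. coord_x P \<noteq> 0)" by (simp add: reduced_def)
next
  assume r: "reduced Z \<and> (\<forall>P\<in>#Z. coord_x P \<noteq> 0)"
  then have MA: "set_mset Z \<subseteq> affine_curve f" by (simp add: reduced_def)
  have ne: "cls (dv Z) \<noteq> cls (dv N)" if "size N = g" "set_mset N \<subseteq> C" "N \<noteq> Z" for N
    using reduced_unique[of Z N] r Z that cls_eq_iff by blast
  have "cls (dv Z) \<in> carrier J" using dv_carrier[OF Z(2)] carrier_J by blast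
  moreover have "cls (dv Z) \<notin> theta_divisor g f"
  proof
    assume "cls (dv Z) \<in> theta_divisor g f"
    then obtain N where N: "cls (dv Z) = cls (dv N)" "size N = g - 1" "set_mset N \<subseteq> C"
      unfolding theta_dv by auto
    have "cls (dv (add_mset Infinity N)) = cls (dv N)" by (simp add: dv_add_mset[of Infinity N])
    moreover have "add_mset Infinity N \<noteq> Z" using MA by auto
    ultimately show False using ne[of "add_mset Infinity N"] N g_pos by simp
  qed
  moreover have "cls (dv Z) \<notin> theta_translate g f e" if e: "e = 1 \<or> e = -1" for e
  proof
    assume "cls (dv Z) \<in> theta_translate g f e"
    then obtain N where N: "cls (dv Z) = cls (dv (add_mset (Affine 0 e) N))" "size N = g - 1" "set_mset N \<subseteq> C"
      unfolding translate_dv[OF e] by auto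
    have "add_mset (Affine 0 e) N \<noteq> Z" using r by auto
    moreover have "Affine 0 e \<in> C" using e Affine_0_1 by blast
    ultimately show False using ne[of "add_mset (Affine 0 e) N"] N g_pos by simp
  qed
  ultimately show "cls (dv Z) \<in> theta_compl" unfolding theta_compl_def by blast
qed

lemma cls_invol:
  assumes "set_mset Z \<subseteq> C"
  shows "inv\<^bsub>J\<^esub> (cls (dv Z)) = cls (dv (image_mset invol Z))"
proof -
  have "- dv Z - dv (image_mset invol Z) \<in> PD"
    using principal_uminus[OF dv_invol[OF assms]] by simp
  then show ?thesis using cls_inv[OF dv_carrier[OF assms]] cls_eq_iff by simp
qed

lemma inv_inv_J: "c \<in> carrier J \<Longrightarrow> inv\<^bsub>J\<^esub> (inv\<^bsub>J\<^esub> c) = c"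
  by (rule group.inv_inv[OF comm_group.axioms(2)[OF comm_group_J]])

text \<open>Inversion acts on effective representatives by \<open>invol\<close>, which preserves
  their number. Being an involution, it is onto as soon as it maps the set into itself.\<close>

lemma inv_theta: "(\<lambda>c. inv\<^bsub>J\<^esub> c) ` theta_divisor g f = theta_divisor g f" (is "?l = ?r")
proof -
  have sub: "inv\<^bsub>J\<^esub> c \<in> theta_divisor g f" if c: "c \<in> theta_divisor g f" for c
  proof -
    obtain Z where "c = cls (dv Z)" "size Z = g - 1" "set_mset Z \<subseteq> C" using c unfolding theta_dv by auto
    then show ?thesis unfolding theta_dv
      by (intro CollectI exI[of _ "image_mset invol Z"]) (use invol_image_C[of Z] cls_invol[of Z] in simp)
  qed
  have "theta_divisor g f \<subseteq> carrier J" using dv_carrier carrier_J by (auto simp: theta_dv)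
  then have "inv\<^bsub>J\<^esub> (inv\<^bsub>J\<^esub> c) = c" if "c \<in> theta_divisor g f" for c
    using that inv_inv_J by blast
  then show ?thesis using sub by (metis (no_types, lifting) image_eqI image_subsetI subsetI subset_antisym)
qed

text \<open>The hyperelliptic involution exchanges (0, e) and (0, -e).\<close>

lemma inv_translate:
  assumes e: "e = 1 \<or> e = -1"
  shows "(\<lambda>c. inv\<^bsub>J\<^esub> c) ` theta_translate g f e = theta_translate g f (- e)"
proof -
  have e': "- e = 1 \<or> - e = - 1" using e by auto
  have sub: "inv\<^bsub>J\<^esub> c \<in> theta_translate g f (- e)" if c: "c \<in> theta_translate g f e" and e: "e = 1 \<or> e = -1" for c e
  proof -
    have e': "- e = 1 \<or> - e = - 1" using e by auto
    obtain Z where Z: "c = cls (dv (add_mset (Affine 0 e) Z))" "size Z = g - 1" "set_mset Z \<subseteq> C"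
      using c unfolding translate_dv[OF e] by auto
    have "Affine 0 e \<in> C" using e Affine_0_1 by blast
    then have "inv\<^bsub>J\<^esub> c = cls (dv (image_mset invol (add_mset (Affine 0 e) Z)))"
      unfolding Z by (intro cls_invol) (use Z in auto)
    then show ?thesis unfolding translate_dv[OF e']
      by (intro CollectI exI[of _ "image_mset invol Z"]) (use Z invol_image_C[of Z] in simp)
  qed
  have "theta_translate g f (- e) \<subseteq> carrier J"
    using dv_carrier carrier_J Affine_0_1 e' by (auto simp: translate_dv[OF e'] intro!: imageI)
  then have inv: "inv\<^bsub>J\<^esub> (inv\<^bsub>J\<^esub> c) = c" if "c \<in> theta_translate g f (- e)" for c
    using that inv_inv_J by blast
  show ?thesis
  proof (intro equalityI subsetI)
    fix c assume c: "c \<in> theta_translate g f (- e)"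
    then have "inv\<^bsub>J\<^esub> c \<in> theta_translate g f e" using sub[OF c e'] by simp
    then show "c \<in> (\<lambda>c. inv\<^bsub>J\<^esub> c) ` theta_translate g f e" using inv[OF c] by (metis imageI)
  qed (use sub[OF _ e] in auto)
qed

end

section \<open>Finitely many open conditions; regularity of evaluation and of division by x -
  a\<close>

lemma openin_finite_all:
  assumes "finite I" "openin T W" "\<And>i. i \<in> I \<Longrightarrow> openin T {x \<in> W. Q i x}"
  shows "openin T {x \<in> W. \<forall>i\<in>I. Q i x}"
  using assms(1,3)
proof (induction I)
  case (insert i I)
  have "{x \<in> W. \<forall>i\<in>insert i I. Q i x} = {x \<in> W. Q i x} \<inter> {x \<in> W. \<forall>i\<in>I. Q i x}" by auto
  with insert show ?case by auto
qed (use assms(2) in simp)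

lemma coeff_linear_mult:
  fixes p :: "'a :: comm_ring_1 poly"
  shows "coeff ([:- a, 1:] * p) n = (if n = 0 then 0 else coeff p (n - 1)) - a * coeff p n"
  by (cases n) (auto simp: coeff_pCons)

lemma coeff_synthetic_div:
  fixes p :: "'a :: comm_ring_1 poly"
  shows "coeff (synthetic_div p a) n = coeff p (Suc n) + a * coeff (synthetic_div p a) (Suc n)"
proof -
  have "p = [:- a, 1:] * synthetic_div p a + [:poly p a:]" by (rule synthetic_div_correct'[symmetric])
  from arg_cong[OF this, of "\<lambda>p. coeff p (Suc n)"] show ?thesis
    by (simp only: coeff_add coeff_linear_mult) (simp add: coeff_pCons)
qed

lemma reg_at_poly:
  assumes V: "openin T V" "x \<in> V"
    and p: "\<And>i. reg_at T S (\<lambda>z. coeff (p z) i) x" "\<And>z. degree (p z) \<le> N" and a: "reg_at T S a x"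
  shows "reg_at T S (\<lambda>z. poly (p z) (a z)) x"
proof -
  have "poly (p z) (a z) = (\<Sum>i\<le>N. coeff (p z) i * a z ^ i)" for z
    unfolding poly_altdef by (rule sum.mono_neutral_left) (use p(2)[of z] in \<open>auto simp: coeff_eq_0\<close>)
  then show ?thesis by (simp add: reg_at_sum[OF V] reg_at_mult reg_at_power p a)
qed

text \<open>Horner's scheme computes the quotient from the top coefficient down, hence the downward
  induction from the degree bound \<open>N\<close>, from which on the coefficients vanish.\<close>

lemma reg_at_synthetic_div:
  assumes V: "openin T V" "x \<in> V"
    and p: "\<And>i. reg_at T S (\<lambda>z. coeff (p z) i) x" "\<And>z. degree (p z) \<le> N" and a: "reg_at T S a x"
  shows "reg_at T S (\<lambda>z. coeff (synthetic_div (p z) (a z)) i) x"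
proof (induction "N - i" arbitrary: i)
  case 0
  have "coeff (synthetic_div (p z) (a z)) i = 0" for z
  proof (cases "degree (p z) = 0")
    case True
    then have "synthetic_div (p z) (a z) = 0" using synthetic_div_eq_0_iff by metis
    then show ?thesis by simp
  next
    case False
    with 0 p(2)[of z] show ?thesis by (intro coeff_eq_0) (simp add: degree_synthetic_div)
  qed
  then show ?case by (simp add: reg_at_const[OF V])
next
  case (Suc k)
  then have "reg_at T S (\<lambda>z. coeff (synthetic_div (p z) (a z)) (Suc i)) x" by simp
  then have "reg_at T S (\<lambda>z. coeff (p z) (Suc i) + a z * coeff (synthetic_div (p z) (a z)) (Suc i)) x"
    by (intro reg_at_add reg_at_mult p a)
  then show ?case by (subst coeff_synthetic_div)
qed

lemma reg_at_nonzero_open: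
  assumes "reg_at T S h x" "h x \<noteq> 0" "x \<in> W" "\<And>p. p \<in> polyfuns S \<Longrightarrow> openin T {z \<in> W. p z \<noteq> 0}"
  shows "\<exists>V. openin T V \<and> x \<in> V \<and> V \<subseteq> W \<and> (\<forall>z\<in>V. h z \<noteq> 0)"
proof -
  obtain p q V where 1: "openin T V" "x \<in> V" "V \<subseteq> W" "\<forall>z \<in> V. p z \<noteq> 0 \<and> q z \<noteq> 0 \<and> h z = p z / q z"
    using reg_at_nonzero_nbhd[OF assms] by blast
  then show ?thesis by (intro exI[of _ V]) auto
qed

context hyperelliptic
begin

section \<open>The fibre and divisors\<close>

abbreviation "F \<equiv> mu_fibre g f"

lemma fibre_iff:
  "(p, q, r) \<in> F \<longleftrightarrow> degree p \<le> g \<and> poly p 0 = 1 \<and> degree q \<le> g \<and> poly q 0 = 2 \<and>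
     degree r \<le> g + 1 \<and> poly r 0 = 0 \<and> f = p\<^sup>2 + q * r"
  by (auto simp: mu_fibre_def M_def mu_def)

text \<open>p^2 has degree at most 2g, so q r carries the leading term of f and both degree bounds
  are attained.\<close>

lemma fibre_degrees:
  assumes "(p, q, r) \<in> F"
  shows "degree q = g" "degree r = g + 1" "q \<noteq> 0" "r \<noteq> 0" "lead_coeff q * lead_coeff r = lead_coeff f"
proof -
  have p: "degree p \<le> g" and q: "degree q \<le> g" and r: "degree r \<le> g + 1" and f: "f = p\<^sup>2 + q * r"
    using assms fibre_iff by auto
  have "degree (p\<^sup>2) \<le> 2 * g" using p degree_power_le[of p 2] by simp
  then have lt: "degree (- p\<^sup>2) < degree f" by (simp add: deg_f)
  have qr: "q * r = f + - p\<^sup>2" by (subst f) simp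
  then have "degree (q * r) = 2 * g + 1" using degree_add_eq_left[OF lt] deg_f by simp
  moreover from this show nz: "q \<noteq> 0" "r \<noteq> 0" by auto
  ultimately show "degree q = g" "degree r = g + 1" using q r degree_mult_eq[OF nz] by auto
  have "lead_coeff (q * r) = lead_coeff f" unfolding qr using lead_coeff_add_le[OF lt] by (simp add: add.commute)
  then show "lead_coeff q * lead_coeff r = lead_coeff f" by (simp add: lead_coeff_mult)
qed

definition fdiv :: "triplet \<Rightarrow> point multiset" where
  "fdiv = (\<lambda>(p, q, r). image_mset (\<lambda>a. Affine a (poly p a)) (proots q))"

text \<open>A double root of q at a zero of p would be a double root of f = p^2 + q r.\<close>

lemma fibre_order:
  assumes "(p, q, r) \<in> F" "poly p a = 0"
  shows "order a q \<le> 1"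
proof (rule ccontr)
  assume "\<not> ?thesis"
  then have "[:- a, 1:]\<^sup>2 dvd q" by (simp add: order_divides)
  moreover have "[:- a, 1:]\<^sup>2 dvd p\<^sup>2" using assms(2) by (simp add: poly_eq_0_iff_dvd dvd_power_same)
  ultimately have "[:- a, 1:]\<^sup>2 dvd f" using assms(1) fibre_iff by auto
  then have "2 \<le> order a f" using f_nz by (simp add: order_divides)
  then show False by (simp add: order_f split: if_splits)
qed

lemma fdiv_props:
  assumes m: "m \<in> F"
  shows "size (fdiv m) = g" "reduced (fdiv m)" "\<forall>P\<in>#fdiv m. coord_x P \<noteq> 0" "set_mset (fdiv m) \<subseteq> C"
proof -
  obtain p q r where pqr: "m = (p, q, r)" by (cases m)
  note fi = m[unfolded pqr fibre_iff]
  have q0: "q \<noteq> 0" using fibre_degrees m pqr by blast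
  show "size (fdiv m) = g"
    using fibre_degrees(1)[of p q r] m pqr by (simp add: fdiv_def size_proots_complex)
  show "\<forall>P\<in>#fdiv m. coord_x P \<noteq> 0" using fi q0 by (auto simp: pqr fdiv_def)
  have on: "(poly p a)\<^sup>2 = poly f a" if "poly q a = 0" for a
    using that arg_cong[of f "p\<^sup>2 + q * r" "\<lambda>p. poly p a"] fi by simp
  then show sub: "set_mset (fdiv m) \<subseteq> C" using q0 by (auto simp: pqr fdiv_def Affine_iff)
  show "reduced (fdiv m)"
    unfolding reduced_def
  proof (intro conjI allI notI)
    show "set_mset (fdiv m) \<subseteq> affine_curve f" using q0 on by (auto simp: pqr fdiv_def Affine_iff)
    fix P assume s: "{#P, invol P#} \<subseteq># fdiv m"
    then have "P \<in># fdiv m" "invol P \<in># fdiv m" using set_mset_mono[OF s] by auto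
    then obtain a where a: "P = Affine a (poly p a)" "poly p a = - poly p a" by (auto simp: pqr fdiv_def)
    \<comment> \<open>A conjugate pair on the graph of p is a branch point taken twice, so q has a
      double root at a zero of p.\<close>
    then have p0: "poly p a = 0" by (metis eq_neg_iff_add_eq_0 mult_2 mult_eq_0_iff zero_neq_numeral)
    then have "{#P, P#} \<subseteq># fdiv m" using s a by simp
    then have "count {#P, P#} P \<le> count (fdiv m) P" by (rule mset_subset_eq_count)
    then have "2 \<le> order a q" using a q0 by (simp add: pqr fdiv_def count_image_graph)
    then show False using fibre_order[of p q r a] p0 m pqr by simp
  qed
qed

text \<open>q is determined by its roots and q(0) = 2. For p, the equation (p - p') (p + p') = q (r'
  - r) shows that x q divides the left side, as r and r' vanish at 0. At a root of x q where p + p'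
  vanishes, p vanishes too and the root is simple; at the others the full multiplicity falls on p -
  p'. So p - p' has at least g + 1 roots but degree at most g, unless it is zero.\<close>

lemma fibre_inj:
  assumes m: "m \<in> F" "m' \<in> F" and eq: "fdiv m = fdiv m'"
  shows "m = m'"
proof -
  obtain p q r where pqr: "m = (p, q, r)" by (cases m)
  obtain p' q' r' where pqr': "m' = (p', q', r')" by (cases m')
  note fi = m(1)[unfolded pqr fibre_iff] and fi' = m(2)[unfolded pqr' fibre_iff]
  note fd = fibre_degrees[OF m(1)[unfolded pqr]] and fd' = fibre_degrees[OF m(2)[unfolded pqr']]
  have pr: "image_mset coord_x (fdiv (p, q, r)) = proots q" for p q r
    by (simp add: fdiv_def multiset.map_comp o_def)
  have prq: "proots q = proots q'" using pr[of p q r] pr[of p' q' r'] eq pqr pqr' by simp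
  let ?L = "\<Prod>x\<in>#proots q. [:-x, 1:]"
  have L: "q = smult (lead_coeff q) ?L" "q' = smult (lead_coeff q') ?L"
    using complex_poly_decompose_multiset[of q] complex_poly_decompose_multiset[of q'] prq by simp_all
  have "lead_coeff q * poly ?L 0 = 2" "lead_coeff q' * poly ?L 0 = 2"
    using fi fi' arg_cong[OF L(1), of "\<lambda>p. poly p 0"] arg_cong[OF L(2), of "\<lambda>p. poly p 0"] by simp_all
  then have "lead_coeff q = lead_coeff q'" by (metis mult_cancel_right mult_zero_right zero_neq_numeral)
  then have q: "q = q'" using L by metis
  have pa: "poly p a = poly p' a" if "poly q a = 0" for a
  proof -
    have "Affine a (poly p a) \<in># fdiv m" using that fd(3) by (auto simp: pqr fdiv_def)
    then have "Affine a (poly p a) \<in># fdiv m'" unfolding eq .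
    then show ?thesis by (auto simp: pqr' fdiv_def)
  qed
  have p: "p = p'"
  proof (rule ccontr)
    assume ne: "p \<noteq> p'"
    let ?s = "p - p'" and ?t = "p + p'" and ?k = "[:0, 1:] * q"
    have s: "?s \<noteq> 0" using ne by simp
    have "poly ?t 0 \<noteq> 0" using fi fi' by simp
    then have t: "?t \<noteq> 0" by (metis poly_0)
    have k: "?k \<noteq> 0" using fd(3) by simp
    have "[:0, 1:] dvd r' - r" using fi fi' poly_eq_0_iff_dvd[of "r' - r" 0] by simp
    moreover have "p\<^sup>2 + q * r = p'\<^sup>2 + q * r'" using fi fi' q by metis
    then have "?s * ?t = q * (r' - r)" by algebra
    ultimately have dvd: "?k dvd ?s * ?t" by (metis mult.commute mult_dvd_mono dvd_refl)
    have "proots ?k \<subseteq># proots ?s"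
    proof (rule mset_subset_eqI)
      fix a
      have "order a ?k \<le> order a ?s"
      proof (cases "poly ?k a = 0")
        case False
        then show ?thesis by (simp add: order_0I del: mult_pCons_left)
      next
        case True
        then have pe: "poly p a = poly p' a" using pa fi fi' by auto
        show ?thesis
        proof (cases "poly p a = 0")
          case True
          then have "a \<noteq> 0" using fi by auto
          then have "order a ([:0, 1:] :: complex poly) = 0" by (intro order_0I) simp
          then have "order a ?k \<le> 1"
            using fibre_order[OF m(1)[unfolded pqr] True] order_mult[OF k, of a] by simp
          moreover have "order a ?s \<ge> 1" using s pe order_root[of ?s a] by simp
          ultimately show ?thesis by simp
        next
          case False
          then have "order a ?t = 0" by (intro order_0I) (simp add: pe)
          moreover have "order a ?k \<le> order a (?s * ?t)"
            using dvd s t by (intro dvd_imp_order_le) auto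
          moreover have "?s * ?t \<noteq> 0" using s t by (metis mult_eq_0_iff)
          ultimately show ?thesis using order_mult[of ?s ?t a] by simp
        qed
      qed
      then show "count (proots ?k) a \<le> count (proots ?s) a" using k s by (simp del: mult_pCons_left)
    qed
    then have "degree ?k \<le> degree ?s" using size_mset_mono size_proots_complex by metis
    moreover have "degree ?k = Suc g" using fd(1,3) by (subst degree_mult_eq) auto
    moreover have "degree ?s \<le> g" using fi fi' by (intro degree_diff_le) auto
    ultimately show False by simp
  qed
  have "q * r = q * r'" using fi fi' p q by (metis add_left_cancel)
  then show ?thesis using fd(3) p q pqr pqr' by simp
qed

section \<open>Points of the product without conjugate pairs\<close>

abbreviation "Ag \<equiv> power_atlas g (curve_atlas g f)"
abbreviation "Tg \<equiv> atlas_topology Ag"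
abbreviation "Cg \<equiv> \<Pi>\<^sub>E i\<in>{..<g}. C"

definition "Ug = (\<Pi>\<^sub>E i\<in>{..<g}. affine_curve f)"

definition Sg :: "((nat \<Rightarrow> point) \<Rightarrow> complex) set" where
  "Sg = {(\<lambda>x. s (x i)) | i s. i < g \<and> s \<in> {coord_x, coord_y}}"

abbreviation ps :: "(nat \<Rightarrow> point) \<Rightarrow> point list" where "ps P \<equiv> map P [0..<g]"

definition pts :: "(nat \<Rightarrow> point) \<Rightarrow> point multiset" where "pts P = mset (ps P)"

lemma pts_mem: "Q \<in># pts P \<longleftrightarrow> (\<exists>i<g. Q = P i)"
  by (auto simp: pts_def)

lemma size_pts [simp]: "size (pts P) = g"
  by (simp add: pts_def)

lemma Ug_point: "P \<in> Ug \<Longrightarrow> i < g \<Longrightarrow> P i \<in> affine_curve f"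
  by (auto simp: Ug_def PiE_iff)

text \<open>The preimage under the Abel-Jacobi map of the complement of the three translates, see
  \<open>AJ_preimage\<close>.\<close>

definition C0 :: "(nat \<Rightarrow> point) set" where
  "C0 = {P \<in> Ug. reduced (pts P) \<and> (\<forall>i<g. coord_x (P i) \<noteq> 0)}"

lemma power_chart: "(Ug, Sg) \<in> Ag"
  unfolding power_atlas_def Ug_def Sg_def
  by (rule CollectI, rule exI[of _ "\<lambda>_. (affine_curve f, {coord_x, coord_y})"]) (auto simp: curve_atlas_def)

lemma topspace_Tg: "topspace Tg = Cg"
proof -
  have "Cg \<subseteq> (\<Union>(V, S) \<in> Ag. V)"
  proof
    fix x assume x: "x \<in> Cg"
    let ?c = "\<lambda>i. (U_at (x i), S_at (x i))"
    have "x \<in> (\<Pi>\<^sub>E i\<in>{..<g}. fst (?c i))" using x chart_mem by (auto simp: PiE_iff)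
    moreover have "((\<Pi>\<^sub>E i\<in>{..<g}. fst (?c i)), {(\<lambda>x. s (x i)) | i s. i < g \<and> s \<in> snd (?c i)}) \<in> Ag"
      unfolding power_atlas_def by (intro CollectI exI[of _ ?c]) (simp add: chart_at_in)
    ultimately show "x \<in> (\<Union>(V, S) \<in> Ag. V)" by blast
  qed
  moreover have sub: "V \<subseteq> Cg" if VS: "(V, S) \<in> Ag" for V S
  proof -
    obtain c where c: "V = (\<Pi>\<^sub>E i\<in>{..<g}. fst (c i))" "\<forall>i<g. c i \<in> curve_atlas g f"
      using VS unfolding power_atlas_def by auto
    have "fst (c i) \<subseteq> C" if "i < g" for i
      using c(2)[rule_format, OF that] by (auto simp: curve_atlas_def)
    then show ?thesis unfolding c(1) by (intro PiE_mono) auto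
  qed
  have "(\<Union>(V, S) \<in> Ag. V) \<subseteq> Cg"
  proof (rule UN_least)
    fix p assume "p \<in> Ag"
    moreover obtain V S where "p = (V, S)" by (cases p)
    ultimately show "(case p of (V, S) \<Rightarrow> V) \<subseteq> Cg" using sub[of V S] by simp
  qed
  ultimately show ?thesis unfolding topspace_atlas by (intro equalityI)
qed

lemma open_basic_g: "p \<in> polyfuns Sg \<Longrightarrow> openin Tg {z \<in> Ug. p z \<noteq> 0}"
  by (rule openin_atlas_basic[OF power_chart])

lemma open_Ug: "openin Tg Ug"
  by (rule openin_atlas_chart[OF power_chart])

lemma polyfuns_xy: "i < g \<Longrightarrow> (\<lambda>z. coord_x (z i)) \<in> polyfuns Sg" "i < g \<Longrightarrow> (\<lambda>z. coord_y (z i)) \<in> polyfuns Sg"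
  unfolding Sg_def by (rule polyfuns.gen, blast)+

lemma reduced_add_msetI:
  assumes "reduced Z" "P \<in> affine_curve f" "invol P \<notin># Z"
  shows "reduced (add_mset P Z)"
  unfolding reduced_def
proof (intro conjI allI notI)
  show "set_mset (add_mset P Z) \<subseteq> affine_curve f" using assms by (auto simp: reduced_def)
  fix Q assume Q: "{#Q, invol Q#} \<subseteq># add_mset P Z"
  consider "Q = P" | "invol Q = P" | "Q \<noteq> P" "invol Q \<noteq> P" by blast
  then show False
  proof cases
    case 1
    then show ?thesis using Q assms(3) by simp
  next
    case 2
    then have "{#P, Q#} \<subseteq># add_mset P Z" using Q by (simp add: add_mset_commute)
    then have "Q \<in># Z" by simp
    then show ?thesis using 2 assms(3) by (metis invol_invol)
  next
    case 3
    have "count {#Q, invol Q#} a \<le> count Z a" for a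
      using mset_subset_eq_count[OF Q, of a] 3 by (cases "a = P") simp_all
    then have "{#Q, invol Q#} \<subseteq># Z" by (rule mset_subset_eqI)
    then show ?thesis using assms(1) by (simp add: reduced_def)
  qed
qed

text \<open>Turns reducedness into finitely many conditions on pairs of entries, each of which is
  open.\<close>

lemma reduced_sorted_wrt:
  "reduced (mset xs) \<longleftrightarrow> set xs \<subseteq> affine_curve f \<and> sorted_wrt (\<lambda>P Q. Q \<noteq> invol P) xs"
proof (induction xs)
  case Nil
  show ?case by (simp add: reduced_def)
next
  case (Cons P xs)
  have "reduced (mset (P # xs)) \<longleftrightarrow> reduced (mset xs) \<and> P \<in> affine_curve f \<and> invol P \<notin> set xs"
    using reduced_add_mset[of P "mset xs"] reduced_add_msetI[of "mset xs" P] by auto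
  then show ?case using Cons by auto
qed

lemma mem_C0: "P \<in> C0 \<longleftrightarrow> P \<in> Ug \<and> (\<forall>i\<in>{..<g}. coord_x (P i) \<noteq> 0) \<and>
    (\<forall>ij\<in>{(i, j). i < j \<and> j < g}. P (snd ij) \<noteq> invol (P (fst ij)))"
proof (cases "P \<in> Ug")
  case True
  then have "set (ps P) \<subseteq> affine_curve f" using Ug_point by auto
  then show ?thesis using True
    unfolding C0_def pts_def reduced_sorted_wrt by (auto simp: sorted_wrt_iff_nth_less)
qed (simp add: C0_def)

lemma open_C0: "openin Tg C0"
proof -
  let ?W = "{z \<in> Ug. \<forall>i\<in>{..<g}. coord_x (z i) \<noteq> 0}"
  have W: "openin Tg ?W"
    by (rule openin_finite_all[OF _ open_Ug]) (auto intro!: open_basic_g polyfuns_xy)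
  have fin: "finite {(i, j). i < j \<and> j < g}" by (rule finite_subset[of _ "{..<g} \<times> {..<g}"]) auto
  have "openin Tg {z \<in> ?W. \<forall>ij\<in>{(i, j). i < j \<and> j < g}. z (snd ij) \<noteq> invol (z (fst ij))}"
  proof (rule openin_finite_all[OF fin W])
    fix ij assume "ij \<in> {(i, j). i < j \<and> j < g}"
    then obtain i j where ij: "ij = (i, j)" "i < g" "j < g" by auto
    have "openin Tg {z \<in> Ug. coord_x (z j) - coord_x (z i) \<noteq> 0}" "openin Tg {z \<in> Ug. coord_y (z j) + coord_y (z i) \<noteq> 0}"
      using ij by (auto intro!: open_basic_g[of "\<lambda>z. coord_x (z j) - coord_x (z i)", simplified]
         open_basic_g[of "\<lambda>z. coord_y (z j) + coord_y (z i)", simplified] polyfuns_diff polyfuns.add polyfuns_xy)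
    then have "openin Tg (?W \<inter> ({z \<in> Ug. coord_x (z j) - coord_x (z i) \<noteq> 0} \<union> {z \<in> Ug. coord_y (z j) + coord_y (z i) \<noteq> 0}))"
      using W by blast
    moreover have "?W \<inter> ({z \<in> Ug. coord_x (z j) - coord_x (z i) \<noteq> 0} \<union> {z \<in> Ug. coord_y (z j) + coord_y (z i) \<noteq> 0})
        = {z \<in> ?W. z (snd ij) \<noteq> invol (z (fst ij))}"
    proof -
      have "z j \<noteq> invol (z i) \<longleftrightarrow> coord_x (z j) - coord_x (z i) \<noteq> 0 \<or> coord_y (z j) + coord_y (z i) \<noteq> 0"
        if "z \<in> Ug" for z
      proof -
        have "z i \<in> affine_curve f" "z j \<in> affine_curve f" using that ij Ug_point by auto
        then obtain a b a' b' where "z i = Affine a b" "z j = Affine a' b'" by (auto simp: affine_curve_def)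
        then show ?thesis by (auto simp: add_eq_0_iff2)
      qed
      then show ?thesis unfolding ij fst_conv snd_conv by blast
    qed
    ultimately show "openin Tg {z \<in> ?W. z (snd ij) \<noteq> invol (z (fst ij))}" by simp
  qed
  also have "{z \<in> ?W. \<forall>ij\<in>{(i, j). i < j \<and> j < g}. z (snd ij) \<noteq> invol (z (fst ij))} = C0"
    using mem_C0 by auto
  finally show ?thesis .
qed

lemma C0_point: "P \<in> C0 \<Longrightarrow> i < g \<Longrightarrow> P i \<in> affine_curve f \<and> coord_x (P i) \<noteq> 0"
  by (simp add: C0_def Ug_point)

lemma C0_Ug: "P \<in> C0 \<Longrightarrow> P \<in> Ug"
  by (simp add: C0_def)

lemma Ug_Cg: "Ug \<subseteq> Cg"
  unfolding Ug_def by (intro PiE_mono) auto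

section \<open>The inverse map\<close>

text \<open>The appended point imposes P(0) = 1 and brings the number of points to g + 1. It stands
  last because \<open>mum\<close> works from the end of the list; \<open>js\<close> varies in the
  induction over the points added after it.\<close>

abbreviation lst :: "nat list \<Rightarrow> (nat \<Rightarrow> point) \<Rightarrow> point list" where
  "lst js P \<equiv> map P js @ [Affine 0 1]"

lemma reduced_lst:
  assumes "P \<in> C0"
  shows "reduced (mset (lst [0..<g] P))"
proof -
  have "invol (Affine 0 1) \<notin># pts P"
  proof
    assume "invol (Affine 0 1) \<in># pts P"
    then obtain i where "i < g" "P i = Affine 0 (- 1)" by (auto simp: pts_mem)
    then show False using C0_point[OF assms, of i] by simp
  qed
  then have "reduced (add_mset (Affine 0 1) (pts P))"
    using assms Affine_0_1 by (intro reduced_add_msetI) (auto simp: C0_def)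
  then show ?thesis by (simp add: pts_def)
qed

definition xprod :: "(nat \<Rightarrow> point) \<Rightarrow> complex poly" where
  "xprod P = (\<Prod>Q\<leftarrow>ps P. [:- coord_x Q, 1:])"

text \<open>The Mumford polynomial u of the enlarged list is x times \<open>xprod P\<close>. The
  factor x moves to the third component, which then vanishes at 0, and c rescales the second to the
  value 2 at 0.\<close>

definition beta :: "(nat \<Rightarrow> point) \<Rightarrow> triplet" where
  "beta P = (let (u, v, w) = mum f (lst [0..<g] P); c = poly (xprod P) 0
     in (v, smult (2 / c) (xprod P), smult (c / 2) ([:0, 1:] * w)))"

lemma xprod_0: "P \<in> C0 \<Longrightarrow> poly (xprod P) 0 \<noteq> 0"
  unfolding xprod_def poly_linear_prod using C0_point[of P] by auto

lemma beta_fibre: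
  assumes P: "P \<in> C0"
  shows "beta P \<in> F" "fdiv (beta P) = pts P"
proof -
  obtain u v w where uvw: "mum f (lst [0..<g] P) = (u, v, w)" by (cases "mum f (lst [0..<g] P)") auto
  have m: "mrep (lst [0..<g] P) (u, v, w)" using mrep_mum[OF reduced_lst[OF P]] uvw by simp
  have len: "length (lst [0..<g] P) = g + 1" by simp
  have dw: "degree w = g" "degree v \<le> g" using mrep_degree[OF m len] by auto
  let ?c = "poly (xprod P) 0"
  have b: "beta P = (v, smult (2 / ?c) (xprod P), smult (?c / 2) ([:0, 1:] * w))"
    by (simp add: beta_def uvw Let_def)
  have c: "?c \<noteq> 0" by (rule xprod_0[OF P])
  have u: "u = xprod P * [:0, 1:]" using m by (simp add: mrep_def xprod_def del: mult_pCons_right)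
  have v: "\<And>Q. Q \<in> set (lst [0..<g] P) \<Longrightarrow> poly v (coord_x Q) = coord_y Q" and f: "f = v\<^sup>2 + u * w"
    using m by (auto simp: mrep_def)
  have "degree (xprod P) = g" using degree_linear_prod[of coord_x "ps P"] by (simp add: xprod_def)
  moreover have "poly v 0 = 1" using v[of "Affine 0 1"] by simp
  moreover have "degree ([:0, 1:] * w) \<le> g + 1" using dw degree_pCons_le[of 0 w] by simp
  moreover have E: "smult (2 / ?c) (xprod P) * smult (?c / 2) ([:0, 1:] * w) = u * w"
    unfolding u using c by (simp add: mult.assoc del: mult_pCons_left mult_pCons_right)
  ultimately show "beta P \<in> F"
    unfolding b fibre_iff E using dw f c by (simp del: mult_pCons_left mult_pCons_right)
  have "fdiv (beta P) = image_mset (\<lambda>a. Affine a (poly v a)) (image_mset coord_x (pts P))"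
    unfolding b fdiv_def pts_def xprod_def prod.case
    using c by (simp add: xprod_def proots_linear_prod del: map_map)
  also have "\<dots> = image_mset (\<lambda>Q. Q) (pts P)"
    unfolding image_mset.compositionality o_def
  proof (rule image_mset_cong)
    fix Q assume "Q \<in># pts P"
    then obtain i where i: "i < g" "Q = P i" by (auto simp: pts_mem)
    then have "Q \<in> affine_curve f" "poly v (coord_x Q) = coord_y Q" using C0_point[OF P i(1)] v by auto
    then show "Affine (coord_x Q) (poly v (coord_x Q)) = Q" using affine_coords by metis
  qed
  finally show "fdiv (beta P) = pts P" by simp
qed

text \<open>Any ordering of the points of \<open>fdiv m\<close> will do: its image under
  \<open>beta\<close> has the same divisor, so \<open>fibre_inj\<close> identifies it with
  m.\<close>

lemma fibre_eq_beta:
  assumes "m \<in> F"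
  obtains P where "P \<in> C0" "beta P = m"
proof -
  note fp = fdiv_props[OF assms]
  obtain P0 where P0: "fdiv m = pts P0" using ex_map_upt[of "fdiv m"] fp(1) unfolding pts_def by metis
  let ?P = "restrict P0 {..<g}"
  have "ps ?P = ps P0" by simp
  then have eq: "pts ?P = pts P0" by (simp only: pts_def)
  have "P0 i \<in> affine_curve f" if "i < g" for i
    using fp(2) that pts_mem unfolding P0 reduced_def by blast
  then have "?P \<in> Ug" unfolding Ug_def by auto
  moreover have "coord_x (P0 i) \<noteq> 0" if "i < g" for i using fp(3) that pts_mem[of "P0 i" P0] unfolding P0 by blast
  ultimately have P: "?P \<in> C0" unfolding C0_def mem_Collect_eq eq using fp(2) P0 by simp
  have "beta ?P = m" by (rule fibre_inj) (use beta_fibre[OF P] assms P0 eq in auto)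
  with P that show ?thesis by blast
qed

section \<open>Regularity of the Mumford representation in the points\<close>

lemma degree_mstep:
  assumes "degree u \<le> N" "degree v \<le> N" "degree w \<le> N" "mstep P (u, v, w) = (u', v', w')"
  shows "degree u' \<le> Suc N" "degree v' \<le> Suc N" "degree w' \<le> Suc N"
proof -
  obtain c where uvw: "u' = [:- coord_x P, 1:] * u" "v' = v + smult c u"
    "w' = synthetic_div (w - smult (2 * c) v - smult (c\<^sup>2) u) (coord_x P)"
    using assms(4) by (auto simp: mstep_def Let_def simp del: mult_pCons_left)
  have s: "degree (smult d q) \<le> N" if "degree q \<le> N" for d :: complex and q
    using degree_smult_le[of d q] that by simp
  have "degree u' \<le> degree [:- coord_x P, 1:] + degree u" unfolding uvw by (rule degree_mult_le)
  then show "degree u' \<le> Suc N" using assms(1) by simp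
  have "degree v' \<le> N" unfolding uvw by (intro degree_add_le s assms)
  then show "degree v' \<le> Suc N" by simp
  have "degree (w - smult (2 * c) v - smult (c\<^sup>2) u) \<le> N" by (intro degree_diff_le s assms)
  then show "degree w' \<le> Suc N" unfolding uvw degree_synthetic_div by simp
qed

text \<open>A crude bound independent of the coordinates of the points, so that evaluation becomes a
  sum with a fixed number of terms.\<close>

lemma degree_mum:
  "degree (fst (mum f Ps)) \<le> degree f + length Ps \<and> degree (fst (snd (mum f Ps))) \<le> degree f + length Ps \<and>
   degree (snd (snd (mum f Ps))) \<le> degree f + length Ps"
proof (induction Ps)
  case (Cons P Ps)
  obtain u v w where 1: "mum f Ps = (u, v, w)" by (cases "mum f Ps") auto
  obtain u' v' w' where 2: "mstep P (u, v, w) = (u', v', w')" by (cases "mstep P (u, v, w)") auto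
  show ?case using degree_mstep[OF _ _ _ 2] Cons 1 2 by simp
qed simp

abbreviation regC :: "((nat \<Rightarrow> point) \<Rightarrow> complex) \<Rightarrow> (nat \<Rightarrow> point) \<Rightarrow> bool" where
  "regC h P \<equiv> reg_at Tg Sg h P"

lemma regC_const: "P \<in> C0 \<Longrightarrow> regC (\<lambda>_. c) P"
  by (rule reg_at_const[OF open_C0])

lemma regC_polyfuns: "P \<in> C0 \<Longrightarrow> p \<in> polyfuns Sg \<Longrightarrow> regC p P"
  by (rule reg_at_polyfuns[OF open_C0])

lemma regC_divide: "P \<in> C0 \<Longrightarrow> regC k P \<Longrightarrow> regC h P \<Longrightarrow> h P \<noteq> 0 \<Longrightarrow> regC (\<lambda>z. k z / h z) P"
  by (rule reg_at_divide[where U = Ug]) (auto intro: open_basic_g C0_Ug)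

definition mcoeff :: "(nat \<Rightarrow> point) \<Rightarrow> nat \<Rightarrow> triplet \<Rightarrow> complex" where
  "mcoeff P j = (\<lambda>(u, v, w). if poly u (coord_x (P j)) \<noteq> 0
     then (coord_y (P j) - poly v (coord_x (P j))) / poly u (coord_x (P j))
     else poly w (coord_x (P j)) / (coord_y (P j) + poly v (coord_x (P j))))"

text \<open>The definition of c by cases looks singular where points collide. Where u(a) is nonzero
  the first quotient is valid nearby. Where u(a) = 0, the identity c (b + v(a)) = w(a), true in both
  cases, makes the second quotient valid on a whole neighbourhood.\<close>

lemma regC_mum:
  assumes ob: "ob \<in> C0" and js: "set js \<subseteq> {..<g}"
    and red: "\<And>P. P \<in> C0 \<Longrightarrow> reduced (mset (lst js P))"
  shows "\<forall>i. regC (\<lambda>P. coeff (fst (mum f (lst js P))) i) ob \<and> regC (\<lambda>P. coeff (fst (snd (mum f (lst js P)))) i) ob \<and>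
    regC (\<lambda>P. coeff (snd (snd (mum f (lst js P)))) i) ob"
  using js red
proof (induction js)
  case Nil
  show ?case by (simp add: regC_const[OF ob])
next
  case (Cons j js)
  have j: "j < g" using Cons.prems by simp
  let ?m = "\<lambda>P. mum f (lst js P)"
  let ?u = "\<lambda>P. fst (?m P)" and ?v = "\<lambda>P. fst (snd (?m P))" and ?w = "\<lambda>P. snd (snd (?m P))"
  let ?a = "\<lambda>P. coord_x (P j)" and ?b = "\<lambda>P. coord_y (P j)"
  let ?N = "degree f + length (js @ [0])"
  have rd: "reduced (mset (lst js P))" "P j \<in> affine_curve f" "invol (P j) \<notin> set (lst js P)" if "P \<in> C0" for P
    using Cons.prems(2)[OF that] reduced_add_mset[of "P j" "mset (lst js P)"] by auto
  have IH: "regC (\<lambda>P. coeff (?u P) i) ob" "regC (\<lambda>P. coeff (?v P) i) ob" "regC (\<lambda>P. coeff (?w P) i) ob" for i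
    using Cons.IH Cons.prems(1) rd(1) by auto
  have deg: "degree (?u P) \<le> ?N" "degree (?v P) \<le> ?N" "degree (?w P) \<le> ?N" for P
    using degree_mum[of "lst js P"] by auto
  have ra: "regC ?a ob" "regC ?b ob" by (auto intro: regC_polyfuns[OF ob] polyfuns_xy[OF j])
  note rp = reg_at_poly[OF open_C0 ob]
  have ua: "regC (\<lambda>P. poly (?u P) (?a P)) ob" by (rule rp[OF IH(1) deg(1) ra(1)])
  have va: "regC (\<lambda>P. poly (?v P) (?a P)) ob" by (rule rp[OF IH(2) deg(2) ra(1)])
  have wa: "regC (\<lambda>P. poly (?w P) (?a P)) ob" by (rule rp[OF IH(3) deg(3) ra(1)])
  let ?c = "\<lambda>P. mcoeff P j (?m P)"
  have mc: "poly (?u P) (?a P) = 0 \<Longrightarrow> ?b P + poly (?v P) (?a P) \<noteq> 0"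
    "?c P * (?b P + poly (?v P) (?a P)) = poly (?w P) (?a P)" if P: "P \<in> C0" for P
  proof -
    have m: "mrep (lst js P) (?u P, ?v P, ?w P)" using mrep_mum[OF rd(1)[OF P]] by simp
    have sub: "set (lst js P) \<subseteq> affine_curve f" using rd(1)[OF P] unfolding reduced_def by simp
    note mstep_coeff[OF m sub rd(2,3)[OF P]]
    then show "poly (?u P) (?a P) = 0 \<Longrightarrow> ?b P + poly (?v P) (?a P) \<noteq> 0"
      "?c P * (?b P + poly (?v P) (?a P)) = poly (?w P) (?a P)"
      by (auto simp: mcoeff_def case_prod_unfold)
  qed
  have c: "regC ?c ob"
  proof (cases "poly (?u ob) (?a ob) = 0")
    case False
    obtain V where V: "openin Tg V" "ob \<in> V" "\<And>P. P \<in> V \<Longrightarrow> poly (?u P) (?a P) \<noteq> 0"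
      using reg_at_nonzero_open[OF ua False C0_Ug[OF ob] open_basic_g] by blast
    have "regC (\<lambda>P. (?b P - poly (?v P) (?a P)) / poly (?u P) (?a P)) ob"
      by (intro regC_divide ob reg_at_diff ra va ua False)
    then show ?thesis by (rule reg_at_cong[OF _ V(1,2)]) (use V(3) in \<open>auto simp: mcoeff_def case_prod_unfold\<close>)
  next
    case True
    have nz: "?b ob + poly (?v ob) (?a ob) \<noteq> 0" by (rule mc(1)[OF ob True])
    have bv: "regC (\<lambda>P. ?b P + poly (?v P) (?a P)) ob" by (intro reg_at_add ra va)
    obtain V where V: "openin Tg V" "ob \<in> V" "\<And>P. P \<in> V \<Longrightarrow> ?b P + poly (?v P) (?a P) \<noteq> 0"
      using reg_at_nonzero_open[OF bv nz C0_Ug[OF ob] open_basic_g] by blast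
    have "regC (\<lambda>P. poly (?w P) (?a P) / (?b P + poly (?v P) (?a P))) ob"
      by (intro regC_divide ob wa bv nz)
    moreover have "openin Tg (V \<inter> C0)" "ob \<in> V \<inter> C0" using V open_C0 ob by auto
    moreover have "?c P = poly (?w P) (?a P) / (?b P + poly (?v P) (?a P))" if "P \<in> V \<inter> C0" for P
      using V(3)[of P] mc(2)[of P] that by (simp add: eq_divide_eq)
    ultimately show ?thesis by (rule reg_at_cong)
  qed
  have step: "mum f (lst (j # js) P) = ([:- ?a P, 1:] * ?u P, ?v P + smult (?c P) (?u P),
      synthetic_div (?w P - smult (2 * ?c P) (?v P) - smult ((?c P)\<^sup>2) (?u P)) (?a P))" for P
    by (simp add: mstep_def mcoeff_def case_prod_unfold Let_def del: mult_pCons_left)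
  have r1: "regC (\<lambda>P. coeff ([:- ?a P, 1:] * ?u P) i) ob" for i
    unfolding coeff_linear_mult by (cases "i = 0") (auto intro!: reg_at_diff reg_at_mult IH ra regC_const[OF ob] reg_at_uminus)
  have r2: "regC (\<lambda>P. coeff (?v P + smult (?c P) (?u P)) i) ob" for i
    unfolding coeff_add coeff_smult by (intro reg_at_add reg_at_mult IH c)
  have q: "regC (\<lambda>P. coeff (?w P - smult (2 * ?c P) (?v P) - smult ((?c P)\<^sup>2) (?u P)) i) ob" for i
    unfolding coeff_diff coeff_smult
    by (intro reg_at_diff reg_at_mult reg_at_power IH c regC_const[OF ob])
  have s: "degree (smult d p) \<le> ?N" if "degree p \<le> ?N" for d :: complex and p
    using degree_smult_le[of d p] that by simp
  have "degree (?w P - smult (2 * ?c P) (?v P) - smult ((?c P)\<^sup>2) (?u P)) \<le> ?N" for P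
    by (intro degree_diff_le s deg)
  from reg_at_synthetic_div[OF open_C0 ob q this ra(1)]
  show ?case unfolding step fst_conv snd_conv using r1 r2 by blast
qed

section \<open>Pulling functions on the fibre back to the product\<close>

definition SF :: "(triplet \<Rightarrow> complex) set" where
  "SF = {(\<lambda>(P, Q, R). coeff P i) | i. i \<le> g} \<union>
     {(\<lambda>(P, Q, R). coeff Q i) | i. i \<le> g} \<union> {(\<lambda>(P, Q, R). coeff R i) | i. i \<le> g + 1}"

abbreviation "TF \<equiv> atlas_topology {(F, SF)}"

lemma fibre_variety: "mu_fibre_variety g f = atlas_space {(F, SF)}"
  by (simp add: mu_fibre_variety_def SF_def)

lemma polyfuns_xprod: "(\<lambda>P. coeff (xprod P) i) \<in> polyfuns Sg"
proof -
  have "(\<lambda>P. coeff (\<Prod>Q\<leftarrow>map P js. [:- coord_x Q, 1:]) i) \<in> polyfuns Sg" if "set js \<subseteq> {..<g}" for js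
    using that
  proof (induction js arbitrary: i)
    case Nil
    show ?case by (simp add: polyfuns.const)
  next
    case (Cons j js)
    have "(\<lambda>P. coeff (\<Prod>Q\<leftarrow>map P (j # js). [:- coord_x Q, 1:]) i)
      = (\<lambda>P. (if i = 0 then 0 else coeff (\<Prod>Q\<leftarrow>map P js. [:- coord_x Q, 1:]) (i - 1))
          - coord_x (P j) * coeff (\<Prod>Q\<leftarrow>map P js. [:- coord_x Q, 1:]) i)"
      by (simp only: list.map prod_list.Cons coeff_linear_mult)
    moreover have "\<dots> \<in> polyfuns Sg"
      using Cons by (cases "i = 0") (auto intro!: polyfuns_diff polyfuns.mult polyfuns_xy polyfuns.const polyfuns_uminus)
    ultimately show ?case by simp
  qed
  moreover have "set [0..<g] \<subseteq> {..<g}" by auto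
  ultimately show ?thesis unfolding xprod_def by blast
qed

lemma regC_beta:
  assumes ob: "ob \<in> C0" and e: "e \<in> SF"
  shows "regC (\<lambda>P. e (beta P)) ob"
proof -
  let ?m = "\<lambda>P. mum f (lst [0..<g] P)" and ?c = "\<lambda>P. poly (xprod P) 0"
  have b: "beta P = (fst (snd (?m P)), smult (2 / ?c P) (xprod P), smult (?c P / 2) ([:0, 1:] * snd (snd (?m P))))" for P
    by (simp add: beta_def case_prod_unfold Let_def)
  have R: "\<forall>i. regC (\<lambda>P. coeff (fst (?m P)) i) ob \<and> regC (\<lambda>P. coeff (fst (snd (?m P))) i) ob \<and>
    regC (\<lambda>P. coeff (snd (snd (?m P))) i) ob"
    by (rule regC_mum[OF ob _ reduced_lst]) auto
  have r: "regC (\<lambda>P. coeff (fst (snd (?m P))) i) ob" "regC (\<lambda>P. coeff (snd (snd (?m P))) i) ob" for i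
    using R by blast+
  have x: "regC (\<lambda>P. coeff (xprod P) i) ob" for i by (rule regC_polyfuns[OF ob polyfuns_xprod])
  have rc: "regC ?c ob" unfolding poly_0_coeff_0 by (rule x)
  have w: "regC (\<lambda>P. coeff ([:0, 1:] * snd (snd (?m P))) i) ob" for i
    by (cases i) (simp_all add: r regC_const[OF ob])
  have "regC (\<lambda>P. coeff (smult (2 / ?c P) (xprod P)) i) ob" for i
    unfolding coeff_smult by (intro reg_at_mult regC_divide ob x rc regC_const xprod_0)
  moreover have "regC (\<lambda>P. coeff (smult (?c P / 2) ([:0, 1:] * snd (snd (?m P)))) i) ob" for i
    unfolding coeff_smult
    by (intro reg_at_mult regC_divide ob x rc regC_const w) simp
  ultimately show ?thesis
    using e r unfolding SF_def by (auto simp: b)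
qed

lemma regC_compose_beta: "P \<in> C0 \<Longrightarrow> p \<in> polyfuns SF \<Longrightarrow> regC (\<lambda>P. p (beta P)) P"
  by (rule reg_at_compose[where S' = SF, OF _ open_C0]) (auto intro: regC_beta)

lemma open_beta_nonzero:
  assumes "p \<in> polyfuns SF"
  shows "openin Tg {P \<in> C0. p (beta P) \<noteq> 0}"
proof (subst openin_subopen, intro ballI)
  fix P assume P: "P \<in> {P \<in> C0. p (beta P) \<noteq> 0}"
  then have ob: "P \<in> C0" by simp
  have nz: "p (beta P) \<noteq> 0" using P by simp
  obtain V where V: "openin Tg V" "P \<in> V" "\<And>P. P \<in> V \<Longrightarrow> p (beta P) \<noteq> 0"
    using reg_at_nonzero_open[OF regC_compose_beta[OF ob assms] nz C0_Ug[OF ob] open_basic_g] by blast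
  then have "openin Tg (V \<inter> C0)" "P \<in> V \<inter> C0" "V \<inter> C0 \<subseteq> {P \<in> C0. p (beta P) \<noteq> 0}" using open_C0 ob by auto
  then show "\<exists>V. openin Tg V \<and> P \<in> V \<and> V \<subseteq> {P \<in> C0. p (beta P) \<noteq> 0}" by blast
qed

lemma topspace_TF: "topspace TF = F"
  by (simp add: topspace_atlas)

lemma open_beta_preimage:
  assumes "openin TF V"
  shows "openin Tg {P \<in> C0. beta P \<in> V}"
proof -
  have "C0 \<subseteq> topspace Tg" using C0_Ug Ug_Cg topspace_Tg by blast
  then have ts: "topspace (subtopology Tg C0) = C0" by auto
  have "continuous_map (subtopology Tg C0) TF beta"
    unfolding atlas_topology_def[of "{(F, SF)}"]
  proof (rule continuous_on_generated_topo)
    fix W assume "W \<in> {{x \<in> U. p x \<noteq> 0} | U S p. (U, S) \<in> {(F, SF)} \<and> p \<in> polyfuns S}"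
    then obtain p where p: "W = {x \<in> F. p x \<noteq> 0}" "p \<in> polyfuns SF" by auto
    have "beta -` W \<inter> topspace (subtopology Tg C0) = {P \<in> C0. p (beta P) \<noteq> 0}"
      unfolding ts p using beta_fibre by auto
    then show "openin (subtopology Tg C0) (beta -` W \<inter> topspace (subtopology Tg C0))"
      using open_beta_nonzero[OF p(2)] open_C0 by (simp add: openin_open_subtopology)
  next
    have "F \<in> {{x \<in> U. p x \<noteq> 0} | U S p. (U, S) \<in> {(F, SF)} \<and> p \<in> polyfuns S}"
      by (rule CollectI, rule exI[of _ F], rule exI[of _ SF], rule exI[of _ "\<lambda>_. 1"])
        (auto intro: polyfuns.const)
    moreover have "beta ` topspace (subtopology Tg C0) \<subseteq> F" unfolding ts using beta_fibre by auto
    ultimately show "beta ` topspace (subtopology Tg C0)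
      \<subseteq> \<Union>{{x \<in> U. p x \<noteq> 0} | U S p. (U, S) \<in> {(F, SF)} \<and> p \<in> polyfuns S}" by blast
  qed
  from openin_continuous_map_preimage[OF this assms]
  have "openin (subtopology Tg C0) {P \<in> C0. beta P \<in> V}" unfolding ts .
  then show ?thesis using open_C0 by (simp add: openin_open_subtopology)
qed

lemma regular_beta:
  assumes "openin TF V" "h \<in> regular (atlas_space {(F, SF)}) V"
  shows "h \<circ> beta \<in> regular (atlas_space Ag) {P \<in> C0. beta P \<in> V}"
proof (rule regular_atlasI[OF open_beta_preimage[OF assms(1)]])
  fix P assume P: "P \<in> {P \<in> C0. beta P \<in> V}"
  then have ob: "P \<in> C0" by simp
  have "reg_at TF SF h (beta P)" using regular_atlas_reg_at[OF assms(2), of "beta P"] P by auto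
  then obtain p q W where 1: "p \<in> polyfuns SF" "q \<in> polyfuns SF" "openin TF W" "beta P \<in> W"
    "\<And>z. z \<in> W \<Longrightarrow> q z \<noteq> 0" "\<And>z. z \<in> W \<Longrightarrow> h z = p z / q z"
    by (rule reg_atE) blast
  have "regC (\<lambda>P. p (beta P) / q (beta P)) P"
    by (intro regC_divide ob regC_compose_beta 1)
  then have "regC (h \<circ> beta) P"
    by (rule reg_at_cong[OF _ open_beta_preimage[OF 1(3)]]) (use ob 1 in auto)
  then show "\<exists>(U, S)\<in>Ag. P \<in> U \<and> reg_at Tg S (h \<circ> beta) P" using power_chart C0_Ug[OF ob] by blast
qed

section \<open>Denominators on the product\<close>

text \<open>A common denominator: on \<open>C0\<close> the coordinates t = 1/x and s = y/x^(g+1) of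
  every factor become polynomial after multiplication by a power of it.\<close>

definition xall :: "(nat \<Rightarrow> point) \<Rightarrow> complex" where "xall z = (\<Prod>i<g. coord_x (z i))"

lemma xall_nz: "z \<in> C0 \<Longrightarrow> xall z \<noteq> 0"
  using C0_point by (auto simp: xall_def)

lemma power_chartE:
  assumes "(V, S) \<in> Ag"
  obtains c where "V = (\<Pi>\<^sub>E i\<in>{..<g}. fst (c i))" "S = {(\<lambda>x. s (x i)) | i s. i < g \<and> s \<in> snd (c i)}"
    "\<And>i. i < g \<Longrightarrow> c i = (affine_curve f, {coord_x, coord_y}) \<or> c i = (U_inf, {coord_t, coord_s g})"
proof -
  obtain c where c: "V = (\<Pi>\<^sub>E i\<in>{..<g}. fst (c i))" "S = {(\<lambda>x. s (x i)) | i s. i < g \<and> s \<in> snd (c i)}"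
    "\<forall>i<g. c i \<in> curve_atlas g f"
    using assms unfolding power_atlas_def by blast
  show ?thesis by (rule that[OF c(1,2)]) (use c(3) in \<open>auto simp: curve_atlas_def\<close>)
qed

text \<open>All entries are affine with x nonzero, hence in the overlap of the two charts of the
  curve.\<close>

lemma C0_subset_chart:
  assumes "(V, S) \<in> Ag"
  shows "C0 \<subseteq> V"
proof
  fix z assume z: "z \<in> C0"
  from assms obtain c where c: "V = (\<Pi>\<^sub>E i\<in>{..<g}. fst (c i))"
    "\<And>i. i < g \<Longrightarrow> c i = (affine_curve f, {coord_x, coord_y}) \<or> c i = (U_inf, {coord_t, coord_s g})"
    by (rule power_chartE) blast
  have "z i \<in> fst (c i)" if "i < g" for i
    using c(2)[OF that] C0_point[OF z that] by (elim disjE) simp_all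
  moreover have "z \<in> extensional {..<g}" using C0_Ug[OF z] unfolding Ug_def PiE_def by blast
  ultimately show "z \<in> V" unfolding c(1) PiE_iff by simp
qed

lemma clear_denominators:
  assumes VS: "(V, S) \<in> Ag" and p: "p \<in> polyfuns S"
  shows "\<exists>q\<in>polyfuns Sg. \<exists>N. \<forall>z\<in>C0. p z * xall z ^ N = q z"
  using p
proof induction
  case (gen s')
  from VS obtain c where "S = {(\<lambda>x. s (x i)) | i s. i < g \<and> s \<in> snd (c i)}"
    "\<And>i. i < g \<Longrightarrow> c i = (affine_curve f, {coord_x, coord_y}) \<or> c i = (U_inf, {coord_t, coord_s g})"
    by (rule power_chartE) blast
  with gen obtain i s where s': "s' = (\<lambda>x. s (x i))" and i: "i < g"
    and s: "s = coord_x \<or> s = coord_y \<or> s = coord_t \<or> s = coord_s g" by fastforce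
  \<comment> \<open>The complementary product: multiplying 1/x of the i-th point by
    \<open>xall\<close> leaves the other abscissas.\<close>
  define o' where "o' z = (\<Prod>k\<in>{..<g} - {i}. coord_x (z k))" for z
  have o': "o' \<in> polyfuns Sg" unfolding o'_def by (auto intro!: polyfuns_prod polyfuns_xy)
  have xa: "xall z = coord_x (z i) * o' z" for z
    unfolding xall_def o'_def using i by (simp add: prod.remove)
  have pt: "\<exists>a b. z i = Affine a b \<and> a \<noteq> 0" if "z \<in> C0" for z
    using C0_point[OF that i] by (cases "z i") auto
  consider "s = coord_x" | "s = coord_y" | "s = coord_t" | "s = coord_s g" using s by blast
  then show ?case
  proof cases
    case 1
    then show ?thesis
      by (intro bexI[of _ "\<lambda>z. coord_x (z i)"] exI[of _ 0]) (auto simp: s' intro: polyfuns_xy i)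
  next
    case 2
    then show ?thesis
      by (intro bexI[of _ "\<lambda>z. coord_y (z i)"] exI[of _ 0]) (auto simp: s' intro: polyfuns_xy i)
  next
    case 3
    show ?thesis
    proof (intro bexI[of _ o'] exI[of _ 1] ballI o')
      fix z assume "z \<in> C0"
      from pt[OF this] show "s' z * xall z ^ 1 = o' z" unfolding s' 3 by (auto simp: xa)
    qed
  next
    case 4
    show ?thesis
    proof (intro bexI[of _ "\<lambda>z. coord_y (z i) * o' z ^ (g + 1)"] exI[of _ "g + 1"] ballI)
      fix z assume "z \<in> C0"
      from pt[OF this] show "s' z * xall z ^ (g + 1) = coord_y (z i) * o' z ^ (g + 1)"
        unfolding s' 4 by (auto simp: xa power_mult_distrib simp del: power_Suc)
    qed (intro polyfuns.mult polyfuns_power o' polyfuns_xy i)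
  qed
next
  case (const c)
  show ?case by (intro bexI[of _ "\<lambda>_. c"] exI[of _ 0]) (auto intro: polyfuns.const)
next
  case (add p p')
  then obtain q N q' N' where 1: "q \<in> polyfuns Sg" "\<forall>z\<in>C0. p z * xall z ^ N = q z"
    "q' \<in> polyfuns Sg" "\<forall>z\<in>C0. p' z * xall z ^ N' = q' z" by blast
  have x: "xall \<in> polyfuns Sg" unfolding xall_def by (auto intro!: polyfuns_prod polyfuns_xy)
  show ?case
  proof (intro bexI[of _ "\<lambda>z. q z * xall z ^ N' + q' z * xall z ^ N"] exI[of _ "N + N'"] ballI)
    fix z assume "z \<in> C0"
    then have "p z * xall z ^ N = q z" "p' z * xall z ^ N' = q' z" using 1 by auto
    moreover have "(p z + p' z) * (A * B) = p z * A * B + p' z * B * A" for A B by (simp add: algebra_simps)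
    ultimately show "(p z + p' z) * xall z ^ (N + N') = q z * xall z ^ N' + q' z * xall z ^ N"
      by (simp add: power_add)
  qed (intro polyfuns.add polyfuns.mult polyfuns_power 1 x)
next
  case (mult p p')
  then obtain q N q' N' where 1: "q \<in> polyfuns Sg" "\<forall>z\<in>C0. p z * xall z ^ N = q z"
    "q' \<in> polyfuns Sg" "\<forall>z\<in>C0. p' z * xall z ^ N' = q' z" by blast
  show ?case
  proof (intro bexI[of _ "\<lambda>z. q z * q' z"] exI[of _ "N + N'"] ballI)
    fix z assume "z \<in> C0"
    then have "p z * xall z ^ N = q z" "p' z * xall z ^ N' = q' z" using 1 by auto
    moreover have "(p z * p' z) * (A * B) = (p z * A) * (p' z * B)" for A B by simp
    ultimately show "(p z * p' z) * xall z ^ (N + N') = q z * q' z" by (simp only: power_add)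
  qed (intro polyfuns.mult 1)
qed

lemma xall_polyfuns: "xall \<in> polyfuns Sg"
  unfolding xall_def by (auto intro!: polyfuns_prod polyfuns_xy)

lemma regC_chart:
  assumes "(V, S) \<in> Ag" "p \<in> polyfuns S" "z0 \<in> C0"
  shows "regC p z0"
proof -
  obtain q N where q: "q \<in> polyfuns Sg" "\<forall>z\<in>C0. p z * xall z ^ N = q z"
    using clear_denominators[OF assms(1,2)] by blast
  have "regC (\<lambda>z. q z / xall z ^ N) z0"
    by (intro regC_divide assms regC_polyfuns q reg_at_power xall_polyfuns) (use xall_nz[OF assms(3)] in simp)
  then show ?thesis
  proof (rule reg_at_cong[OF _ open_C0 assms(3)])
    fix z assume "z \<in> C0"
    then show "p z = q z / xall z ^ N" using q(2) xall_nz[of z] by (simp add: eq_divide_eq)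
  qed
qed

lemma regular_regC:
  assumes "h \<in> regular (atlas_space Ag) W" "z0 \<in> W" "z0 \<in> C0"
  shows "regC h z0"
proof -
  obtain V' S where VS: "(V', S) \<in> Ag" "z0 \<in> V'" "reg_at Tg S h z0"
    using regular_atlas_reg_at[OF assms(1,2)] by blast
  obtain p q V where 1: "p \<in> polyfuns S" "q \<in> polyfuns S" "openin Tg V" "z0 \<in> V"
    "\<And>z. z \<in> V \<Longrightarrow> q z \<noteq> 0" "\<And>z. z \<in> V \<Longrightarrow> h z = p z / q z"
    using VS(3) by (rule reg_atE) blast
  have "regC (\<lambda>z. p z / q z) z0"
    by (intro regC_divide assms regC_chart[OF VS(1)] 1)
  then show ?thesis by (rule reg_at_cong[OF _ 1(3,4)]) (rule 1(6))
qed

text \<open>Within \<open>C0\<close> the principal sets of the affine chart form a base of the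
  topology: a generator from another chart becomes one after clearing denominators.\<close>

lemma principal_nbhd:
  assumes "openin Tg W" "z0 \<in> W" "z0 \<in> C0"
  shows "\<exists>q\<in>polyfuns Sg. q z0 \<noteq> 0 \<and> (\<forall>z\<in>C0. q z \<noteq> 0 \<longrightarrow> z \<in> W)"
proof -
  have "generate_topology_on {{x \<in> U. p x \<noteq> 0} | U S p. (U, S) \<in> Ag \<and> p \<in> polyfuns S} W"
    using assms(1) unfolding atlas_topology_def openin_topology_generated_by_iff .
  then show ?thesis using assms(2)
  proof induction
    case (Int a b)
    then obtain q q' where "q \<in> polyfuns Sg" "q z0 \<noteq> 0" "\<forall>z\<in>C0. q z \<noteq> 0 \<longrightarrow> z \<in> a"
      "q' \<in> polyfuns Sg" "q' z0 \<noteq> 0" "\<forall>z\<in>C0. q' z \<noteq> 0 \<longrightarrow> z \<in> b" by blast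
    then show ?case by (intro bexI[of _ "\<lambda>z. q z * q' z"]) (auto intro: polyfuns.mult)
  next
    case (UN K)
    then show ?case by blast
  next
    case (Basis s)
    then obtain V S p where 1: "s = {x \<in> V. p x \<noteq> 0}" "(V, S) \<in> Ag" "p \<in> polyfuns S" by blast
    obtain q N where q: "q \<in> polyfuns Sg" "\<forall>z\<in>C0. p z * xall z ^ N = q z"
      using clear_denominators[OF 1(2,3)] by blast
    have "q z0 \<noteq> 0" using q(2) assms(3) xall_nz[OF assms(3)] Basis.prems 1(1) by (metis (mono_tags, lifting) mem_Collect_eq mult_eq_0_iff power_eq_0_iff)
    moreover have "z \<in> s" if "z \<in> C0" "q z \<noteq> 0" for z
      using q(2) that C0_subset_chart[OF 1(2)] by (auto simp: 1(1))
    ultimately show ?case using q(1) by blast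
  qed simp
qed

text \<open>
  A regular function is a fraction near a point; multiplying by a function that vanishes outside
  the neighbourhood makes the identity hold everywhere.
\<close>

lemma global_fraction:
  assumes "openin Tg W" "z0 \<in> W" "z0 \<in> C0" "regC h z0"
  shows "\<exists>p\<in>polyfuns Sg. \<exists>q\<in>polyfuns Sg. q z0 \<noteq> 0 \<and>
    (\<forall>z\<in>C0. h z * q z = p z \<and> (q z \<noteq> 0 \<longrightarrow> z \<in> W))"
proof -
  obtain p q V where 1: "p \<in> polyfuns Sg" "q \<in> polyfuns Sg" "openin Tg V" "z0 \<in> V"
    "\<And>z. z \<in> V \<Longrightarrow> q z \<noteq> 0" "\<And>z. z \<in> V \<Longrightarrow> h z = p z / q z"
    using assms(4) by (rule reg_atE) blast
  have "openin Tg (W \<inter> V)" "z0 \<in> W \<inter> V" using assms 1 by auto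
  then obtain e where e: "e \<in> polyfuns Sg" "e z0 \<noteq> 0" "\<forall>z\<in>C0. e z \<noteq> 0 \<longrightarrow> z \<in> W \<inter> V"
    using principal_nbhd assms(3) by meson
  show ?thesis
  proof (rule bexI[of _ "\<lambda>z. p z * e z"], rule bexI[of _ "\<lambda>z. q z * e z"], intro conjI ballI)
    show "q z0 * e z0 \<noteq> 0" using 1 e by simp
    fix z assume z: "z \<in> C0"
    show "h z * (q z * e z) = p z * e z"
    proof (cases "e z = 0")
      case False
      then have "z \<in> V" using e z by auto
      then show ?thesis using 1 by simp
    qed simp
    show "q z * e z \<noteq> 0 \<longrightarrow> z \<in> W" using e z by auto
  qed (use 1 e in \<open>auto intro: polyfuns.mult\<close>)
qed

section \<open>Symmetric functions of the points\<close>

text \<open>\<open>dl g\<close> is the symmetric group on the indices; shorter lists occur in the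
  induction of \<open>desc_distinct_sum\<close>.\<close>

definition dl :: "nat \<Rightarrow> nat list set" where
  "dl k = {js. length js = k \<and> distinct js \<and> set js \<subseteq> {..<g}}"

definition act :: "nat list \<Rightarrow> (nat \<Rightarrow> point) \<Rightarrow> nat \<Rightarrow> point" where
  "act js z = (\<lambda>i\<in>{..<g}. z (js ! i))"

lemma finite_dl: "finite (dl k)"
proof (rule finite_subset)
  show "dl k \<subseteq> {js. set js \<subseteq> {..<g} \<and> length js = k}" by (auto simp: dl_def)
qed (simp add: finite_lists_length_eq)

lemma act_pts:
  assumes "js \<in> dl g"
  shows "pts (act js z) = pts z"
proof -
  have js: "length js = g" "distinct js" "set js \<subseteq> {..<g}" using assms by (auto simp: dl_def)
  have "set js = {..<g}" by (rule card_subset_eq) (use js distinct_card[of js] in auto)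
  then have "set js = set [0..<g]" by (simp add: atLeast0LessThan)
  then have "mset js = mset [0..<g]" using set_eq_iff_mset_eq_distinct[OF js(2) distinct_upt] by blast
  have "ps (act js z) = map z (map (\<lambda>i. js ! i) [0..<g])" by (simp add: act_def)
  also have "map (\<lambda>i. js ! i) [0..<g] = js" using js(1) by (metis map_nth)
  finally have "pts (act js z) = image_mset z (mset js)" by (simp only: pts_def mset_map)
  then show ?thesis using \<open>mset js = mset [0..<g]\<close> by (simp only: pts_def mset_map)
qed

text \<open>\<open>mum\<close> treats the points in order, so the invariance of \<open>beta\<close>
  is not visible in its formula; it follows from \<open>fibre_inj\<close>, as the multiset of points
  is unchanged.\<close>

lemma act_C0:
  assumes "js \<in> dl g" "z \<in> C0"
  shows "act js z \<in> C0" "beta (act js z) = beta z"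
proof -
  have js: "js ! i < g" if "i < g" for i using assms(1) that by (auto simp: dl_def dest: nth_mem)
  have "act js z \<in> Ug" using C0_point[OF assms(2) js] by (auto simp: act_def Ug_def)
  moreover have "coord_x (act js z i) \<noteq> 0" if "i < g" for i
    using C0_point[OF assms(2) js[OF that]] that by (simp add: act_def)
  ultimately show *: "act js z \<in> C0" using assms(2) by (simp add: C0_def act_pts[OF assms(1)])
  show "beta (act js z) = beta z"
    by (rule fibre_inj) (use beta_fibre[OF *] beta_fibre[OF assms(2)] act_pts[OF assms(1)] in auto)
qed

lemma act_id: "z \<in> C0 \<Longrightarrow> act [0..<g] z = z"
  using C0_Ug[of z] by (intro ext) (auto simp: act_def Ug_def PiE_iff extensional_def)

lemma id_dl: "[0..<g] \<in> dl g"
  by (auto simp: dl_def)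

section \<open>Functions that descend to polynomials on the fibre\<close>

definition desc :: "((nat \<Rightarrow> point) \<Rightarrow> complex) \<Rightarrow> bool" where
  "desc h \<longleftrightarrow> (\<exists>E\<in>polyfuns SF. \<forall>z\<in>C0. h z = E (beta z))"

lemma descI: "E \<in> polyfuns SF \<Longrightarrow> (\<And>z. z \<in> C0 \<Longrightarrow> h z = E (beta z)) \<Longrightarrow> desc h"
  unfolding desc_def by blast

lemma desc_cong: "desc h \<Longrightarrow> (\<And>z. z \<in> C0 \<Longrightarrow> k z = h z) \<Longrightarrow> desc k"
  unfolding desc_def by auto

lemma desc_const: "desc (\<lambda>_. c)"
  by (rule descI[OF polyfuns.const]) simp

lemma desc_add: "desc h \<Longrightarrow> desc k \<Longrightarrow> desc (\<lambda>z. h z + k z)"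
proof -
  assume "desc h" "desc k"
  then obtain E E' where "E \<in> polyfuns SF" "\<forall>z\<in>C0. h z = E (beta z)"
    "E' \<in> polyfuns SF" "\<forall>z\<in>C0. k z = E' (beta z)" unfolding desc_def by blast
  then show ?thesis by (intro descI[OF polyfuns.add[of E SF E']]) auto
qed

lemma desc_mult: "desc h \<Longrightarrow> desc k \<Longrightarrow> desc (\<lambda>z. h z * k z)"
proof -
  assume "desc h" "desc k"
  then obtain E E' where "E \<in> polyfuns SF" "\<forall>z\<in>C0. h z = E (beta z)"
    "E' \<in> polyfuns SF" "\<forall>z\<in>C0. k z = E' (beta z)" unfolding desc_def by blast
  then show ?thesis by (intro descI[OF polyfuns.mult[of E SF E']]) auto
qed

lemma desc_uminus: "desc h \<Longrightarrow> desc (\<lambda>z. - h z)"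
  using desc_mult[OF desc_const[of "-1"]] by force

lemma desc_diff: "desc h \<Longrightarrow> desc k \<Longrightarrow> desc (\<lambda>z. h z - k z)"
  using desc_add[OF _ desc_uminus] by force

lemma desc_sum: "(\<And>i. i \<in> I \<Longrightarrow> desc (h i)) \<Longrightarrow> desc (\<lambda>z. \<Sum>i\<in>I. h i z)"
  by (induction I rule: infinite_finite_induct) (auto intro: desc_const desc_add)

lemma xprod_prod: "xprod z = (\<Prod>j<g. [:- coord_x (z j), 1:])"
  unfolding xprod_def map_map o_def
  using prod.distinct_set_conv_list[of "[0..<g]" "\<lambda>j. [:- coord_x (z j), 1:]"] by (simp add: atLeast0LessThan)

lemma degree_prod_linear:
  assumes "finite I"
  shows "degree (\<Prod>k\<in>I. [:- c k, 1 :: complex:]) = card I" "lead_coeff (\<Prod>k\<in>I. [:- c k, 1 :: complex:]) = 1"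
proof -
  show "degree (\<Prod>k\<in>I. [:- c k, 1 :: complex:]) = card I"
    by (subst degree_prod_sum_eq) auto
  show "lead_coeff (\<Prod>k\<in>I. [:- c k, 1 :: complex:]) = 1"
    by (simp add: lead_coeff_prod)
qed

text \<open>\<open>xprod z\<close> is q divided by its leading coefficient. The leading coefficients
  of q and r multiply to that of f, so this inverse is a constant times a coordinate of the fibre,
  the coefficient of r at g + 1.\<close>

lemma desc_coeff_xprod: "desc (\<lambda>z. coeff (xprod z) i)"
proof (cases "i \<le> g")
  case True
  have "(\<lambda>(P, Q, R). coeff Q i) \<in> polyfuns SF" "(\<lambda>(P, Q, R). coeff R (g + 1)) \<in> polyfuns SF"
    by (rule polyfuns.gen, use True in \<open>auto simp: SF_def\<close>)+
  then have "(\<lambda>m. (\<lambda>(P, Q, R). coeff Q i) m * (\<lambda>(P, Q, R). coeff R (g + 1)) m * (1 / lead_coeff f)) \<in> polyfuns SF"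
    by (intro polyfuns.mult polyfuns.const)
  then show ?thesis
  proof (rule descI)
    fix z assume z: "z \<in> C0"
    obtain p q r where m: "beta z = (p, q, r)" by (cases "beta z")
    have q: "q = smult (2 / poly (xprod z) 0) (xprod z)" using m by (auto simp: beta_def Let_def split: prod.splits)
    have fd: "degree q = g" "degree r = g + 1" "q \<noteq> 0" "lead_coeff q * lead_coeff r = lead_coeff f"
      using fibre_degrees[of p q r] beta_fibre(1)[OF z] m by auto
    have "lead_coeff (xprod z) = 1" unfolding xprod_prod by (rule degree_prod_linear) simp
    then have lq: "lead_coeff q = 2 / poly (xprod z) 0" by (simp add: q lead_coeff_smult)
    have "coeff q i = 2 / poly (xprod z) 0 * coeff (xprod z) i" by (simp add: q)
    then have "coeff q i = lead_coeff q * coeff (xprod z) i" unfolding lq .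
    then have "coeff q i * coeff r (g + 1) = lead_coeff f * coeff (xprod z) i" using fd by (metis mult.assoc mult.commute)
    then show "coeff (xprod z) i = (\<lambda>(P, Q, R). coeff Q i) (beta z) * (\<lambda>(P, Q, R). coeff R (g + 1)) (beta z) * (1 / lead_coeff f)"
      using f_nz by (simp add: m)
  qed
next
  case False
  have "degree (xprod z) = g" for z unfolding xprod_prod by (simp add: degree_prod_linear)
  then have "coeff (xprod z) i = 0" for z using False by (simp add: coeff_eq_0)
  then show ?thesis by (simp add: desc_const)
qed

text \<open>
  Newton's identities in the form of a recursion for the sums
  \<open>\<Sum>\<^sub>j x\<^sub>j\<^sup>m c\<^sub>j\<close>, where \<open>c\<^sub>j\<close> is a coefficient of the product of the \<open>x - x\<^sub>k\<close> with \<open>k \<noteq> j\<close>.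
\<close>

lemma desc_power_sum: "desc (\<lambda>z. \<Sum>j<g. coord_x (z j) ^ m)"
proof -
  define cf where "cf z j = (\<Prod>k\<in>{..<g} - {j}. [:- coord_x (z k), 1:])" for z :: "nat \<Rightarrow> point" and j
  define T where "T m i z = (\<Sum>j<g. coord_x (z j) ^ m * coeff (cf z j) i)" for m i z
  have fac: "xprod z = [:- coord_x (z j), 1:] * cf z j" if "j < g" for z j
    unfolding xprod_prod cf_def using that by (simp add: prod.remove del: mult_pCons_left)
  have c0: "coeff (xprod z) 0 = - coord_x (z j) * coeff (cf z j) 0" if "j < g" for z j
    unfolding fac[OF that] coeff_linear_mult by simp
  have cS: "coeff (xprod z) (Suc i) = coeff (cf z j) i - coord_x (z j) * coeff (cf z j) (Suc i)" if "j < g" for z i j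
    unfolding fac[OF that] coeff_linear_mult by simp
  \<comment> \<open>Each cofactor is monic of degree g - 1, so the power sum is the entry i = g - 1
    of the recursion.\<close>
  have top: "coeff (cf z j) (g - 1) = 1" if "j < g" for z j
    using degree_prod_linear[of "{..<g} - {j}" "\<lambda>k. coord_x (z k)"] that by (simp add: cf_def)
  have s: "(\<Sum>j<g. coord_x (z j) ^ m) = T m (g - 1) z" for z m
    unfolding T_def by (rule sum.cong) (simp_all add: top del: One_nat_def)
  have "\<forall>i. desc (T m i)" for m
  proof (induction m)
    case 0
    have "T 0 i z = of_nat (Suc i) * coeff (xprod z) (Suc i)" for i z
    proof -
      \<comment> \<open>By the product rule the cofactors sum to the derivative, which starts the
        recursion at m = 0.\<close>
      have "pderiv (xprod z) = (\<Sum>j<g. cf z j)"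
        unfolding xprod_prod pderiv_prod cf_def by (simp add: pderiv_pCons)
      from arg_cong[OF this, of "\<lambda>p. coeff p i"] show ?thesis
        by (simp add: T_def coeff_pderiv coeff_sum)
    qed
    then have "T 0 i = (\<lambda>z. of_nat (Suc i) * coeff (xprod z) (Suc i))" for i by blast
    then show ?case by (simp only:) (intro allI desc_mult desc_const desc_coeff_xprod)
  next
    case (Suc m)
    have "desc (T (Suc m) i)" for i
    proof (cases i)
      case 0
      have "T (Suc m) 0 z = - coeff (xprod z) 0 * T m (g - 1) z" for z
        unfolding s[symmetric] sum_distrib_left unfolding T_def
        by (rule sum.cong) (use c0 in \<open>auto simp: algebra_simps\<close>)
      then have "T (Suc m) 0 = (\<lambda>z. - coeff (xprod z) 0 * T m (g - 1) z)" by blast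
      then show ?thesis unfolding 0 by (simp only:) (intro desc_mult desc_uminus desc_coeff_xprod Suc[rule_format])
    next
      case (Suc k)
      have "T (Suc m) (Suc k) z = T m k z - coeff (xprod z) (Suc k) * T m (g - 1) z" for z
        unfolding s[symmetric] sum_distrib_left unfolding T_def sum_subtractf[symmetric]
      proof (rule sum.cong[OF refl])
        fix j assume "j \<in> {..<g}"
        then have e: "coeff (xprod z) (Suc k) = coeff (cf z j) k - coord_x (z j) * coeff (cf z j) (Suc k)" using cS by simp
        show "coord_x (z j) ^ Suc m * coeff (cf z j) (Suc k)
          = coord_x (z j) ^ m * coeff (cf z j) k - coeff (xprod z) (Suc k) * coord_x (z j) ^ m"
          unfolding e by (simp add: algebra_simps)
      qed
      then have "T (Suc m) (Suc k) = (\<lambda>z. T m k z - coeff (xprod z) (Suc k) * T m (g - 1) z)" by blast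
      then show ?thesis unfolding Suc
        by (simp only:) (intro desc_diff desc_mult desc_coeff_xprod Suc.IH[rule_format])
    qed
    then show ?case by blast
  qed
  then show ?thesis unfolding s by blast
qed

text \<open>On the curve the function is A(x) + B(x) y, and y = p(x) at every entry of z, with p the
  first component of \<open>beta z\<close>. The sum thus combines power sums with coefficients of
  p.\<close>

lemma desc_trace:
  assumes "\<psi> \<in> polyfuns {coord_x, coord_y}"
  shows "desc (\<lambda>z. \<Sum>j<g. \<psi> (z j))"
proof -
  obtain A B where AB: "\<forall>P\<in>affine_curve f. \<psi> P = pxy A B P" using c1.polyfuns_normal_form[OF assms] by blast
  have cp: "desc (\<lambda>z. coeff (fst (beta z)) n)" if "n \<le> g" for n
  proof (rule descI)
    show "(\<lambda>(P, Q, R). coeff P n) \<in> polyfuns SF" by (rule polyfuns.gen) (use that in \<open>auto simp: SF_def\<close>)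
  qed (simp add: case_prod_unfold)
  let ?D = "\<lambda>z. (\<Sum>n\<le>degree A. coeff A n * (\<Sum>j<g. coord_x (z j) ^ n)) +
    (\<Sum>n\<le>degree B. coeff B n * (\<Sum>k\<le>g. coeff (fst (beta z)) k * (\<Sum>j<g. coord_x (z j) ^ (n + k))))"
  have "desc ?D"
    by (intro desc_add desc_sum desc_mult desc_const desc_power_sum cp) simp
  then show ?thesis
  proof (rule desc_cong)
    fix z assume z: "z \<in> C0"
    obtain p q r where m: "beta z = (p, q, r)" by (cases "beta z")
    have F: "(p, q, r) \<in> F" and d: "fdiv (p, q, r) = pts z" using beta_fibre[OF z] m by auto
    have dp: "degree p \<le> g" using F fibre_iff by blast
    have y: "coord_y (z j) = poly p (coord_x (z j))" if "j < g" for j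
    proof -
      have "z j \<in># fdiv (p, q, r)" unfolding d using that pts_mem by blast
      then show ?thesis by (auto simp: fdiv_def)
    qed
    have pp: "poly p a = (\<Sum>k\<le>g. coeff p k * a ^ k)" for a
      unfolding poly_altdef by (rule sum.mono_neutral_left) (use dp in \<open>auto simp: coeff_eq_0\<close>)
    have "\<psi> (z j) = (\<Sum>n\<le>degree A. coeff A n * coord_x (z j) ^ n) +
        (\<Sum>n\<le>degree B. coeff B n * (\<Sum>k\<le>g. coeff p k * coord_x (z j) ^ (n + k)))" if "j < g" for j
    proof -
      have "\<psi> (z j) = poly A (coord_x (z j)) + poly B (coord_x (z j)) * poly p (coord_x (z j))"
        using AB C0_point[OF z that] y[OF that] by simp
      also have "poly B (coord_x (z j)) * poly p (coord_x (z j))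
          = (\<Sum>n\<le>degree B. coeff B n * (\<Sum>k\<le>g. coeff p k * coord_x (z j) ^ (n + k)))"
        unfolding poly_altdef[of B] sum_distrib_right
        by (rule sum.cong) (simp_all add: pp sum_distrib_left power_add mult_ac)
      finally show ?thesis by (simp add: poly_altdef)
    qed
    then have "(\<Sum>j<g. \<psi> (z j)) = (\<Sum>j<g. (\<Sum>n\<le>degree A. coeff A n * coord_x (z j) ^ n) +
        (\<Sum>n\<le>degree B. coeff B n * (\<Sum>k\<le>g. coeff p k * coord_x (z j) ^ (n + k))))" by simp
    also have "\<dots> = ?D z"
    proof -
      have "(\<Sum>j<g. \<Sum>n\<le>degree A. coeff A n * coord_x (z j) ^ n)
          = (\<Sum>n\<le>degree A. coeff A n * (\<Sum>j<g. coord_x (z j) ^ n))"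
        unfolding sum_distrib_left by (rule sum.swap)
      moreover have "(\<Sum>j<g. \<Sum>n\<le>degree B. coeff B n * (\<Sum>k\<le>g. coeff p k * coord_x (z j) ^ (n + k)))
          = (\<Sum>n\<le>degree B. coeff B n * (\<Sum>j<g. \<Sum>k\<le>g. coeff p k * coord_x (z j) ^ (n + k)))"
        unfolding sum_distrib_left[of _ _ "{..<g}"] by (rule sum.swap)
      moreover have "(\<Sum>j<g. \<Sum>k\<le>g. coeff p k * coord_x (z j) ^ (n + k))
          = (\<Sum>k\<le>g. coeff p k * (\<Sum>j<g. coord_x (z j) ^ (n + k)))" for n
        unfolding sum_distrib_left by (rule sum.swap)
      ultimately show ?thesis by (simp add: m sum.distrib)
    qed
    finally show "(\<Sum>j<g. \<psi> (z j)) = ?D z" .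
  qed
qed

lemma dl_Suc: "dl (Suc k) = (\<lambda>(js, j). j # js) ` (SIGMA js:dl k. {..<g} - set js)"
proof (intro equalityI subsetI)
  fix l assume "l \<in> dl (Suc k)"
  then obtain j js where "l = j # js" "(js, j) \<in> (SIGMA js:dl k. {..<g} - set js)"
    by (cases l) (auto simp: dl_def)
  then show "l \<in> (\<lambda>(js, j). j # js) ` (SIGMA js:dl k. {..<g} - set js)" by force
qed (auto simp: dl_def)

text \<open>
  The induction step removes the condition that the new index differs from the others, and corrects
  for it by multiplying one of the other factors.
\<close>

lemma desc_distinct_sum:
  assumes "\<And>i. i < k \<Longrightarrow> \<psi> i \<in> polyfuns {coord_x, coord_y}"
  shows "desc (\<lambda>z. \<Sum>js\<in>dl k. \<Prod>i<k. \<psi> i (z (js ! i)))"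
  using assms
proof (induction k arbitrary: \<psi>)
  case 0
  have "dl 0 = {[]}" by (auto simp: dl_def)
  then show ?case by (simp add: desc_const)
next
  case (Suc k)
  let ?\<psi> = "\<lambda>i. \<psi> (Suc i)"
  let ?\<chi> = "\<lambda>l i. if i = l then (\<lambda>P. ?\<psi> i P * \<psi> 0 P) else ?\<psi> i"
  have eq: "(\<Sum>js\<in>dl (Suc k). \<Prod>i<Suc k. \<psi> i (z (js ! i)))
     = (\<Sum>j<g. \<psi> 0 (z j)) * (\<Sum>js\<in>dl k. \<Prod>i<k. ?\<psi> i (z (js ! i)))
       - (\<Sum>l<k. \<Sum>js\<in>dl k. \<Prod>i<k. ?\<chi> l i (z (js ! i)))" for z
  proof -
    have "(\<Sum>js\<in>dl (Suc k). \<Prod>i<Suc k. \<psi> i (z (js ! i)))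
        = (\<Sum>(js, j)\<in>(SIGMA js:dl k. {..<g} - set js). \<Prod>i<Suc k. \<psi> i (z ((j # js) ! i)))"
      unfolding dl_Suc by (subst sum.reindex) (auto simp: inj_on_def case_prod_unfold)
    also have "\<dots> = (\<Sum>js\<in>dl k. \<Sum>j\<in>{..<g} - set js. \<Prod>i<Suc k. \<psi> i (z ((j # js) ! i)))"
      by (rule sum.Sigma[symmetric]) (auto simp: finite_dl)
    also have "\<dots> = (\<Sum>js\<in>dl k. (\<Sum>j<g. \<psi> 0 (z j)) * (\<Prod>i<k. ?\<psi> i (z (js ! i)))
        - (\<Sum>l<k. \<Prod>i<k. ?\<chi> l i (z (js ! i))))"
    proof (rule sum.cong[OF refl])
      fix js assume js: "js \<in> dl k"
      then have len: "length js = k" and dist: "distinct js" and sub: "set js \<subseteq> {..<g}" by (auto simp: dl_def)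
      have "(\<Sum>j\<in>{..<g} - set js. \<psi> 0 (z j)) = (\<Sum>j<g. \<psi> 0 (z j)) - (\<Sum>j\<in>set js. \<psi> 0 (z j))"
        by (rule sum_diff) (use sub in auto)
      also have "(\<Sum>j\<in>set js. \<psi> 0 (z j)) = (\<Sum>l<k. \<psi> 0 (z (js ! l)))"
        by (rule sum.reindex_bij_betw[symmetric]) (use bij_betw_nth[OF dist, of "{..<k}" "set js"] len in auto)
      finally have s: "(\<Sum>j\<in>{..<g} - set js. \<psi> 0 (z j)) = (\<Sum>j<g. \<psi> 0 (z j)) - (\<Sum>l<k. \<psi> 0 (z (js ! l)))" .
      have p: "\<psi> 0 (z (js ! l)) * (\<Prod>i<k. ?\<psi> i (z (js ! i))) = (\<Prod>i<k. ?\<chi> l i (z (js ! i)))" if l: "l < k" for l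
      proof -
        have "(\<Prod>i<k. ?\<chi> l i (z (js ! i))) = ?\<chi> l l (z (js ! l)) * (\<Prod>i\<in>{..<k} - {l}. ?\<chi> l i (z (js ! i)))"
          using l by (subst prod.remove[of _ l]) auto
        also have "(\<Prod>i\<in>{..<k} - {l}. ?\<chi> l i (z (js ! i))) = (\<Prod>i\<in>{..<k} - {l}. ?\<psi> i (z (js ! i)))"
          by (rule prod.cong) auto
        also have "?\<chi> l l (z (js ! l)) * (\<Prod>i\<in>{..<k} - {l}. ?\<psi> i (z (js ! i)))
            = \<psi> 0 (z (js ! l)) * (?\<psi> l (z (js ! l)) * (\<Prod>i\<in>{..<k} - {l}. ?\<psi> i (z (js ! i))))"
          by (simp add: mult_ac)
        also have "?\<psi> l (z (js ! l)) * (\<Prod>i\<in>{..<k} - {l}. ?\<psi> i (z (js ! i))) = (\<Prod>i<k. ?\<psi> i (z (js ! i)))"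
          using l by (subst prod.remove[of "{..<k}" l]) auto
        finally show ?thesis ..
      qed
      have "(\<Sum>j\<in>{..<g} - set js. \<Prod>i<Suc k. \<psi> i (z ((j # js) ! i)))
          = (\<Sum>j\<in>{..<g} - set js. \<psi> 0 (z j)) * (\<Prod>i<k. ?\<psi> i (z (js ! i)))"
        unfolding prod.lessThan_Suc_shift sum_distrib_right by simp
      also have "\<dots> = (\<Sum>j<g. \<psi> 0 (z j)) * (\<Prod>i<k. ?\<psi> i (z (js ! i)))
          - (\<Sum>l<k. \<psi> 0 (z (js ! l)) * (\<Prod>i<k. ?\<psi> i (z (js ! i))))"
        unfolding s left_diff_distrib sum_distrib_right ..
      also have "(\<Sum>l<k. \<psi> 0 (z (js ! l)) * (\<Prod>i<k. ?\<psi> i (z (js ! i)))) = (\<Sum>l<k. \<Prod>i<k. ?\<chi> l i (z (js ! i)))"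
        by (rule sum.cong[OF refl], rule p) simp
      finally show "(\<Sum>j\<in>{..<g} - set js. \<Prod>i<Suc k. \<psi> i (z ((j # js) ! i)))
          = (\<Sum>j<g. \<psi> 0 (z j)) * (\<Prod>i<k. ?\<psi> i (z (js ! i))) - (\<Sum>l<k. \<Prod>i<k. ?\<chi> l i (z (js ! i)))" .
    qed
    also have "\<dots> = (\<Sum>j<g. \<psi> 0 (z j)) * (\<Sum>js\<in>dl k. \<Prod>i<k. ?\<psi> i (z (js ! i)))
       - (\<Sum>l<k. \<Sum>js\<in>dl k. \<Prod>i<k. ?\<chi> l i (z (js ! i)))"
      unfolding sum_subtractf sum_distrib_left by (subst sum.swap) simp
    finally show ?thesis .
  qed
  have "\<psi> 0 \<in> polyfuns {coord_x, coord_y}" by (rule Suc.prems) simp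
  moreover have "desc (\<lambda>z. \<Sum>js\<in>dl k. \<Prod>i<k. ?\<psi> i (z (js ! i)))" by (rule Suc.IH) (simp add: Suc.prems)
  moreover have "desc (\<lambda>z. \<Sum>js\<in>dl k. \<Prod>i<k. ?\<chi> l i (z (js ! i)))" for l
    by (rule Suc.IH) (auto intro!: polyfuns.mult Suc.prems)
  ultimately show ?case
    unfolding eq by (intro desc_diff[OF desc_mult[OF desc_trace] desc_sum])
qed

section \<open>Symmetrisation of polynomial functions on the product\<close>

inductive_set tensors :: "((nat \<Rightarrow> point) \<Rightarrow> complex) set" where
  pure: "(\<And>i. i < g \<Longrightarrow> \<psi> i \<in> polyfuns {coord_x, coord_y}) \<Longrightarrow> (\<lambda>z. \<Prod>i<g. \<psi> i (z i)) \<in> tensors"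
| plus: "p \<in> tensors \<Longrightarrow> q \<in> tensors \<Longrightarrow> (\<lambda>z. p z + q z) \<in> tensors"

lemma tensors_mult:
  assumes "p \<in> tensors" "q \<in> tensors"
  shows "(\<lambda>z. p z * q z) \<in> tensors"
  using assms(1)
proof induction
  case (pure \<psi>)
  show ?case using assms(2)
  proof induction
    case (pure \<psi>')
    have "(\<lambda>z. \<Prod>i<g. (\<lambda>P. \<psi> i P * \<psi>' i P) (z i)) \<in> tensors"
      by (rule tensors.pure) (intro polyfuns.mult pure \<open>\<And>i. i < g \<Longrightarrow> \<psi> i \<in> polyfuns {coord_x, coord_y}\<close>)
    then show ?case by (simp add: prod.distrib)
  next
    case (plus p q)
    then show ?case using tensors.plus by (simp add: distrib_left)
  qed
next
  case (plus p p')
  then show ?case using tensors.plus by (simp add: distrib_right)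
qed

text \<open>A coordinate of one entry is a pure product with factors 1 elsewhere; a scalar is put
  into the factor of index 0, which exists because g is positive.\<close>

lemma polyfuns_tensors:
  assumes "p \<in> polyfuns Sg"
  shows "p \<in> tensors"
  using assms
proof induction
  case (gen s')
  then obtain i s where s: "s' = (\<lambda>x. s (x i))" "i < g" "s \<in> {coord_x, coord_y}" by (auto simp: Sg_def)
  have "(\<lambda>z. \<Prod>k<g. (if k = i then s else (\<lambda>_. 1)) (z k)) \<in> tensors"
    by (rule tensors.pure) (use s in \<open>auto intro: polyfuns.gen polyfuns.const\<close>)
  moreover have "(\<Prod>k<g. (if k = i then s else (\<lambda>_. 1)) (z k)) = s' z" for z :: "nat \<Rightarrow> point"
    unfolding s(1) using s(2) by (subst prod.remove[of _ i]) auto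
  ultimately show ?case by simp
next
  case (const c)
  have "(\<lambda>z. \<Prod>k<g. (\<lambda>_. if k = 0 then c else 1) (z k)) \<in> tensors"
    by (rule tensors.pure) (rule polyfuns.const)
  moreover have "(\<Prod>k<g. if k = 0 then c else 1) = c" using g_pos by (subst prod.remove[of _ 0]) auto
  ultimately show ?case by simp
qed (auto intro: tensors.plus tensors_mult)

text \<open>For a pure product the sum over permutations is the sum over distinct indices with k =
  g; the general case follows by additivity.\<close>

lemma desc_symmetrized:
  assumes "p \<in> polyfuns Sg"
  shows "desc (\<lambda>z. \<Sum>js\<in>dl g. p (act js z))"
  using polyfuns_tensors[OF assms]
proof induction
  case (pure \<psi>)
  have "(\<Sum>js\<in>dl g. \<Prod>i<g. \<psi> i (act js z i)) = (\<Sum>js\<in>dl g. \<Prod>i<g. \<psi> i (z (js ! i)))" for z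
    by (simp add: act_def)
  then show ?case using desc_distinct_sum[OF pure] by simp
next
  case (plus p q)
  then show ?case using desc_add by (simp add: sum.distrib)
qed

section \<open>The isomorphism\<close>

text \<open>Each z in Z differs from z0 in a coordinate e of some entry; the product of the
  functions e - e(z) has the required zeros.\<close>

lemma separating_function:
  assumes "finite Z" "Z \<subseteq> Ug" "z0 \<in> Ug" "z0 \<notin> Z"
  shows "\<exists>d\<in>polyfuns Sg. d z0 \<noteq> 0 \<and> (\<forall>z\<in>Z. d z = 0)"
  using assms(1,2,4)
proof (induction Z)
  case empty
  show ?case by (intro bexI[of _ "\<lambda>_. 1"]) (auto intro: polyfuns.const)
next
  case (insert z Z)
  then obtain d where d: "d \<in> polyfuns Sg" "d z0 \<noteq> 0" "\<forall>z\<in>Z. d z = 0" by auto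
  have "z \<noteq> z0" "z \<in> Ug" using insert.prems by auto
  then obtain i where i: "i < g" "z i \<noteq> z0 i"
    using assms(3) unfolding Ug_def by (metis PiE_ext lessThan_iff)
  have "z i \<in> affine_curve f" "z0 i \<in> affine_curve f" using Ug_point \<open>z \<in> Ug\<close> assms(3) i by auto
  then have "coord_x (z i) \<noteq> coord_x (z0 i) \<or> coord_y (z i) \<noteq> coord_y (z0 i)"
    using i(2) affine_coords by metis
  then obtain e where e: "e \<in> polyfuns Sg" "e z0 \<noteq> e z"
    using polyfuns_xy[OF i(1)] by metis
  show ?case
    by (intro bexI[of _ "\<lambda>w. d w * (e w - e z)"])
      (use d e in \<open>auto intro!: polyfuns.mult polyfuns_diff polyfuns.const\<close>)
qed

text \<open>Symmetrising h q = p directly could make the denominator cancel at z0. Multiplying first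
  by d, which vanishes on the rest of the orbit of z0, leaves at z0 only the terms of the
  stabiliser, and these are all equal.\<close>

lemma descend_fraction:
  assumes W: "openin Tg W" "\<And>js z. js \<in> dl g \<Longrightarrow> z \<in> C0 \<Longrightarrow> act js z \<in> W \<Longrightarrow> z \<in> W"
    and h: "\<And>js z. js \<in> dl g \<Longrightarrow> z \<in> C0 \<Longrightarrow> h (act js z) = h z"
    and z0: "z0 \<in> W" "z0 \<in> C0" "regC h z0"
  shows "\<exists>p\<in>polyfuns SF. \<exists>q\<in>polyfuns SF. q (beta z0) \<noteq> 0 \<and>
    (\<forall>z\<in>C0. h z * q (beta z) = p (beta z) \<and> (q (beta z) \<noteq> 0 \<longrightarrow> z \<in> W))"
proof -
  obtain p q where pq: "p \<in> polyfuns Sg" "q \<in> polyfuns Sg" "q z0 \<noteq> 0"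
    "\<And>z. z \<in> C0 \<Longrightarrow> h z * q z = p z" "\<And>z. z \<in> C0 \<Longrightarrow> q z \<noteq> 0 \<Longrightarrow> z \<in> W"
    using global_fraction[OF W(1) z0] by blast
  let ?Z = "(\<lambda>js. act js z0) ` dl g - {z0}"
  have "?Z \<subseteq> Ug" using act_C0(1)[OF _ z0(2)] C0_Ug by blast
  then obtain d where d: "d \<in> polyfuns Sg" "d z0 \<noteq> 0" "\<forall>z\<in>?Z. d z = 0"
    using separating_function[of ?Z z0] C0_Ug[OF z0(2)] finite_dl by auto
  obtain P where P: "P \<in> polyfuns SF" "\<And>z. z \<in> C0 \<Longrightarrow> (\<Sum>js\<in>dl g. p (act js z) * d (act js z)) = P (beta z)"
    using desc_symmetrized[OF polyfuns.mult[OF pq(1) d(1)]] unfolding desc_def by blast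
  obtain Q where Q: "Q \<in> polyfuns SF" "\<And>z. z \<in> C0 \<Longrightarrow> (\<Sum>js\<in>dl g. q (act js z) * d (act js z)) = Q (beta z)"
    using desc_symmetrized[OF polyfuns.mult[OF pq(2) d(1)]] unfolding desc_def by blast
  \<comment> \<open>The stabiliser of z0, nontrivial when entries of z0 coincide; its order is
    nonzero in the complex numbers.\<close>
  let ?G = "{js \<in> dl g. act js z0 = z0}"
  have "(\<Sum>js\<in>dl g. q (act js z0) * d (act js z0)) = (\<Sum>js\<in>?G. q (act js z0) * d (act js z0))"
    by (rule sum.mono_neutral_right[OF finite_dl]) (use d(3) in auto)
  also have "\<dots> = (\<Sum>js\<in>?G. q z0 * d z0)" by (rule sum.cong) auto
  also have "\<dots> = of_nat (card ?G) * (q z0 * d z0)" by simp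
  finally have "Q (beta z0) = of_nat (card ?G) * (q z0 * d z0)" using Q(2)[OF z0(2)] by simp
  moreover have "card ?G \<noteq> 0" using id_dl act_id[OF z0(2)] finite_dl by (auto simp: card_eq_0_iff)
  ultimately have "Q (beta z0) \<noteq> 0" using pq(3) d(2) by simp
  moreover have "h z * Q (beta z) = P (beta z) \<and> (Q (beta z) \<noteq> 0 \<longrightarrow> z \<in> W)" if z: "z \<in> C0" for z
  proof
    have "h z * (\<Sum>js\<in>dl g. q (act js z) * d (act js z)) = (\<Sum>js\<in>dl g. p (act js z) * d (act js z))"
      unfolding sum_distrib_left
    proof (rule sum.cong[OF refl])
      fix js assume js: "js \<in> dl g"
      have "h z * q (act js z) = p (act js z)" using pq(4)[OF act_C0(1)[OF js z]] h[OF js z] by simp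
      then show "h z * (q (act js z) * d (act js z)) = p (act js z) * d (act js z)" by (simp add: mult.assoc[symmetric])
    qed
    then show "h z * Q (beta z) = P (beta z)" using P(2)[OF z] Q(2)[OF z] by simp
    show "Q (beta z) \<noteq> 0 \<longrightarrow> z \<in> W"
    proof
      \<comment> \<open>Some summand is nonzero and places a permutation of z in \<open>W\<close>;
        the invariance of \<open>W\<close> gives z itself.\<close>
      assume "Q (beta z) \<noteq> 0"
      then obtain js where js: "js \<in> dl g" "q (act js z) \<noteq> 0"
        unfolding Q(2)[OF z, symmetric] by (metis (no_types, lifting) mult_eq_0_iff sum.neutral)
      then show "z \<in> W" using pq(5)[OF act_C0(1)[OF js(1) z]] W(2)[OF js(1) z] by blast
    qed
  qed
  ultimately show ?thesis using P(1) Q(1) by blast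
qed

section \<open>The quotient structure of the Jacobian\<close>

abbreviation "AJ \<equiv> abel_jacobi g f"
abbreviation "JV \<equiv> Jac_variety g f"

lemma AJ_pts: "AJ P = cls (dv (pts P))"
  unfolding pts_def by (rule abel_jacobi_dv)

lemma pts_C: "P \<in> Cg \<Longrightarrow> set_mset (pts P) \<subseteq> C"
  by (auto simp: pts_mem PiE_iff)

lemma AJ_carrier: "P \<in> Cg \<Longrightarrow> AJ P \<in> carrier J"
  unfolding AJ_pts carrier_J using dv_carrier pts_C by blast

lemma openin_JV: "openin (zariski JV) V \<longleftrightarrow> V \<subseteq> carrier J \<and> openin Tg {P \<in> Cg. AJ P \<in> V}"
  unfolding Jac_variety_def openin_quotient_space by (simp add: topspace_Tg)

lemma regular_JV: "h \<in> regular JV V \<longleftrightarrow> h \<circ> AJ \<in> regular (atlas_space Ag) {P \<in> Cg. AJ P \<in> V}"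
  unfolding Jac_variety_def by (simp add: quotient_space_def topspace_Tg)

lemma topspace_JV: "topspace (zariski JV) = carrier J"
proof
  show "topspace (zariski JV) \<subseteq> carrier J" using openin_JV openin_topspace by blast
  have "{P \<in> Cg. AJ P \<in> carrier J} = topspace Tg" using AJ_carrier topspace_Tg by blast
  then have "openin (zariski JV) (carrier J)" unfolding openin_JV by simp
  then show "carrier J \<subseteq> topspace (zariski JV)" by (rule openin_subset)
qed

lemma AJ_preimage: "{P \<in> Cg. AJ P \<in> theta_compl} = C0"
proof -
  have "P \<in> C0 \<longleftrightarrow> AJ P \<in> theta_compl" if P: "P \<in> Cg" for P
  proof -
    have "AJ P \<in> theta_compl \<longleftrightarrow> reduced (pts P) \<and> (\<forall>i<g. coord_x (P i) \<noteq> 0)"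
      unfolding AJ_pts cls_dv_in_compl[OF size_pts pts_C[OF P]] by (metis pts_mem)
    moreover have "P \<in> Ug" if "reduced (pts P)"
    proof -
      have "P i \<in> affine_curve f" if "i < g" for i
        using \<open>reduced (pts P)\<close> that pts_mem[of "P i" P] unfolding reduced_def by blast
      then show ?thesis using P by (auto simp: Ug_def PiE_iff)
    qed
    ultimately show ?thesis by (auto simp: C0_def)
  qed
  then show ?thesis using C0_Ug Ug_Cg by blast
qed

lemma open_compl: "openin (zariski JV) theta_compl"
  unfolding openin_JV AJ_preimage using open_C0 by (auto simp: theta_compl_def)

section \<open>The two mutually inverse morphisms\<close>

definition phi :: "triplet \<Rightarrow> (point \<Rightarrow>\<^sub>0 int) set" where "phi m = cls (dv (fdiv m))"

lemma phi_beta: "P \<in> C0 \<Longrightarrow> phi (beta P) = AJ P"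
  by (simp add: phi_def AJ_pts beta_fibre)

lemma phi_compl: "m \<in> F \<Longrightarrow> phi m \<in> theta_compl"
  unfolding phi_def using cls_dv_in_compl[of "fdiv m"] fdiv_props by blast

lemma inj_phi: "inj_on phi F"
proof (rule inj_onI)
  fix m m' assume m: "m \<in> F" "m' \<in> F" and "phi m = phi m'"
  then have "dv (fdiv m) - dv (fdiv m') \<in> PD" by (simp add: phi_def cls_eq_iff)
  then have "fdiv m = fdiv m'" using fdiv_props m by (intro reduced_unique) auto
  then show "m = m'" using fibre_inj m by blast
qed

lemma compl_AJ:
  assumes "c \<in> theta_compl"
  obtains P where "P \<in> C0" "AJ P = c"
proof -
  have "c \<in> carrier J" using assms by (simp add: theta_compl_def)
  then obtain D where D: "D \<in> carrier D0" "c = cls D" using carrier_J by auto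
  obtain Z where Z: "size Z = g" "set_mset Z \<subseteq> C" "D - dv Z \<in> PD" using degree_zero_effective[OF D(1)] by blast
  then have c: "c = cls (dv Z)" using D cls_eq_iff by blast
  obtain P0 where P0: "Z = pts P0" using ex_map_upt[of Z] Z(1) unfolding pts_def by metis
  let ?P = "restrict P0 {..<g}"
  have "ps ?P = ps P0" by simp
  then have eq: "pts ?P = pts P0" by (simp only: pts_def)
  have "P0 i \<in> C" if "i < g" for i using Z(2) that pts_mem[of "P0 i" P0] unfolding P0 by blast
  then have "?P \<in> Cg" by auto
  moreover have "AJ ?P = c" unfolding AJ_pts eq c P0 ..
  ultimately show ?thesis using that AJ_preimage assms by blast
qed

text \<open>An inverse of \<open>phi\<close> obtained by choice. Its regularity rests on
  \<open>psi_AJ\<close>: after the Abel-Jacobi map it is the explicit \<open>beta\<close>, and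
  functions on a quotient are tested after the quotient map.\<close>

definition psi :: "(point \<Rightarrow>\<^sub>0 int) set \<Rightarrow> triplet" where "psi c = (SOME m. m \<in> F \<and> phi m = c)"

lemma psi:
  assumes "c \<in> theta_compl"
  shows "psi c \<in> F" "phi (psi c) = c"
proof -
  obtain P where "P \<in> C0" "AJ P = c" using compl_AJ[OF assms] .
  then have "beta P \<in> F \<and> phi (beta P) = c" using beta_fibre phi_beta by blast
  then have "psi c \<in> F \<and> phi (psi c) = c" unfolding psi_def by (rule someI)
  then show "psi c \<in> F" "phi (psi c) = c" by auto
qed

lemma psi_phi: "m \<in> F \<Longrightarrow> psi (phi m) = m"
  using inj_phi psi phi_compl by (meson inj_onD)

lemma psi_AJ: "P \<in> C0 \<Longrightarrow> psi (AJ P) = beta P"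
  using psi_phi[OF beta_fibre(1)] phi_beta by simp

lemma zariski_compl: "zariski (open_subspace JV theta_compl) = subtopology (zariski JV) theta_compl"
  and regular_compl: "regular (open_subspace JV theta_compl) = regular JV"
  by (simp_all add: open_subspace_def)

lemma topspace_compl: "topspace (subtopology (zariski JV) theta_compl) = theta_compl"
  using openin_subset[OF open_compl] by (auto simp: topspace_JV)

lemma compl_preimage:
  "{P \<in> Cg. AJ P \<in> {c \<in> theta_compl. psi c \<in> V}} = {P \<in> C0. beta P \<in> V}"
proof -
  have "P \<in> Cg \<and> AJ P \<in> theta_compl \<longleftrightarrow> P \<in> C0" for P using AJ_preimage by blast
  then have "P \<in> Cg \<and> AJ P \<in> theta_compl \<and> psi (AJ P) \<in> V \<longleftrightarrow> P \<in> C0 \<and> beta P \<in> V" for P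
    by (metis psi_AJ)
  then show ?thesis by blast
qed

lemma psi_morphism: "fspace_morphism (open_subspace JV theta_compl) (mu_fibre_variety g f) psi"
  unfolding fspace_morphism_def zariski_compl regular_compl fibre_variety zariski_atlas_space topspace_compl
proof (intro conjI allI impI)
  have "openin (zariski JV) {c \<in> theta_compl. psi c \<in> V}" if "openin TF V" for V
    unfolding openin_JV compl_preimage using open_beta_preimage[OF that] by (auto simp: theta_compl_def)
  then show "continuous_map (subtopology (zariski JV) theta_compl) TF psi"
    unfolding continuous_map_def topspace_compl topspace_TF using psi(1) open_compl
    by (auto simp: openin_open_subtopology)
  fix V h assume Vh: "openin TF V \<and> h \<in> regular (atlas_space {(F, SF)}) V"
  have "(h \<circ> psi) \<circ> AJ \<in> regular (atlas_space Ag) {P \<in> C0. beta P \<in> V}"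
  proof (rule regular_atlasI[OF open_beta_preimage])
    show "openin TF V" using Vh by blast
    fix P assume P: "P \<in> {P \<in> C0. beta P \<in> V}"
    have "regC (h \<circ> beta) P"
      by (rule regular_regC[OF regular_beta P]) (use Vh P in auto)
    \<comment> \<open>The composite is known to agree with \<open>h \<circ> beta\<close> on
      \<open>C0\<close>; as \<open>C0\<close> is open, this settles regularity at its
      points.\<close>
    then have "regC ((h \<circ> psi) \<circ> AJ) P"
      by (rule reg_at_cong[OF _ open_C0]) (use P in \<open>auto simp: psi_AJ\<close>)
    then show "\<exists>(U, S)\<in>Ag. P \<in> U \<and> reg_at Tg S ((h \<circ> psi) \<circ> AJ) P"
      using power_chart C0_Ug P by blast
  qed
  then show "h \<circ> psi \<in> regular JV {c \<in> theta_compl. psi c \<in> V}"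
    unfolding regular_JV compl_preimage .
qed

lemma AJ_act: "js \<in> dl g \<Longrightarrow> AJ (act js z) = AJ z"
  by (simp add: AJ_pts act_pts)

text \<open>Serves both halves of the morphism property: the clause on q gives openness of
  preimages, the equation gives regularity of composites.\<close>

lemma phi_local:
  assumes V: "openin (zariski JV) V" "m0 \<in> F" "phi m0 \<in> V"
    and h: "\<And>P. P \<in> C0 \<Longrightarrow> AJ P \<in> V \<Longrightarrow> regC (\<lambda>P. h (AJ P)) P"
  shows "\<exists>p\<in>polyfuns SF. \<exists>q\<in>polyfuns SF. q m0 \<noteq> 0 \<and>
    (\<forall>m\<in>F. h (phi m) * q m = p m \<and> (q m \<noteq> 0 \<longrightarrow> phi m \<in> V))"
proof -
  obtain P0 where P0: "P0 \<in> C0" "beta P0 = m0" using fibre_eq_beta[OF V(2)] .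
  let ?W = "{P \<in> Cg. AJ P \<in> V}"
  have W: "openin Tg ?W" using V(1) openin_JV by blast
  have C0C: "C0 \<subseteq> Cg" using C0_Ug Ug_Cg by blast
  have P0W: "P0 \<in> ?W" "AJ P0 \<in> V" using P0 V(3) C0C phi_beta[of P0] by auto
  have "\<exists>p\<in>polyfuns SF. \<exists>q\<in>polyfuns SF. q (beta P0) \<noteq> 0 \<and>
    (\<forall>z\<in>C0. h (AJ z) * q (beta z) = p (beta z) \<and> (q (beta z) \<noteq> 0 \<longrightarrow> z \<in> ?W))"
    by (rule descend_fraction[OF W _ _ P0W(1) P0(1) h[OF P0(1) P0W(2)]]) (use AJ_act C0C in auto)
  then obtain p q where pq: "p \<in> polyfuns SF" "q \<in> polyfuns SF" "q m0 \<noteq> 0"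
    "\<And>z. z \<in> C0 \<Longrightarrow> h (AJ z) * q (beta z) = p (beta z)" "\<And>z. z \<in> C0 \<Longrightarrow> q (beta z) \<noteq> 0 \<Longrightarrow> z \<in> ?W"
    unfolding P0(2) by blast
  have "h (phi m) * q m = p m \<and> (q m \<noteq> 0 \<longrightarrow> phi m \<in> V)" if m: "m \<in> F" for m
  proof -
    obtain P where P: "P \<in> C0" "beta P = m" using fibre_eq_beta[OF m] .
    then show ?thesis using pq(4)[OF P(1)] pq(5)[OF P(1)] phi_beta[OF P(1)] by auto
  qed
  then show ?thesis using pq(1-3) by blast
qed

lemma open_fibre_basic: "p \<in> polyfuns SF \<Longrightarrow> openin TF {m \<in> F. p m \<noteq> 0}"
  by (rule openin_atlas_basic) auto

lemma open_phi_preimage: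
  assumes "openin (zariski JV) V"
  shows "openin TF {m \<in> F. phi m \<in> V}"
proof (subst openin_subopen, intro ballI)
  fix m0 assume m0: "m0 \<in> {m \<in> F. phi m \<in> V}"
  \<comment> \<open>The zero function is regular everywhere, and what is wanted is the principal
    neighbourhood given by q.\<close>
  have "\<exists>p\<in>polyfuns SF. \<exists>q\<in>polyfuns SF. q m0 \<noteq> 0 \<and>
    (\<forall>m\<in>F. (\<lambda>_. 0) (phi m) * q m = p m \<and> (q m \<noteq> 0 \<longrightarrow> phi m \<in> V))"
    by (rule phi_local[OF assms]) (use m0 regC_const in auto)
  then obtain q where "q \<in> polyfuns SF" "q m0 \<noteq> 0" "\<forall>m\<in>F. q m \<noteq> 0 \<longrightarrow> phi m \<in> V" by blast
  then show "\<exists>T. openin TF T \<and> m0 \<in> T \<and> T \<subseteq> {m \<in> F. phi m \<in> V}"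
    using open_fibre_basic m0 by (intro exI[of _ "{m \<in> F. q m \<noteq> 0}"]) auto
qed

lemma phi_morphism: "fspace_morphism (mu_fibre_variety g f) (open_subspace JV theta_compl) phi"
  unfolding fspace_morphism_def zariski_compl regular_compl fibre_variety zariski_atlas_space topspace_TF
proof (intro conjI allI impI)
  show "continuous_map TF (subtopology (zariski JV) theta_compl) phi"
    unfolding continuous_map_def topspace_compl topspace_TF
    using phi_compl open_phi_preimage open_compl by (auto simp: openin_open_subtopology)
  fix V h assume "openin (subtopology (zariski JV) theta_compl) V \<and> h \<in> regular JV V"
  then have V: "openin (zariski JV) V" and h: "h \<circ> AJ \<in> regular (atlas_space Ag) {P \<in> Cg. AJ P \<in> V}"
    using open_compl regular_JV by (auto simp: openin_open_subtopology)
  have hr: "regC (\<lambda>P. h (AJ P)) P" if "P \<in> C0" "AJ P \<in> V" for P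
  proof -
    have "P \<in> {P \<in> Cg. AJ P \<in> V}" using that C0_Ug Ug_Cg by blast
    from regular_regC[OF h this that(1)] show ?thesis by (simp add: o_def)
  qed
  show "h \<circ> phi \<in> regular (atlas_space {(F, SF)}) {m \<in> F. phi m \<in> V}"
  proof (rule regular_atlasI[OF open_phi_preimage[OF V]])
    fix m0 assume m0: "m0 \<in> {m \<in> F. phi m \<in> V}"
    then obtain p q where pq: "p \<in> polyfuns SF" "q \<in> polyfuns SF" "q m0 \<noteq> 0"
      "\<And>m. m \<in> F \<Longrightarrow> h (phi m) * q m = p m"
      using phi_local[OF V _ _ hr, of m0] by blast
    have "reg_at TF SF (h \<circ> phi) m0"
    proof (rule reg_atI[OF pq(1,2) open_fibre_basic[OF pq(2)]])
      fix m assume "m \<in> {m \<in> F. q m \<noteq> 0}"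
      then show "q m \<noteq> 0" "(h \<circ> phi) m = p m / q m" using pq(4)[of m] by (auto simp: eq_divide_eq)
    qed (use m0 pq in auto)
    then show "\<exists>(U, S)\<in>{(F, SF)}. m0 \<in> U \<and> reg_at TF S (h \<circ> phi) m0" using m0 by auto
  qed
qed

lemma isomorphic: "fspace_isomorphic (mu_fibre_variety g f) (open_subspace JV theta_compl)"
  unfolding fspace_isomorphic_def
proof (intro exI conjI ballI)
  show "fspace_morphism (mu_fibre_variety g f) (open_subspace JV theta_compl) phi" by (rule phi_morphism)
  show "fspace_morphism (open_subspace JV theta_compl) (mu_fibre_variety g f) psi" by (rule psi_morphism)
  show "psi (phi m) = m" if "m \<in> topspace (zariski (mu_fibre_variety g f))" for m
    using that psi_phi by (simp add: fibre_variety topspace_TF)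
  show "phi (psi c) = c" if "c \<in> topspace (zariski (open_subspace JV theta_compl))" for c
    using that psi(2) unfolding zariski_compl topspace_compl by blast
qed

end

theorem proposition4p6:
  fixes g :: nat and f :: "complex poly"
  assumes "g \<ge> 1" and "degree f = 2 * g + 1" and "rsquarefree f" and "poly f 0 = 1"
  defines "\<Theta> \<equiv> theta_divisor g f"
    and "\<Theta>\<^sub>p \<equiv> theta_translate g f 1"
    and "\<Theta>\<^sub>m \<equiv> theta_translate g f (-1)"
  shows "openin (zariski (Jac_variety g f)) (carrier (Jac g f) - (\<Theta> \<union> \<Theta>\<^sub>p \<union> \<Theta>\<^sub>m)) \<and>
    fspace_isomorphic (mu_fibre_variety g f)
      (open_subspace (Jac_variety g f) (carrier (Jac g f) - (\<Theta> \<union> \<Theta>\<^sub>p \<union> \<Theta>\<^sub>m))) \<and>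
    (\<lambda>c. inv\<^bsub>Jac g f\<^esub> c) ` \<Theta> = \<Theta> \<and>
    (\<lambda>c. inv\<^bsub>Jac g f\<^esub> c) ` \<Theta>\<^sub>p = \<Theta>\<^sub>m \<and>
    (\<lambda>c. inv\<^bsub>Jac g f\<^esub> c) ` \<Theta>\<^sub>m = \<Theta>\<^sub>p"
proof -
  interpret hyperelliptic g f by unfold_locales fact+
  show ?thesis
    using open_compl isomorphic inv_theta inv_translate[of 1] inv_translate[of "-1"]
    unfolding theta_compl_def \<Theta>_def \<Theta>\<^sub>p_def \<Theta>\<^sub>m_def by simp
qed

end
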